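(* For every integer $r\ge 0$, there exists an integer $t_0=t_0(r)$, depending only on $r$, such that for all $n\ge t\ge t_0(r)$ and all $p$ with $\frac{r}{t+2r-1}\le p\le \frac{r+1}{t+2r+1}$, the following holds. If $\mathcal A,\mathcal B\subset 2^{[n]}$ are cross $t$-intersecting, then $$\mu_p(\mathcal A)\,\mu_p(\mathcal B)\le \mu_p(\mathcal F^t_r)^2 .$$ Moreover, equality holds if and only if one of the following holds: (i) $\mathcal A=\mathcal B\cong\mathcal F^t_{r-1}$ and $p=\frac{r}{t+2r-1}$; (ii) $\mathcal A=\mathcal B\cong\mathcal F^t_r$ and $\frac{r}{t+2r-1}\le p\le\frac{r+1}{t+2r+1}$; or (iii) $\mathcal A=\mathcal B\cong\mathcal F^t_{r+1}$ and $p=\frac{r+1}{t+2r+1}$.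
   Context: Here $n\ge t$ are positive integers. For a positive integer $m$, $[m]=\{1,\dots,m\}$, and $2^{[n]}$ is the set of all subsets of $[n]$. For a real number $p\in(0,1)$ and $\mathcal A\subset 2^{[n]}$, the product measure is $\mu_p(\mathcal A)=\sum_{A\in\mathcal A}p^{|A|}(1-p)^{n-|A|}$. Families $\mathcal A,\mathcal B\subset 2^{[n]}$ are cross $t$-intersecting if $|A\cap B|\ge t$ for all $A\in\mathcal A$ and $B\in\mathcal B$. For a non-negative integer $r$, $\mathcal F^t_r=\{F\subset[n]: |F\cap[t+2r]|\ge t+r\}$. Two families $\mathcal A,\mathcal A'\subset 2^{[n]}$ are isomorphic, denoted $\mathcal A\cong\mathcal A'$, if $\mathcal A'=\{\{\pi(a):a\in A\}:A\in\mathcal A\}$, where $\pi$ is a permutation of $[n]$.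
   Formalization: The formal theorem assumes n ≥ t+2r (for r ≥ 1 and t ≤ n < t+2r the inequality fails, e.g. n = t, A = B = {[t]}) and allows case (iii) only if n ≥ t+2r+2, since for n = t+2r or t+2r+1 its family has smaller measure; case (i) needs r ≥ 1. *)

theory Defs
  imports Complex_Main "HOL-Combinatorics.Permutations"
begin

text \<open>The ground set \<open>[n]\<close> is \<open>{1..n}\<close>; a family on \<open>[n]\<close> is a subset of \<open>Pow {1..n}\<close>.\<close>

definition mu :: "nat \<Rightarrow> real \<Rightarrow> nat set set \<Rightarrow> real" where
  "mu n p \<A> = (\<Sum>A\<in>\<A>. p ^ card A * (1 - p) ^ (n - card A))"

definition cross_intersecting :: "nat \<Rightarrow> nat set set \<Rightarrow> nat set set \<Rightarrow> bool" where
  "cross_intersecting t \<A> \<B> \<longleftrightarrow> (\<forall>A\<in>\<A>. \<forall>B\<in>\<B>. t \<le> card (A \<inter> B))"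

text \<open>This is the intended family only if \<open>[t + 2r] \<subseteq> [n]\<close>, i.e. \<open>t + 2 * r \<le> n\<close>. For smaller
  \<open>n\<close> the formula degenerates; it gives the empty family if \<open>n < t + r\<close>.\<close>

definition frankl_family :: "nat \<Rightarrow> nat \<Rightarrow> nat \<Rightarrow> nat set set" where
  "frankl_family n t r = {F. F \<subseteq> {1..n} \<and> t + r \<le> card (F \<inter> {1..t + 2 * r})}"

definition isomorphic_families :: "nat \<Rightarrow> nat set set \<Rightarrow> nat set set \<Rightarrow> bool" where
  "isomorphic_families n \<A> \<A>' \<longleftrightarrow>
     (\<exists>\<pi>. \<pi> permutes {1..n} \<and> \<A>' = (\<lambda>A. \<pi> ` A) ` \<A>)"

end

theory Submission
  imports Defs
begin

text \<open>A set \<open>F\<close> is read as a lattice walk whose height after \<open>s\<close> steps is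
\<open>2 |F \<inter> [s]| - s\<close>. Write \<open>q = 1 - p\<close> and \<open>\<alpha> = p / q\<close>; a random walk ever reaches height
\<open>u\<close> with probability at most \<open>\<alpha>^u\<close>. Compressing both families to the left keeps the measures and the
cross \<open>t\<close>-intersection property, and for compressed families every \<open>A \<in> \<A>\<close> and \<open>B \<in> \<B>\<close> have a
step at which their heights sum to at least \<open>2t\<close> (lemma \<open>compressed_common_peak\<close>). If
\<open>u\<close> and \<open>v\<close> are the lowest peaks in \<open>\<A>\<close> and \<open>\<B>\<close>, then \<open>u + v \<ge> 2t\<close> and the product of the
measures is at most \<open>\<alpha>^(u + v)\<close>. The target \<open>\<mu>(\<F>\<^sup>t\<^sub>r)\<^sup>2\<close> is at least a constant
(depending on \<open>r\<close> only) times \<open>\<alpha>^(2t)\<close>, while \<open>p \<le> (r + 1) / t\<close> tends to \<open>0\<close>. So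
every loss of a factor \<open>p\<close> is unaffordable, and in particular \<open>u + v = 2t\<close>.

The decisive observation is that a walk which reaches height \<open>u\<close> reaches or exceeds it a second time
only with conditional probability \<open>O(p)\<close>. Up to an unaffordable loss, the families therefore consist of
walks that are at their lowest peak exactly once. Two such walks \<open>A\<close>, \<open>B\<close> have to be at height \<open>u\<close>
and \<open>v\<close> at the same step, hence all of them are there at one common step \<open>N\<close>
(lemma \<open>pairs_meet_on_level\<close>). With \<open>u = N - 2k\<close> and \<open>v = N - 2l\<close> this says that
\<open>A\<close> misses exactly \<open>k\<close> and \<open>B\<close> exactly \<open>l\<close> elements of \<open>[N]\<close>, where
\<open>N = t + k + l\<close>; and \<open>k\<close>, \<open>l\<close> are bounded in terms of \<open>r\<close>, since a deep level carries too little measure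
(lemma \<open>shallow_level\<close>).

It remains to exclude sets \<open>F \<in> \<A>\<close> that miss more than \<open>k\<close> elements of \<open>[N]\<close>. If such
an \<open>F\<close> has peak \<open>u + i\<close>, it is incompatible with every \<open>B\<close> whose walk rises straight to height
\<open>v\<close> at step \<open>N\<close> and sinks by more than \<open>i\<close> afterwards. For small \<open>i\<close> these are nearly all sets that miss
\<open>l\<close> elements of \<open>[N]\<close>, so \<open>\<B>\<close> would be negligible (lemma \<open>low_peak_impossible\<close>); for large
\<open>i\<close> the extra sets have measure \<open>\<alpha>^(u + i)\<close>, far less than what they cost in \<open>\<B>\<close>
(lemma \<open>deep_sets_cost\<close>). Hence the product of the measures is at most that of the two
threshold families on \<open>[N]\<close> with parameters \<open>k\<close> and \<open>l\<close>, with equality only for these families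
(lemma \<open>common_peak_bound\<close>).

The measures of threshold families are binomial tails, and their products are compared exactly
(lemma \<open>tail_product_bound\<close>): log-concavity moves \<open>k\<close> and \<open>l\<close> together until they differ by
at most one, a direct estimate excludes \<open>l = k + 1\<close>, and \<open>k = l\<close> is maximal at
\<open>k = r\<close>, tied with a neighbour only at an end of the range of \<open>p\<close>. Finally, if the
compressed families are one and the same threshold family, so were the original ones, on a possibly
different ground set \<open>T\<close> (lemma \<open>unshift_threshold\<close>); this gives the cases of equality.\<close>

section \<open>Tails of the binomial distribution\<close>

text \<open>The probability that exactly \<open>j\<close> elements of \<open>[N]\<close> are missing from a \<open>p\<close>-random set.\<close>

definition binom_weight :: "real \<Rightarrow> nat \<Rightarrow> nat \<Rightarrow> real" where
  "binom_weight p N j = real (N choose j) * p ^ (N - j) * (1 - p) ^ j"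

definition binom_tail :: "real \<Rightarrow> nat \<Rightarrow> nat \<Rightarrow> real" where
  "binom_tail p N k = (\<Sum>j\<le>k. binom_weight p N j)"

lemma binom_weight_nonneg: "0 \<le> p \<Longrightarrow> p \<le> 1 \<Longrightarrow> 0 \<le> binom_weight p N j"
  by (simp add: binom_weight_def)

lemma binom_weight_pos: "0 < p \<Longrightarrow> p < 1 \<Longrightarrow> j \<le> N \<Longrightarrow> 0 < binom_weight p N j"
  by (simp add: binom_weight_def)

lemma binom_weight_le_tail: "0 \<le> p \<Longrightarrow> p \<le> 1 \<Longrightarrow> binom_weight p N k \<le> binom_tail p N k"
  unfolding binom_tail_def by (rule member_le_sum) (auto simp: binom_weight_nonneg)

lemma binom_tail_pos: "0 < p \<Longrightarrow> p < 1 \<Longrightarrow> 0 < binom_tail p N k"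
  unfolding binom_tail_def
  by (rule sum_pos2[of _ 0]) (auto simp: binom_weight_nonneg binom_weight_pos)

lemma binom_tail_Suc_right: "binom_tail p N (Suc k) = binom_tail p N k + binom_weight p N (Suc k)"
  by (simp add: binom_tail_def)

lemma binom_weight_pascal:
  "binom_weight p (Suc N) (Suc j) = p * binom_weight p N (Suc j) + (1 - p) * binom_weight p N j"
proof (cases "Suc j \<le> N")
  case True
  then obtain d where d: "N = Suc j + d" using le_Suc_ex by blast
  then have "N - j = Suc d" "N - Suc j = d" by auto
  then show ?thesis by (simp add: binom_weight_def algebra_simps)
next
  case False
  then show ?thesis by (simp add: binom_weight_def binomial_eq_0 algebra_simps)
qed

lemma binom_tail_Suc_left: "binom_tail p (Suc N) k = binom_tail p N k - (1 - p) * binom_weight p N k"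
proof (induction k)
  case 0
  show ?case by (simp add: binom_tail_def binom_weight_def algebra_simps)
next
  case (Suc k)
  show ?case
    by (simp only: binom_tail_Suc_right Suc.IH binom_weight_pascal) (simp add: algebra_simps)
qed

lemma binom_tail_Suc_Suc: "binom_tail p (Suc N) (Suc k) = binom_tail p N k + p * binom_weight p N (Suc k)"
  by (simp only: binom_tail_Suc_right binom_tail_Suc_left binom_weight_pascal)

lemma binom_weight_ratio:
  assumes "j \<le> N"
  shows "p * real (Suc j) * binom_weight p N (Suc j) = (1 - p) * real (N - j) * binom_weight p N j"
proof (cases "j = N")
  case True then show ?thesis by (simp add: binom_weight_def)
next
  case False
  with assms obtain d where d: "N = Suc (j + d)" using less_imp_Suc_add[of j N] by auto
  have "Suc j * (N choose Suc j) = (N - j) * (N choose j)"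
    using binomial_absorption[of j N] binomial_absorb_comp[of N j] assms
    by (metis)
  then have c: "real (Suc j) * real (N choose Suc j) = real (N - j) * real (N choose j)"
    by (metis of_nat_mult)
  have e: "N - j = Suc d" "N - Suc j = d" using d by auto
  have "p * real (Suc j) * binom_weight p N (Suc j)
      = (real (Suc j) * real (N choose Suc j)) * (p * p ^ d) * (1 - p) ^ Suc j"
    unfolding binom_weight_def e by (simp only: mult_ac)
  also have "\<dots> = (1 - p) * real (N - j) * binom_weight p N j"
    unfolding c unfolding binom_weight_def e by (simp add: mult_ac)
  finally show ?thesis .
qed

text \<open>The ratio of consecutive weights, given by \<open>binom_weight_ratio\<close>, decreases in the index.\<close>

lemma binom_weight_log_concave:
  assumes p: "0 < p" "p < 1" and "i \<le> j" "j + d \<le> N"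
  shows "binom_weight p N i * binom_weight p N (j + d) \<le> binom_weight p N (i + d) * binom_weight p N j"
  using assms(4)
proof (induction d)
  case 0
  then show ?case by simp
next
  case (Suc d)
  define a where "a = binom_weight p N"
  define m where "m = i + d"
  define m' where "m' = j + d"
  have mm: "m \<le> m'" "Suc m' \<le> N" using Suc.prems assms(3) by (auto simp: m_def m'_def)
  have q: "0 < 1 - p" using p by simp
  have a0: "0 \<le> a x" for x using p by (simp add: a_def binom_weight_nonneg)
  have IH: "a i * a m' \<le> a m * a j" using Suc by (simp add: a_def m_def m'_def)
  have r1: "p * real (Suc m) * a (Suc m) = (1 - p) * real (N - m) * a m"
    unfolding a_def by (rule binom_weight_ratio) (use mm in simp)
  have r2: "p * real (Suc m') * a (Suc m') = (1 - p) * real (N - m') * a m'"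
    unfolding a_def by (rule binom_weight_ratio) (use mm in simp)
  have "(p * real (Suc m')) * (a i * a (Suc m')) = (1 - p) * real (N - m') * (a i * a m')"
    using r2 by (simp add: mult_ac)
  also have "\<dots> \<le> (1 - p) * real (N - m) * (a m * a j)"
    by (intro mult_mono IH) (use mm q a0 in auto)
  also have "\<dots> = p * real (Suc m) * (a (Suc m) * a j)"
    using r1 by (simp add: mult_ac)
  also have "\<dots> \<le> (p * real (Suc m')) * (a (Suc m) * a j)"
    by (intro mult_right_mono mult_left_mono) (use mm p a0 in auto)
  finally have "a i * a (Suc m') \<le> a (Suc m) * a j"
    using p by (simp add: mult_le_cancel_left)
  then show ?case by (simp add: a_def m_def m'_def)
qed

text \<open>Partial sums of a log-concave sequence are log-concave. After cancelling
  \<open>S\<^sub>k S\<^sub>l\<^sub>-\<^sub>1\<close> the claim reads \<open>S\<^sub>k a\<^sub>l < a\<^sub>k\<^sub>+\<^sub>1 S\<^sub>l\<^sub>-\<^sub>1\<close>,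
  which follows term by term; the term \<open>a\<^sub>0\<close> of \<open>S\<^sub>l\<^sub>-\<^sub>1\<close> is left over and makes it strict.\<close>

lemma binom_tail_log_concave:
  assumes p: "0 < p" "p < 1" and "k + 2 \<le> l" "l \<le> N"
  shows "binom_tail p N k * binom_tail p N l < binom_tail p N (Suc k) * binom_tail p N (l - 1)"
proof -
  define a where "a = binom_weight p N"
  define d where "d = l - 1 - k"
  have d: "d \<ge> 1" "l = Suc k + d" "l - 1 = k + d" using assms(3) by (auto simp: d_def)
  have a0: "0 \<le> a x" for x using p by (simp add: a_def binom_weight_nonneg)
  have "binom_tail p N k * a l = (\<Sum>j\<le>k. a j * a (Suc k + d))"
    by (simp add: binom_tail_def a_def d sum_distrib_right)
  also have "\<dots> \<le> (\<Sum>j\<le>k. a (j + d) * a (Suc k))"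
    unfolding a_def
    by (intro sum_mono binom_weight_log_concave) (use p assms(4) d in auto)
  also have "\<dots> = (\<Sum>j\<in>{d..k+d}. a j) * a (Suc k)"
    by (subst sum_distrib_right[symmetric], rule arg_cong[where f="\<lambda>x. x * _"],
        rule sum.reindex_bij_witness[of _ "\<lambda>j. j - d" "\<lambda>j. j + d"]) auto
  also have "\<dots> < (\<Sum>j\<le>k+d. a j) * a (Suc k)"
  proof (intro mult_strict_right_mono)
    have "(\<Sum>j\<in>{d..k+d}. a j) < a 0 + (\<Sum>j\<in>{d..k+d}. a j)"
      using p by (simp add: a_def binom_weight_pos)
    also have "\<dots> = (\<Sum>j\<in>insert 0 {d..k+d}. a j)" using d by simp
    also have "\<dots> \<le> (\<Sum>j\<le>k+d. a j)"
      by (rule sum_mono2) (use a0 in auto)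
    finally show "(\<Sum>j\<in>{d..k+d}. a j) < (\<Sum>j\<le>k+d. a j)" .
    show "0 < a (Suc k)" using assms p unfolding a_def by (intro binom_weight_pos) auto
  qed
  finally have *: "binom_tail p N k * a l < binom_tail p N (l - 1) * a (Suc k)"
    unfolding d(3) by (simp add: binom_tail_def a_def)
  have "binom_tail p N l = binom_tail p N (l - 1) + a l"
    using binom_tail_Suc_right[of p N "l - 1"] assms(3) by (simp add: a_def)
  then show ?thesis
    using * by (simp add: binom_tail_Suc_right a_def algebra_simps)
qed

text \<open>The weights decrease below \<open>k\<close> at least as fast as a geometric sequence, so the tail is dominated by
  its last weight.\<close>

lemma binom_tail_geometric:
  assumes p: "0 < p" "p < 1" and "k \<le> N"
  shows "(1 - p) * real (N - k + 1) * (binom_tail p N k - binom_weight p N k) \<le> p * real k * binom_tail p N k"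
proof (cases k)
  case 0 then show ?thesis by (simp add: binom_tail_def)
next
  case (Suc m)
  define a where "a = binom_weight p N"
  have a0: "0 \<le> a x" for x using p by (simp add: a_def binom_weight_nonneg)
  have "(1 - p) * real (N - k + 1) * (binom_tail p N k - binom_weight p N k)
      = (\<Sum>j\<le>m. (1 - p) * real (N - k + 1) * a j)"
    by (simp add: Suc binom_tail_Suc_right) (simp add: binom_tail_def a_def sum_distrib_left)
  also have "\<dots> \<le> (\<Sum>j\<le>m. p * real k * a (Suc j))"
  proof (rule sum_mono)
    fix j assume j: "j \<in> {..m}"
    have "(1 - p) * real (N - k + 1) * a j \<le> (1 - p) * real (N - j) * a j"
      by (intro mult_right_mono mult_left_mono) (use p a0 Suc j assms(3) in auto)
    also have "\<dots> = p * real (Suc j) * a (Suc j)"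
      unfolding a_def by (rule binom_weight_ratio[symmetric]) (use j Suc assms(3) in auto)
    also have "\<dots> \<le> p * real k * a (Suc j)"
      by (intro mult_right_mono mult_left_mono) (use p a0 Suc j in auto)
    finally show "(1 - p) * real (N - k + 1) * a j \<le> p * real k * a (Suc j)" .
  qed
  also have "\<dots> = p * real k * (\<Sum>j\<in>{1..k}. a j)"
    unfolding sum_distrib_left Suc
    by (rule sum.reindex_bij_witness[of _ "\<lambda>j. j - 1" Suc]) auto
  also have "\<dots> \<le> p * real k * binom_tail p N k"
    unfolding binom_tail_def a_def[symmetric]
    by (intro mult_left_mono sum_mono2) (use p a0 in auto)
  finally show ?thesis .
qed

text \<open>Passing from \<open>\<F>\<^sup>t\<^sub>k\<close> to \<open>\<F>\<^sup>t\<^sub>k\<^sub>+\<^sub>1\<close> only affects sets that miss \<open>k\<close> or \<open>k + 1\<close> elements of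
  \<open>[t + 2k]\<close>; the two weights are tied by the factor \<open>c = (t + k) / (k + 1)\<close>.\<close>

lemma central_tail_step:
  fixes t k :: nat
  assumes p: "0 < p" "p < 1" and "0 < t"
  defines "N \<equiv> t + 2 * k"
  defines "c \<equiv> real (t + k) / real (k + 1)"
  shows "p * binom_weight p N (Suc k) = (1 - p) * c * binom_weight p N k"
    and "binom_tail p (t + 2 * Suc k) (Suc k)
       = binom_tail p N k + (1 - p) * binom_weight p N k * (p * c - (1 - p))"
proof -
  have "p * real (Suc k) * binom_weight p N (Suc k) = (1 - p) * real (N - k) * binom_weight p N k"
    by (rule binom_weight_ratio) (simp add: N_def)
  then show 1: "p * binom_weight p N (Suc k) = (1 - p) * c * binom_weight p N k"
    by (simp add: c_def N_def field_simps)
  have "t + 2 * Suc k = Suc (Suc N)" by (simp add: N_def)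
  then have "binom_tail p (t + 2 * Suc k) (Suc k)
      = binom_tail p N k + p * binom_weight p N (Suc k) - (1 - p) * (p * binom_weight p N (Suc k) + (1 - p) * binom_weight p N k)"
    by (simp only: binom_tail_Suc_left binom_tail_Suc_Suc binom_weight_pascal)
       (simp add: binom_tail_Suc_right binom_tail_Suc_left binom_weight_pascal algebra_simps)
  then show "binom_tail p (t + 2 * Suc k) (Suc k)
       = binom_tail p N k + (1 - p) * binom_weight p N k * (p * c - (1 - p))"
    unfolding 1 by (simp add: algebra_simps)
qed

text \<open>In the situation of \<open>adjacent_tail_product\<close>, \<open>S\<close> is the measure of \<open>\<F>\<^sup>t\<^sub>k\<close> and \<open>x\<close> its
  last weight. The margin is small: at the critical value of \<open>p\<close> the sides differ by a relative error of order \<open>1 / t\<close>, so the sharp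
  bound \<open>\<kappa> < 1 / c\<close> on the geometric decay of the tail matters.\<close>

lemma adjacent_real_inequality:
  fixes p c \<kappa> S x :: real
  assumes p: "0 < p" "p < 1 / 2" and S: "0 < S" and x: "0 < x" and c: "1 \<le> c" and "\<kappa> < 1 / c"
    and tail: "S * ((1 - p) - p * \<kappa>) \<le> (1 - p) * x"
  shows "p * c \<le> 1 - p \<Longrightarrow> (S + (1 - p) * c * x) * (S - (1 - p) * x) < S\<^sup>2"
    and "1 - p \<le> p * c \<Longrightarrow> (S + (1 - p) * c * x) * (S - (1 - p) * x)
           < (S + (1 - p) * x * (p * c - (1 - p)))\<^sup>2"
proof -
  have kc: "\<kappa> * c < 1" using assms(6) c by (simp add: field_simps)
  have pk: "p * (\<kappa> * c) < p" using mult_strict_left_mono[OF kc p(1)] by simp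
  assume h: "p * c \<le> 1 - p"
  have "c - 1 < c * ((1 - p) - p * \<kappa>)" using pk h by (simp add: algebra_simps)
  then have "S * (c - 1) < S * (c * ((1 - p) - p * \<kappa>))" using S by simp
  also have "\<dots> = c * (S * ((1 - p) - p * \<kappa>))" by simp
  also have "\<dots> \<le> c * ((1 - p) * x)" using tail c by (intro mult_left_mono) auto
  finally have *: "S * (c - 1) < c * ((1 - p) * x)" .
  have "(S + (1 - p) * c * x) * (S - (1 - p) * x) - S\<^sup>2 = (1 - p) * x * (S * (c - 1) - c * ((1 - p) * x))"
    by (simp add: power2_eq_square algebra_simps)
  also have "\<dots> < 0" using * p x by (intro mult_pos_neg) auto
  finally show "(S + (1 - p) * c * x) * (S - (1 - p) * x) < S\<^sup>2" by simp
next
  have kc: "\<kappa> * c < 1" using assms(6) c by (simp add: field_simps)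
  assume h: "1 - p \<le> p * c"
  \<comment> \<open>The normalisation in which the assumption reads \<open>P \<ge> 1\<close> and the critical value is \<open>P = 1\<close>.\<close>
  define P where "P = p * (c + 1)"
  have P1: "1 \<le> P" using h by (simp add: P_def algebra_simps)
  have "p * (c + 1) \<le> (1/2) * (2 * c)" by (intro mult_mono) (use p c in auto)
  then have Pc: "P \<le> c" by (simp add: P_def)
  have pos: "0 < c + (P - 1)\<^sup>2" using c by (simp add: add_pos_nonneg)
  have "p * \<kappa> < p * (1 / c)" using assms(6) p by (intro mult_strict_left_mono) auto
  then have "1 - P / c < (1 - p) - p * \<kappa>"
    using c by (simp add: P_def field_simps)
  then have st: "S * (1 - P / c) < (1 - p) * x" using tail S
    by (meson less_le_trans mult_strict_left_mono)
  have "(c + 1) * (1 - 2 * p) = c + 1 - 2 * P" by (simp add: P_def algebra_simps)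
  also have "\<dots> \<le> c - P + (P - 1)\<^sup>2 * (1 - P / c)"
  proof -
    have "0 \<le> (P - 1)\<^sup>2 * (1 - P / c)" using Pc c by (intro mult_nonneg_nonneg) (auto simp: field_simps)
    then show ?thesis using P1 by simp
  qed
  also have "\<dots> = (1 - P / c) * (c + (P - 1)\<^sup>2)" using c by (simp add: field_simps)
  finally have "S * ((c + 1) * (1 - 2 * p)) \<le> S * (1 - P / c) * (c + (P - 1)\<^sup>2)"
    using S by (simp add: mult.assoc)
  also have "\<dots> < (1 - p) * x * (c + (P - 1)\<^sup>2)"
    using st pos by (intro mult_strict_right_mono) auto
  finally have *: "S * ((c + 1) * (1 - 2 * p)) < (1 - p) * x * (c + (P - 1)\<^sup>2)" .
  have "(S + (1 - p) * c * x) * (S - (1 - p) * x) - (S + (1 - p) * x * (p * c - (1 - p)))\<^sup>2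
     = (1 - p) * x * (S * ((c + 1) * (1 - 2 * p)) - (1 - p) * x * (c + (P - 1)\<^sup>2))"
    unfolding P_def by (simp add: power2_eq_square algebra_simps)
  also have "\<dots> < 0" using * p x by (intro mult_pos_neg) auto
  finally show "(S + (1 - p) * c * x) * (S - (1 - p) * x) < (S + (1 - p) * x * (p * c - (1 - p)))\<^sup>2"
    by simp
qed

text \<open>The \<open>p\<close>-measure of \<open>\<F>\<^sup>t\<^sub>k\<close>, see \<open>mu_frankl_family\<close>.\<close>

definition central_tail :: "real \<Rightarrow> nat \<Rightarrow> nat \<Rightarrow> real" where
  "central_tail p t k = binom_tail p (t + 2 * k) k"

lemma central_tail_pos: "0 < p \<Longrightarrow> p < 1 \<Longrightarrow> 0 < central_tail p t k"
  by (simp add: central_tail_def binom_tail_pos)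

text \<open>The closest competitors: sets with at least \<open>t + k + 1\<close> elements against sets with at least \<open>t + k\<close>
  elements of \<open>[t + 2k + 1]\<close>. They lose to the better one of \<open>\<F>\<^sup>t\<^sub>k\<close> and \<open>\<F>\<^sup>t\<^sub>k\<^sub>+\<^sub>1\<close>.\<close>

lemma adjacent_tail_product:
  assumes p: "0 < p" "p < 1 / 2" and t: "0 < t"
  shows "binom_tail p (t + 2 * k + 1) k * binom_tail p (t + 2 * k + 1) (Suc k)
       < (max (central_tail p t k) (central_tail p t (Suc k)))\<^sup>2"
proof -
  define N where "N = t + 2 * k"
  define c where "c = real (t + k) / real (k + 1)"
  define S where "S = binom_tail p N k"
  define x where "x = binom_weight p N k"
  define \<kappa> where "\<kappa> = real k / real (t + k + 1)"
  have p1: "p < 1" using p by simp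
  have S: "0 < S" and x: "0 < x" using p
    by (auto simp: S_def x_def N_def intro!: binom_tail_pos binom_weight_pos)
  have c1: "1 \<le> c" using t by (simp add: c_def field_simps)
  have \<kappa>: "\<kappa> < 1 / c" using t by (simp add: \<kappa>_def c_def field_simps)
  have "(1 - p) * real (t + k + 1) * (S - x) \<le> p * real k * S"
    using binom_tail_geometric[OF p(1) p1, of k N] by (simp add: S_def x_def N_def add.commute)
  then have tail: "S * ((1 - p) - p * \<kappa>) \<le> (1 - p) * x"
    unfolding \<kappa>_def by (simp add: field_simps)
  have y: "p * binom_weight p N (Suc k) = (1 - p) * c * x"
    using central_tail_step(1)[OF p(1) p1 t, of k] unfolding N_def c_def x_def by simp
  have V': "central_tail p t (Suc k) = S + (1 - p) * x * (p * c - (1 - p))"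
    using central_tail_step(2)[OF p(1) p1 t, of k] unfolding central_tail_def N_def c_def x_def S_def by simp
  have V: "central_tail p t k = S" by (simp add: central_tail_def S_def N_def)
  have L: "binom_tail p (t + 2 * k + 1) k * binom_tail p (t + 2 * k + 1) (Suc k)
      = (S + (1 - p) * c * x) * (S - (1 - p) * x)"
    using binom_tail_Suc_left[of p N k] binom_tail_Suc_Suc[of p N k] y
    by (simp add: N_def S_def x_def mult.commute)
  show ?thesis
  proof (cases "p * c \<le> 1 - p")
    case True
    have "(S + (1 - p) * c * x) * (S - (1 - p) * x) < S\<^sup>2"
      by (rule adjacent_real_inequality(1)[OF p S x c1 \<kappa> tail True])
    also have "\<dots> \<le> (max (central_tail p t k) (central_tail p t (Suc k)))\<^sup>2"
      using S V by (intro power_mono) auto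
    finally show ?thesis unfolding L .
  next
    case False
    then have "(S + (1 - p) * c * x) * (S - (1 - p) * x) < (S + (1 - p) * x * (p * c - (1 - p)))\<^sup>2"
      by (intro adjacent_real_inequality(2)[OF p S x c1 \<kappa> tail]) auto
    also have "\<dots> = (central_tail p t (Suc k))\<^sup>2" by (simp add: V')
    also have "\<dots> \<le> (max (central_tail p t k) (central_tail p t (Suc k)))\<^sup>2"
      using central_tail_pos[OF p(1) p1, of t "Suc k"] by (intro power_mono) auto
    finally show ?thesis unfolding L .
  qed
qed

text \<open>The value of \<open>p\<close> at which \<open>\<F>\<^sup>t\<^sub>k\<close> and \<open>\<F>\<^sup>t\<^sub>k\<^sub>+\<^sub>1\<close> have equal measure.\<close>

definition critical_prob :: "nat \<Rightarrow> nat \<Rightarrow> real" where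
  "critical_prob t k = (real k + 1) / (real t + 2 * real k + 1)"

lemma critical_prob_strict_mono: "2 \<le> t \<Longrightarrow> k < l \<Longrightarrow> critical_prob t k < critical_prob t l"
proof -
  assume t: "2 \<le> t" and kl: "k < l"
  have "critical_prob t j < critical_prob t (Suc j)" for j
    using t unfolding critical_prob_def by (simp add: field_simps)
  then show ?thesis using kl strict_mono_Suc_iff[of "critical_prob t"] by (auto simp: strict_mono_def)
qed

lemma central_tail_compare:
  assumes p: "0 < p" "p < 1" and t: "0 < t"
  shows "central_tail p t (Suc k) < central_tail p t k \<longleftrightarrow> p < critical_prob t k"
    and "central_tail p t (Suc k) = central_tail p t k \<longleftrightarrow> p = critical_prob t k"
proof -
  define x where "x = (1 - p) * binom_weight p (t + 2 * k) k"
  define d where "d = p * (real (t + k) / real (k + 1)) - (1 - p)"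
  have x: "0 < x" using p by (auto simp: x_def intro!: mult_pos_pos binom_weight_pos)
  have e: "central_tail p t (Suc k) = central_tail p t k + x * d"
    using central_tail_step(2)[OF p t, of k] by (simp add: central_tail_def x_def d_def)
  have d1: "d < 0 \<longleftrightarrow> p < critical_prob t k" "d = 0 \<longleftrightarrow> p = critical_prob t k"
    using t by (auto simp: d_def critical_prob_def field_simps)
  show "central_tail p t (Suc k) < central_tail p t k \<longleftrightarrow> p < critical_prob t k"
    unfolding e d1(1)[symmetric] using x by (auto simp: mult_less_0_iff)
  show "central_tail p t (Suc k) = central_tail p t k \<longleftrightarrow> p = critical_prob t k"
    unfolding e d1(2)[symmetric] using x by auto
qed

text \<open>The indices \<open>k\<close> for which \<open>\<F>\<^sup>t\<^sub>k\<close> is optimal when \<open>p\<close> lies between the critical values for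
  \<open>r - 1\<close> and \<open>r\<close>.\<close>

definition extremal_index :: "real \<Rightarrow> nat \<Rightarrow> nat \<Rightarrow> nat \<Rightarrow> bool" where
  "extremal_index p t r k \<longleftrightarrow> k = r \<or> (Suc k = r \<and> p = critical_prob t k) \<or> (k = Suc r \<and> p = critical_prob t r)"

text \<open>The critical values increase with the index, so the measures of \<open>\<F>\<^sup>t\<^sub>k\<close> increase up to \<open>k = r\<close> and
  decrease from there on; only a step at a critical value is flat.\<close>

lemma central_tail_unimodal:
  assumes p: "0 < p" "p < 1" and t: "2 \<le> t"
    and hi: "p \<le> critical_prob t r" and lo: "\<And>j. Suc j = r \<Longrightarrow> critical_prob t j \<le> p"
  shows "central_tail p t k \<le> central_tail p t r"
    and "central_tail p t k = central_tail p t r \<longleftrightarrow> extremal_index p t r k"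
proof -
  have t0: "0 < t" using t by simp
  note cmp = central_tail_compare[OF p t0]
  let ?V = "central_tail p t"
  have up: "?V (r + Suc d) \<le> ?V (r + 1) \<and> ?V (r + 1) \<le> ?V r \<and> (0 < d \<longrightarrow> ?V (r + Suc d) < ?V (r + 1))" for d
  proof (induction d)
    case 0 
    show ?case using cmp[of r] hi by fastforce
  next
    case (Suc d)
    have "p < critical_prob t (r + Suc d)"
      using hi critical_prob_strict_mono[OF t, of r "r + Suc d"] by simp
    then have "?V (Suc (r + Suc d)) < ?V (r + Suc d)" using cmp by blast
    then show ?case using Suc by auto
  qed
  have down: "d < r \<Longrightarrow> ?V (r - Suc d) \<le> ?V (r - 1) \<and> ?V (r - 1) \<le> ?V r \<and> (0 < d \<longrightarrow> ?V (r - Suc d) < ?V (r - 1))" for d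
  proof (induction d)
    case 0 
    then have "\<not> p < critical_prob t (r - 1)" using lo[of "r - 1"] by simp
    then show ?case using cmp(1)[of "r - 1"] 0 by auto
  next
    case (Suc d)
    define j where "j = r - Suc (Suc d)"
    have j: "r - Suc d = Suc j" using Suc.prems by (simp add: j_def)
    have "critical_prob t j < critical_prob t (r - 1)"
      by (rule critical_prob_strict_mono[OF t]) (use Suc.prems in \<open>auto simp: j_def\<close>)
    also have "\<dots> \<le> p" using lo[of "r - 1"] Suc.prems by simp
    finally have "critical_prob t j < p" .
    then have "?V j < ?V (Suc j)" using cmp[of j] by force
    then show ?case using Suc j by (auto simp: j_def)
  qed
  consider "k = r" | d where "k = r + Suc d" | d where "d < r" "k = r - Suc d"
  proof (cases k r rule: linorder_cases)
    case less
    then show ?thesis using that(3)[of "r - k - 1"] by auto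
  next
    case greater
    then show ?thesis using that(2)[of "k - r - 1"] by auto
  qed (use that(1) in auto)
  note cases = this
  show "?V k \<le> ?V r"
  proof (rule cases)
    fix d assume "k = r + Suc d" then show ?thesis using up[of d] by auto
  next
    fix d assume "d < r" "k = r - Suc d" then show ?thesis using down[of d] by auto
  qed auto
  show "?V k = ?V r \<longleftrightarrow> extremal_index p t r k"
  proof (rule cases)
    assume "k = r" then show ?thesis by (simp add: extremal_index_def)
  next
    fix d assume k: "k = r + Suc d"
    show ?thesis
    proof (cases "d = 0")
      case True
      then show ?thesis using k cmp(2)[of r] by (simp add: extremal_index_def)
    next
      case False
      then have "?V k < ?V r" using up[of d] k by auto
      then show ?thesis using False k by (auto simp: extremal_index_def)
    qed
  next
    fix d assume d: "d < r" and k: "k = r - Suc d"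
    show ?thesis
    proof (cases "d = 0")
      case True
      then have "Suc k = r" using d k by simp
      then show ?thesis using cmp(2)[of k] by (auto simp: extremal_index_def)
    next
      case False
      then have "?V k < ?V r" using down[OF d] k by auto
      then show ?thesis using False k d by (auto simp: extremal_index_def)
    qed
  qed
qed

text \<open>For \<open>k\<close> and \<open>l\<close> at distance at least two, log-concavity moves both towards each other without changing
  \<open>N\<close> and strictly increases the product. This ends with \<open>k = l\<close> or with neighbours.\<close>

lemma tail_product_bound:
  fixes t k l :: nat
  assumes p: "0 < p" "p < 1 / 2" and t: "2 \<le> t"
    and hi: "p \<le> critical_prob t r" and lo: "\<And>j. Suc j = r \<Longrightarrow> critical_prob t j \<le> p"
  defines "N \<equiv> t + k + l"
  shows "binom_tail p N k * binom_tail p N l \<le> (central_tail p t r)\<^sup>2"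
    and "binom_tail p N k * binom_tail p N l = (central_tail p t r)\<^sup>2 \<Longrightarrow> k = l \<and> extremal_index p t r k"
proof -
  have p1: "p < 1" using p by simp
  note uni = central_tail_unimodal[OF p(1) p1 t hi lo]
  note pos = central_tail_pos[OF p(1) p1]
  have sq: "(central_tail p t j)\<^sup>2 \<le> (central_tail p t r)\<^sup>2" for j
    using uni(1)[of j] pos[of t j] by (intro power_mono) auto
  have gap: "binom_tail p (t + 2 * k + Suc d) k * binom_tail p (t + 2 * k + Suc d) (k + Suc d) < (central_tail p t r)\<^sup>2"
    for k d
  proof (induction d arbitrary: k rule: less_induct)
    case (less d)
    consider "d = 0" | "d = 1" | e where "d = Suc (Suc e)"
      by (metis One_nat_def not0_implies_Suc)
    then show ?case
    proof cases
      case 1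
      have "binom_tail p (t + 2 * k + 1) k * binom_tail p (t + 2 * k + 1) (Suc k)
         < (max (central_tail p t k) (central_tail p t (Suc k)))\<^sup>2"
        by (rule adjacent_tail_product) (use p t in auto)
      also have "\<dots> \<le> (central_tail p t r)\<^sup>2" using sq by (simp add: max_def)
      finally show ?thesis by (simp add: 1)
    next
      case 2
      have "binom_tail p (t + 2 * k + 2) k * binom_tail p (t + 2 * k + 2) (k + 2)
         < binom_tail p (t + 2 * k + 2) (Suc k) * binom_tail p (t + 2 * k + 2) (k + 2 - 1)"
        by (rule binom_tail_log_concave) (use p1 p in auto)
      also have "\<dots> = (central_tail p t (Suc k))\<^sup>2" by (simp add: central_tail_def power2_eq_square)
      also have "\<dots> \<le> (central_tail p t r)\<^sup>2" by (rule sq)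
      finally show ?thesis by (simp add: 2 numeral_2_eq_2)
    next
      case 3
      let ?N = "t + 2 * k + Suc d"
      have "binom_tail p ?N k * binom_tail p ?N (k + Suc d)
         < binom_tail p ?N (Suc k) * binom_tail p ?N (k + Suc d - 1)"
        by (rule binom_tail_log_concave) (use p1 p 3 in auto)
      also have "\<dots> < (central_tail p t r)\<^sup>2"
        using less.IH[of e "Suc k"] by (simp add: 3)
      finally show ?thesis .
    qed
  qed
  have strict: "binom_tail p N k * binom_tail p N l < (central_tail p t r)\<^sup>2" if "k \<noteq> l"
  proof (cases "k < l")
    case True
    then obtain d where l: "l = k + Suc d" using less_imp_Suc_add by fastforce
    then have N: "N = t + 2 * k + Suc d" by (simp add: N_def)
    show ?thesis unfolding N l by (rule gap)
  next
    case False
    then have "l < k" using that by simp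
    then obtain d where k: "k = l + Suc d" using less_imp_Suc_add by fastforce
    then have N: "N = t + 2 * l + Suc d" by (simp add: N_def)
    show ?thesis unfolding N k mult.commute[of "binom_tail _ _ (l + Suc d)"] by (rule gap)
  qed
  have eq: "binom_tail p N k * binom_tail p N l = (central_tail p t k)\<^sup>2" if "k = l"
    using that by (simp add: N_def central_tail_def power2_eq_square mult_2 add.assoc)
  show "binom_tail p N k * binom_tail p N l \<le> (central_tail p t r)\<^sup>2"
    using strict eq sq[of k] by (cases "k = l") auto
  assume h: "binom_tail p N k * binom_tail p N l = (central_tail p t r)\<^sup>2"
  then have kl: "k = l" using strict by force
  then have "(central_tail p t k)\<^sup>2 = (central_tail p t r)\<^sup>2" using eq h by simp
  then have "central_tail p t k = central_tail p t r"
    using pos[of t k] pos[of t r] by (simp add: power2_eq_iff_nonneg)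
  then show "k = l \<and> extremal_index p t r k" using uni(2) kl by blast
qed

section \<open>The product measure and supermartingales on prefixes\<close>

definition set_weight :: "nat \<Rightarrow> real \<Rightarrow> nat set \<Rightarrow> real" where
  "set_weight n p F = p ^ card F * (1 - p) ^ (n - card F)"

lemma mu_set_weight: "mu n p \<A> = sum (set_weight n p) \<A>"
  by (simp add: mu_def set_weight_def)

lemma set_weight_pos: "0 < p \<Longrightarrow> p < 1 \<Longrightarrow> 0 < set_weight n p F"
  by (simp add: set_weight_def)

lemma mu_nonneg: "0 < p \<Longrightarrow> p < 1 \<Longrightarrow> 0 \<le> mu n p \<A>"
  unfolding mu_set_weight by (intro sum_nonneg less_imp_le set_weight_pos)

lemma finite_family: "\<A> \<subseteq> Pow {i..n} \<Longrightarrow> finite (\<A> :: nat set set)"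
  by (rule finite_subset) auto

lemma mu_mono: "0 < p \<Longrightarrow> p < 1 \<Longrightarrow> \<A> \<subseteq> \<B> \<Longrightarrow> \<B> \<subseteq> Pow {1..n} \<Longrightarrow> mu n p \<A> \<le> mu n p \<B>"
  unfolding mu_set_weight
  by (rule sum_mono2) (auto intro: finite_family less_imp_le set_weight_pos)

lemma mu_pos: "0 < p \<Longrightarrow> p < 1 \<Longrightarrow> \<A> \<subseteq> Pow {1..n} \<Longrightarrow> \<A> \<noteq> {} \<Longrightarrow> 0 < mu n p \<A>"
  unfolding mu_set_weight by (intro sum_pos) (auto intro: finite_family set_weight_pos)

lemma mu_Un_le:
  assumes "0 < p" "p < 1" "\<A> \<subseteq> Pow {1..n}" "\<B> \<subseteq> Pow {1..n}"
  shows "mu n p (\<A> \<union> \<B>) \<le> mu n p \<A> + mu n p \<B>"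
proof -
  have "mu n p (\<A> \<union> \<B>) = mu n p \<A> + mu n p (\<B> - \<A>)"
    unfolding mu_set_weight using assms
    by (subst sum.union_disjoint[symmetric]) (auto intro: finite_family finite_subset[OF Diff_subset])
  also have "mu n p (\<B> - \<A>) \<le> mu n p \<B>" by (rule mu_mono) (use assms in auto)
  finally show ?thesis by simp
qed

lemma mu_diff:
  assumes "\<A> \<subseteq> Pow {1..n}" "\<B> \<subseteq> \<A>"
  shows "mu n p (\<A> - \<B>) = mu n p \<A> - mu n p \<B>"
  unfolding mu_set_weight by (rule sum_diff) (use assms finite_family in auto)

lemma mu_eq_imp_eq:
  assumes "0 < p" "p < 1" "\<A> \<subseteq> \<B>" "\<B> \<subseteq> Pow {1..n}" "mu n p \<B> \<le> mu n p \<A>"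
  shows "\<A> = \<B>"
proof (rule ccontr)
  assume "\<A> \<noteq> \<B>"
  then have "0 < mu n p (\<B> - \<A>)" using assms by (intro mu_pos) auto
  then show False using assms by (simp add: mu_diff)
qed

text \<open>The event that the first \<open>m\<close> steps of the walk are those of \<open>X\<close>.\<close>

definition cylinder :: "nat \<Rightarrow> nat \<Rightarrow> nat set \<Rightarrow> nat set set" where
  "cylinder n m X = {F. F \<subseteq> {1..n} \<and> F \<inter> {1..m} = X}"

lemma cylinder_subset: "cylinder n m X \<subseteq> Pow {1..n}"
  by (auto simp: cylinder_def)

lemma cylinder_Suc:
  assumes "m \<le> n"
  shows "cylinder (Suc n) m X = cylinder n m X \<union> insert (Suc n) ` cylinder n m X" (is "?L = ?R")
proof
  show "?L \<subseteq> ?R"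
  proof
    fix F assume F: "F \<in> ?L"
    have 1: "F - {Suc n} \<in> cylinder n m X"
    proof -
      have "F - {Suc n} \<subseteq> {1..n}" using F by (fastforce simp: cylinder_def le_Suc_eq)
      moreover have "(F - {Suc n}) \<inter> {1..m} = X" using F assms by (auto simp: cylinder_def)
      ultimately show ?thesis by (simp add: cylinder_def)
    qed
    show "F \<in> ?R"
    proof (cases "Suc n \<in> F")
      case True
      then have "F = insert (Suc n) (F - {Suc n})" by auto
      then show ?thesis using 1 by blast
    next
      case False
      then show ?thesis using 1 by simp
    qed
  qed
  show "?R \<subseteq> ?L"
  proof
    fix F assume "F \<in> ?R"
    then show "F \<in> ?L"
    proof
      assume "F \<in> cylinder n m X" then show ?thesis by (auto simp: cylinder_def)
    next
      assume "F \<in> insert (Suc n) ` cylinder n m X"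
      then obtain G where "F = insert (Suc n) G" "G \<subseteq> {1..n}" "G \<inter> {1..m} = X"
        by (auto simp: cylinder_def)
      then show ?thesis using assms by (auto simp: cylinder_def)
    qed
  qed
qed

text \<open>The random walk estimates below are instances of this: a function of prefixes that does not increase
  in the mean has expectation at most its initial value. The element \<open>Suc n\<close> is exposed last.\<close>

lemma supermartingale_cylinder:
  fixes \<psi> :: "nat \<Rightarrow> nat set \<Rightarrow> real"
  assumes p: "0 < p" "p < 1" and "m \<le> n" and X: "X \<subseteq> {1..m}"
    and step: "\<And>s Y. m \<le> s \<Longrightarrow> Y \<subseteq> {1..s} \<Longrightarrow> Y \<inter> {1..m} = X \<Longrightarrow>
        p * \<psi> (Suc s) (insert (Suc s) Y) + (1 - p) * \<psi> (Suc s) Y \<le> \<psi> s Y"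
  shows "(\<Sum>F\<in>cylinder n m X. set_weight n p F * \<psi> n F) \<le> set_weight m p X * \<psi> m X"
  using assms(3)
proof (induction n rule: dec_induct)
  case base
  have "cylinder m m X = {X}" using X by (auto simp: cylinder_def)
  then show ?case by simp
next
  case (step n)
  let ?C = "cylinder n m X"
  have fin: "finite ?C" by (rule finite_family[OF cylinder_subset])
  have C: "F \<subseteq> {1..n}" "Suc n \<notin> F" "finite F" "card F \<le> n" if "F \<in> ?C" for F
  proof -
    show 1: "F \<subseteq> {1..n}" using that by (simp add: cylinder_def)
    then show "Suc n \<notin> F" by auto
    show "finite F" using 1 finite_subset by blast
    show "card F \<le> n" using card_mono[OF _ 1] by simp
  qed
  have inj: "inj_on (insert (Suc n)) ?C"
    using C(2) by (auto simp: inj_on_def insert_ident)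
  have disj: "?C \<inter> insert (Suc n) ` ?C = {}" using C(2) by blast
  have w: "set_weight (Suc n) p F = (1 - p) * set_weight n p F"
    "set_weight (Suc n) p (insert (Suc n) F) = p * set_weight n p F" if "F \<in> ?C" for F
    using C[OF that] by (auto simp: set_weight_def Suc_diff_le)
  have "(\<Sum>F\<in>cylinder (Suc n) m X. set_weight (Suc n) p F * \<psi> (Suc n) F)
     = (\<Sum>F\<in>?C. set_weight (Suc n) p F * \<psi> (Suc n) F)
     + (\<Sum>F\<in>?C. set_weight (Suc n) p (insert (Suc n) F) * \<psi> (Suc n) (insert (Suc n) F))"
    unfolding cylinder_Suc[OF step.hyps(1)]
    by (subst sum.union_disjoint) (use fin disj inj in \<open>auto simp: sum.reindex\<close>)
  also have "\<dots> = (\<Sum>F\<in>?C. set_weight n p F * (p * \<psi> (Suc n) (insert (Suc n) F) + (1 - p) * \<psi> (Suc n) F))"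
    unfolding sum.distrib[symmetric] by (rule sum.cong) (auto simp: w algebra_simps)
  also have "\<dots> \<le> (\<Sum>F\<in>?C. set_weight n p F * \<psi> n F)"
    by (intro sum_mono mult_left_mono assms(5))
       (use step.hyps p C in \<open>auto simp: cylinder_def intro: less_imp_le set_weight_pos\<close>)
  also have "\<dots> \<le> set_weight m p X * \<psi> m X" by (rule step.IH)
  finally show ?case .
qed

lemma mu_le_supermartingale:
  fixes \<psi> :: "nat \<Rightarrow> nat set \<Rightarrow> real"
  assumes p: "0 < p" "p < 1" and "m \<le> n" and X: "X \<subseteq> {1..m}"
    and step: "\<And>s Y. m \<le> s \<Longrightarrow> Y \<subseteq> {1..s} \<Longrightarrow> Y \<inter> {1..m} = X \<Longrightarrow>
        p * \<psi> (Suc s) (insert (Suc s) Y) + (1 - p) * \<psi> (Suc s) Y \<le> \<psi> s Y"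
    and "\<And>F. F \<subseteq> {1..n} \<Longrightarrow> 0 \<le> \<psi> n F"
    and "\<And>F. F \<in> \<A> \<Longrightarrow> 1 \<le> \<psi> n F" and "\<A> \<subseteq> cylinder n m X"
  shows "mu n p \<A> \<le> set_weight m p X * \<psi> m X"
proof -
  have "mu n p \<A> \<le> (\<Sum>F\<in>\<A>. set_weight n p F * \<psi> n F)"
    unfolding mu_set_weight
    by (intro sum_mono) (use assms(7) p in \<open>simp add: set_weight_pos\<close>)
  also have "\<dots> \<le> (\<Sum>F\<in>cylinder n m X. set_weight n p F * \<psi> n F)"
    by (rule sum_mono2[OF _ assms(8)])
       (use p assms(6) in \<open>auto intro!: finite_family[OF cylinder_subset] mult_nonneg_nonneg
          less_imp_le[OF set_weight_pos] simp: cylinder_def\<close>)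
  also have "\<dots> \<le> set_weight m p X * \<psi> m X"
    by (rule supermartingale_cylinder[OF assms(1-5)])
  finally show ?thesis .
qed

text \<open>The constants \<open>1\<close> and \<open>-1\<close> are both supermartingales.\<close>

lemma mu_cylinder:
  assumes p: "0 < p" "p < 1" and "m \<le> n" and X: "X \<subseteq> {1..m}"
  shows "mu n p (cylinder n m X) = set_weight m p X"
proof (rule antisym)
  show "mu n p (cylinder n m X) \<le> set_weight m p X"
    using supermartingale_cylinder[OF p assms(3) X, of "\<lambda>_ _. 1"] by (simp add: mu_set_weight)
  show "set_weight m p X \<le> mu n p (cylinder n m X)"
    using supermartingale_cylinder[OF p assms(3) X, of "\<lambda>_ _. -1"] by (simp add: mu_set_weight sum_negf)
qed

lemma mu_prefix_union:
  assumes p: "0 < p" "p < 1" and "m \<le> n" and X: "\<X> \<subseteq> Pow {1..m}"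
  shows "mu n p {F. F \<subseteq> {1..n} \<and> F \<inter> {1..m} \<in> \<X>} = sum (set_weight m p) \<X>"
proof -
  have "{F. F \<subseteq> {1..n} \<and> F \<inter> {1..m} \<in> \<X>} = (\<Union>X\<in>\<X>. cylinder n m X)"
    by (auto simp: cylinder_def)
  then have "mu n p {F. F \<subseteq> {1..n} \<and> F \<inter> {1..m} \<in> \<X>} = (\<Sum>X\<in>\<X>. mu n p (cylinder n m X))"
    unfolding mu_set_weight
    by (simp only:, subst sum.UNION_disjoint)
       (use X finite_family in \<open>auto simp: cylinder_def intro!: finite_family[of _ n]\<close>)
  also have "\<dots> = sum (set_weight m p) \<X>"
    by (rule sum.cong[OF refl], rule mu_cylinder[OF p assms(3)]) (use X in blast)
  finally show ?thesis .
qed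

section \<open>The walk of a set\<close>

definition height :: "nat set \<Rightarrow> nat \<Rightarrow> int" where
  "height F s = 2 * int (card (F \<inter> {1..s})) - int s"

lemma height_0 [simp]: "height F 0 = 0"
  by (simp add: height_def)

lemma height_Suc: "height F (Suc s) = (if Suc s \<in> F then height F s + 1 else height F s - 1)"
proof -
  have "F \<inter> {1..Suc s} = (if Suc s \<in> F then insert (Suc s) (F \<inter> {1..s}) else F \<inter> {1..s})"
    by (auto simp: le_Suc_eq)
  then show ?thesis by (simp add: height_def)
qed

lemma height_cong: "(\<And>x. x \<le> s \<Longrightarrow> x \<in> F \<longleftrightarrow> x \<in> G) \<Longrightarrow> height F s = height G s"
  unfolding height_def by (rule arg_cong[where f="\<lambda>A. 2 * int (card A) - int s"]) auto

lemma height_insert_future [simp]: "s \<le> m \<Longrightarrow> height (insert (Suc m) F) s = height F s"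
  by (rule height_cong) auto

lemma height_lipschitz: "s \<le> s' \<Longrightarrow> \<bar>height F s' - height F s\<bar> \<le> int (s' - s)"
proof (induction s' rule: dec_induct)
  case (step m)
  then show ?case by (auto simp: height_Suc Suc_diff_le)
qed simp

lemma height_le: "height F s \<le> int s"
  using height_lipschitz[of 0 s F] by simp

text \<open>The function \<open>\<alpha>\<close> to the power of the negative height is a martingale for the walk.\<close>

lemma bernoulli_average:
  fixes p :: real
  assumes "p < 1"
  defines "\<alpha> \<equiv> p / (1 - p)"
  shows "p * \<alpha> ^ d + (1 - p) * \<alpha> ^ Suc (Suc d) = \<alpha> ^ Suc d"
proof -
  have 1: "(1 - p) * \<alpha> = p" and 2: "p + p * \<alpha> = \<alpha>"
    using assms by (auto simp: \<alpha>_def field_simps)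
  have "p * \<alpha> ^ d + (1 - p) * \<alpha> ^ Suc (Suc d) = (p + ((1 - p) * \<alpha>) * \<alpha>) * \<alpha> ^ d"
    by (simp add: algebra_simps)
  then show ?thesis unfolding 1 2 by simp
qed

text \<open>The martingale of \<open>bernoulli_average\<close>, stopped when height \<open>u\<close> is reached. At this moment it equals
  \<open>1\<close>, hence it dominates the event.\<close>

lemma mu_hit_cylinder:
  assumes p: "0 < p" "p < 1" and mn: "m \<le> n" and X: "X \<subseteq> {1..m}" and u: "height X m \<le> u"
  shows "mu n p {F \<in> cylinder n m X. \<exists>s\<in>{m..n}. u \<le> height F s}
     \<le> set_weight m p X * (p / (1 - p)) ^ nat (u - height X m)"
proof -
  define \<alpha> where "\<alpha> = p / (1 - p)"
  have \<alpha>: "0 < \<alpha>" using p by (simp add: \<alpha>_def)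
  define \<psi> where "\<psi> s Y = (if \<exists>s'\<in>{m..s}. u \<le> height Y s' then 1 else \<alpha> ^ nat (u - height Y s))" for s Y
  have "mu n p {F \<in> cylinder n m X. \<exists>s\<in>{m..n}. u \<le> height F s} \<le> set_weight m p X * \<psi> m X"
  proof (rule mu_le_supermartingale[OF p mn X])
    fix s Y assume s: "m \<le> s" and Y: "Y \<subseteq> {1..s}"
    have ns: "Suc s \<notin> Y" using Y by auto
    show "p * \<psi> (Suc s) (insert (Suc s) Y) + (1 - p) * \<psi> (Suc s) Y \<le> \<psi> s Y"
    proof (cases "\<exists>s'\<in>{m..s}. u \<le> height Y s'")
      case True
      then obtain s' where s': "m \<le> s'" "s' \<le> s" "u \<le> height Y s'" by auto
      then have "\<exists>s'\<in>{m..Suc s}. u \<le> height Y s'" "\<exists>s'\<in>{m..Suc s}. u \<le> height (insert (Suc s) Y) s'"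
        by (auto intro!: bexI[of _ s'])
      then show ?thesis using True by (simp add: \<psi>_def)
    next
      case False
      then have lt: "height Y s < u" using s by force
      define d where "d = nat (u - height Y s - 1)"
      have d: "u - height Y s = int d + 1" using lt by (simp add: d_def)
      have up: "\<psi> (Suc s) (insert (Suc s) Y) = \<alpha> ^ d"
      proof (cases "d = 0")
        case True
        then have "u \<le> height (insert (Suc s) Y) (Suc s)" using d by (simp add: height_Suc)
        then have "\<exists>s'\<in>{m..Suc s}. u \<le> height (insert (Suc s) Y) s'" using s by (intro bexI[of _ "Suc s"]) auto
        then show ?thesis using True by (simp add: \<psi>_def)
      next
        case d0: False
        have "\<not> (\<exists>s'\<in>{m..Suc s}. u \<le> height (insert (Suc s) Y) s')"
          using False d d0 by (auto simp: le_Suc_eq height_Suc)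
        moreover have "nat (u - (height Y s + 1)) = d" using d by simp
        ultimately show ?thesis by (simp add: \<psi>_def height_Suc)
      qed
      have "\<not> (\<exists>s'\<in>{m..Suc s}. u \<le> height Y s')"
        using False lt ns by (auto simp: le_Suc_eq height_Suc)
      moreover have "nat (u - (height Y s - 1)) = Suc (Suc d)" using d by simp
      ultimately have down: "\<psi> (Suc s) Y = \<alpha> ^ Suc (Suc d)"
        using ns by (simp add: \<psi>_def height_Suc)
      have "nat (u - height Y s) = Suc d" using d by simp
      then have "\<psi> s Y = \<alpha> ^ Suc d" using False by (simp add: \<psi>_def)
      then show ?thesis unfolding up down using bernoulli_average[OF p(2), of d] by (simp only: \<alpha>_def)
    qed
  qed (use \<alpha> in \<open>auto simp: \<psi>_def\<close>)
  also have "\<psi> m X = \<alpha> ^ nat (u - height X m)" using u by (auto simp: \<psi>_def)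
  finally show ?thesis by (simp add: \<alpha>_def)
qed

lemma mu_hit:
  assumes p: "0 < p" "p < 1" and u: "0 \<le> u"
  shows "mu n p {F. F \<subseteq> {1..n} \<and> (\<exists>s\<le>n. u \<le> height F s)} \<le> (p / (1 - p)) ^ nat u"
proof -
  have "{F. F \<subseteq> {1..n} \<and> (\<exists>s\<le>n. u \<le> height F s)} = {F \<in> cylinder n 0 {}. \<exists>s\<in>{0..n}. u \<le> height F s}"
    by (auto simp: cylinder_def)
  then show ?thesis using mu_hit_cylinder[OF p, of 0 n "{}" u] u by (simp add: set_weight_def)
qed

definition visits_twice :: "nat \<Rightarrow> int \<Rightarrow> nat set \<Rightarrow> bool" where
  "visits_twice n u F \<longleftrightarrow> (\<exists>s s'. s < s' \<and> s' \<le> n \<and> u \<le> height F s \<and> u \<le> height F s')"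

lemma visits_twice_Suc:
  "visits_twice (Suc n) u F \<longleftrightarrow> visits_twice n u F \<or> (u \<le> height F (Suc n) \<and> (\<exists>s\<le>n. u \<le> height F s))"
proof
  assume "visits_twice (Suc n) u F"
  then show "visits_twice n u F \<or> (u \<le> height F (Suc n) \<and> (\<exists>s\<le>n. u \<le> height F s))"
    by (auto simp: visits_twice_def le_Suc_eq less_Suc_eq_le)
next
  assume "visits_twice n u F \<or> (u \<le> height F (Suc n) \<and> (\<exists>s\<le>n. u \<le> height F s))"
  then show "visits_twice (Suc n) u F"
    unfolding visits_twice_def by (meson le_SucI le_refl less_Suc_eq_le)
qed

lemma visits_twice_insert [simp]: "visits_twice n u (insert (Suc n) F) = visits_twice n u F"
  unfolding visits_twice_def by (intro iff_exI conj_cong refl) simp_all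

text \<open>At the first visit to \<open>u\<close> the walk either rises at once, with probability \<open>p\<close>, or drops to
  \<open>u - 1\<close>, from where it returns with probability at most \<open>\<alpha>\<close>. Together this is
  \<open>p + q \<alpha> = 2p\<close>, an extra factor \<open>2p\<close> on top of the probability of reaching \<open>u\<close>.\<close>

lemma mu_visits_twice:
  assumes p: "0 < p" "p < 1 / 2" and u: "0 \<le> u"
  shows "mu n p {F. F \<subseteq> {1..n} \<and> visits_twice n u F} \<le> 2 * p * (p / (1 - p)) ^ nat u"
proof -
  have p1: "p < 1" using p by simp
  define \<alpha> where "\<alpha> = p / (1 - p)"
  have \<alpha>: "0 < \<alpha>" "\<alpha> \<le> 1" using p by (auto simp: \<alpha>_def field_simps)
  have av: "p * \<alpha> ^ d + (1 - p) * \<alpha> ^ Suc (Suc d) = \<alpha> ^ Suc d" for d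
    using bernoulli_average[OF p1, of d] by (simp only: \<alpha>_def)
  have q\<alpha>: "(1 - p) * \<alpha> = p" using p by (simp add: \<alpha>_def)
  \<comment> \<open>The conditional probability bound given the first \<open>s\<close> steps: event settled; at the first visit;
    one visit in the past; no visit yet.\<close>
  define \<psi> where "\<psi> s Y =
    (if visits_twice s u Y \<or> u < height Y s then 1
     else if height Y s = u then 2 * p
     else if \<exists>s'\<le>s. u \<le> height Y s' then \<alpha> ^ nat (u - height Y s)
     else 2 * p * \<alpha> ^ nat (u - height Y s))" for s Y
  have pow1: "\<alpha> ^ k \<le> 1" for k using \<alpha> by (simp add: power_le_one)
  have \<psi>1: "\<psi> s Y \<le> 1" and \<psi>0: "0 \<le> \<psi> s Y" for s Y
    using p \<alpha> mult_mono[of "2 * p" 1 "\<alpha> ^ nat (u - height Y s)" 1] pow1 by (auto simp: \<psi>_def)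
  have "mu n p {F. F \<subseteq> {1..n} \<and> visits_twice n u F} \<le> set_weight 0 p {} * \<psi> 0 {}"
  proof (rule mu_le_supermartingale[OF p(1) p1])
    fix s :: nat and Y assume Y: "Y \<subseteq> {1..s}"
    have ns: "Suc s \<notin> Y" using Y by auto
    have hup: "height (insert (Suc s) Y) (Suc s) = height Y s + 1"
      and hdn: "height Y (Suc s) = height Y s - 1" using ns by (auto simp: height_Suc)
    have ex_up: "(\<exists>s'\<le>Suc s. u \<le> height (insert (Suc s) Y) s') \<longleftrightarrow> (\<exists>s'\<le>s. u \<le> height Y s') \<or> u \<le> height Y s + 1"
      using hup by (auto simp: le_Suc_eq)
    have ex_dn: "(\<exists>s'\<le>Suc s. u \<le> height Y s') \<longleftrightarrow> (\<exists>s'\<le>s. u \<le> height Y s') \<or> u \<le> height Y s - 1"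
      using hdn by (auto simp: le_Suc_eq)
    have vup: "visits_twice (Suc s) u (insert (Suc s) Y) \<longleftrightarrow>
         visits_twice s u Y \<or> (u \<le> height Y s + 1 \<and> (\<exists>s'\<le>s. u \<le> height Y s'))"
      unfolding visits_twice_Suc hup visits_twice_insert by auto
    have vdn: "visits_twice (Suc s) u Y \<longleftrightarrow>
         visits_twice s u Y \<or> (u \<le> height Y s - 1 \<and> (\<exists>s'\<le>s. u \<le> height Y s'))"
      unfolding visits_twice_Suc hdn by simp
    show "p * \<psi> (Suc s) (insert (Suc s) Y) + (1 - p) * \<psi> (Suc s) Y \<le> \<psi> s Y"
    proof (cases "visits_twice s u Y \<or> u < height Y s")
      case True
      have "p * \<psi> (Suc s) (insert (Suc s) Y) + (1 - p) * \<psi> (Suc s) Y \<le> p * 1 + (1 - p) * 1"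
        by (intro add_mono mult_left_mono \<psi>1) (use p in auto)
      then show ?thesis using True by (simp add: \<psi>_def)
    next
      case False
      show ?thesis
      proof (cases "height Y s = u")
        case True
        then have ex: "\<exists>s'\<le>s. u \<le> height Y s'" by auto
        have "\<psi> s Y = 2 * p" using True False by (simp add: \<psi>_def)
        moreover have "\<psi> (Suc s) Y = \<alpha>" using False True ex by (simp add: \<psi>_def vdn hdn ex_dn)
        moreover have "\<psi> (Suc s) (insert (Suc s) Y) = 1" using True by (simp add: \<psi>_def hup)
        ultimately show ?thesis using q\<alpha> by simp
      next
        case ne: False
        define d where "d = nat (u - height Y s - 1)"
        have d: "u = height Y s + int d + 1" using False ne by (simp add: d_def)
        have e: "nat (u - height Y s) = Suc d" "nat (u - (height Y s + 1)) = d" "nat (u - (height Y s - 1)) = Suc (Suc d)"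
          using d by auto
        define E where "E \<longleftrightarrow> (\<exists>s'\<le>s. u \<le> height Y s')"
        show ?thesis
        proof (cases E)
          case True
          have "\<psi> s Y = \<alpha> ^ Suc d" unfolding \<psi>_def E_def[symmetric] e using True False ne by auto
          moreover have "\<psi> (Suc s) Y = \<alpha> ^ Suc (Suc d)"
            unfolding \<psi>_def vdn hdn ex_dn E_def[symmetric] e using False True d by simp
          moreover have "\<psi> (Suc s) (insert (Suc s) Y) = \<alpha> ^ d"
            unfolding \<psi>_def vup hup ex_up E_def[symmetric] e using False True d by (cases "d = 0") auto
          ultimately show ?thesis using av[of d] by simp
        next
          case nex: False
          have now: "\<psi> s Y = 2 * p * \<alpha> ^ Suc d" unfolding \<psi>_def E_def[symmetric] e using nex False ne by auto
          moreover have "\<psi> (Suc s) Y = 2 * p * \<alpha> ^ Suc (Suc d)"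
            unfolding \<psi>_def vdn hdn ex_dn E_def[symmetric] e using False nex d by simp
          moreover have "\<psi> (Suc s) (insert (Suc s) Y) = 2 * p * \<alpha> ^ d"
            unfolding \<psi>_def vup hup ex_up E_def[symmetric] e using False nex d by (cases "d = 0") auto
          ultimately have "p * \<psi> (Suc s) (insert (Suc s) Y) + (1 - p) * \<psi> (Suc s) Y
              = 2 * p * (p * \<alpha> ^ d + (1 - p) * \<alpha> ^ Suc (Suc d))" by (simp add: algebra_simps)
          then show ?thesis unfolding av now by simp
        qed
      qed
    qed
  qed (use \<psi>0 in \<open>auto simp: \<psi>_def cylinder_def\<close>)
  also have "\<dots> = 2 * p * \<alpha> ^ nat u"
    using u by (auto simp: \<psi>_def set_weight_def visits_twice_def)
  finally show ?thesis by (simp add: \<alpha>_def)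
qed

section \<open>Threshold families\<close>

text \<open>Membership is stated as missing at most \<open>k\<close> elements of \<open>T\<close>, so that no subtraction is needed;
  \<open>\<F>\<^sup>t\<^sub>r\<close> is the case \<open>T = [t + 2r]\<close>, \<open>k = r\<close>.\<close>

definition threshold :: "nat \<Rightarrow> nat set \<Rightarrow> nat \<Rightarrow> nat set set" where
  "threshold n T k = {F. F \<subseteq> {1..n} \<and> card T \<le> card (F \<inter> T) + k}"

definition exact_level :: "nat \<Rightarrow> nat \<Rightarrow> nat \<Rightarrow> nat set set" where
  "exact_level n N k = {F. F \<subseteq> {1..n} \<and> card (F \<inter> {1..N}) + k = N}"

lemma frankl_family_threshold: "frankl_family n t r = threshold n {1..t + 2 * r} r"
  by (auto simp: frankl_family_def threshold_def)

lemma threshold_subset: "threshold n T k \<subseteq> Pow {1..n}"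
  by (auto simp: threshold_def)

lemma exact_level_subset: "exact_level n N k \<subseteq> Pow {1..n}"
  by (auto simp: exact_level_def)

lemma mu_exact_level:
  assumes p: "0 < p" "p < 1" and "N \<le> n"
  shows "mu n p (exact_level n N k) = binom_weight p N k"
proof -
  define \<X> where "\<X> = {X. X \<subseteq> {1..N} \<and> card X + k = N}"
  have "exact_level n N k = {F. F \<subseteq> {1..n} \<and> F \<inter> {1..N} \<in> \<X>}"
    by (auto simp: exact_level_def \<X>_def)
  then have "mu n p (exact_level n N k) = sum (set_weight N p) \<X>"
    using mu_prefix_union[OF p assms(3), of \<X>] by (auto simp: \<X>_def)
  also have "\<dots> = (\<Sum>X\<in>\<X>. p ^ (N - k) * (1 - p) ^ k)"
    by (rule sum.cong) (auto simp: \<X>_def set_weight_def)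
  also have "\<dots> = real (card \<X>) * (p ^ (N - k) * (1 - p) ^ k)" by simp
  also have "card \<X> = N choose k"
  proof (cases "k \<le> N")
    case True
    then have "\<X> = {X. X \<subseteq> {1..N} \<and> card X = N - k}" by (auto simp: \<X>_def)
    then show ?thesis using n_subsets[of "{1..N}" "N - k"] True by (simp add: binomial_symmetric[of k N])
  next
    case False
    then have "\<X> = {}" by (auto simp: \<X>_def)
    then show ?thesis using False by simp
  qed
  finally show ?thesis by (simp add: binom_weight_def)
qed

lemma mu_threshold:
  assumes p: "0 < p" "p < 1" and "N \<le> n"
  shows "mu n p (threshold n {1..N} k) = binom_tail p N k"
proof (induction k)
  case 0
  have "card (F \<inter> {1..N}) \<le> N" for F using card_mono[of "{1..N}" "F \<inter> {1..N}"] by simp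
  then have "threshold n {1..N} 0 = exact_level n N 0"
    by (auto simp: threshold_def exact_level_def intro: antisym)
  then show ?case using mu_exact_level[OF assms, of 0] by (simp add: binom_tail_def)
next
  case (Suc k)
  have "threshold n {1..N} (Suc k) = threshold n {1..N} k \<union> exact_level n N (Suc k)"
    "threshold n {1..N} k \<inter> exact_level n N (Suc k) = {}"
    by (auto simp: threshold_def exact_level_def)
  then have "mu n p (threshold n {1..N} (Suc k)) = mu n p (threshold n {1..N} k) + mu n p (exact_level n N (Suc k))"
    unfolding mu_set_weight
    by (simp add: sum.union_disjoint finite_family[OF threshold_subset] finite_family[OF exact_level_subset])
  then show ?case using Suc mu_exact_level[OF assms, of "Suc k"] by (simp add: binom_tail_Suc_right)
qed

lemma height_eq_iff_exact_level:
  "F \<subseteq> {1..n} \<Longrightarrow> F \<in> exact_level n N k \<longleftrightarrow> height F N = int N - 2 * int k"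
  by (auto simp: exact_level_def height_def)

lemma height_ge_iff_threshold:
  "F \<subseteq> {1..n} \<Longrightarrow> F \<in> threshold n {1..N} k \<longleftrightarrow> int N - 2 * int k \<le> height F N"
  by (auto simp: threshold_def height_def)

section \<open>Left compression\<close>

definition swap :: "nat \<Rightarrow> nat \<Rightarrow> nat set \<Rightarrow> nat set" where
  "swap i j F = Transposition.transpose i j ` F"

text \<open>The usual \<open>(i, j)\<close>-compression, described by membership: if only one of \<open>G\<close> and
  \<open>swap i j G\<close> belongs to \<open>\<A>\<close> and the two differ, the compression contains the one with \<open>i\<close>.\<close>

definition shift :: "nat \<Rightarrow> nat \<Rightarrow> nat set set \<Rightarrow> nat set set" where
  "shift i j \<A> = {G. if j \<in> G \<and> i \<notin> G then G \<in> \<A> \<and> swap i j G \<in> \<A> else G \<in> \<A> \<or> swap i j G \<in> \<A>}"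

lemma swap_swap [simp]: "swap i j (swap i j F) = F"
  by (simp add: swap_def image_image)

lemma mem_swap: "x \<in> swap i j F \<longleftrightarrow> Transposition.transpose i j x \<in> F"
  unfolding swap_def by (metis image_iff transpose_involutory)

lemma mem_swap_simps [simp]:
  "i \<in> swap i j F \<longleftrightarrow> j \<in> F" "j \<in> swap i j F \<longleftrightarrow> i \<in> F"
  "x \<noteq> i \<Longrightarrow> x \<noteq> j \<Longrightarrow> x \<in> swap i j F \<longleftrightarrow> x \<in> F"
  by (auto simp: mem_swap)

lemma swap_eq_self: "(i \<in> F \<longleftrightarrow> j \<in> F) \<Longrightarrow> swap i j F = F"
  by (rule set_eqI, rename_tac x, case_tac "x = i"; case_tac "x = j") auto

lemma swap_upward: "i \<notin> F \<Longrightarrow> j \<in> F \<Longrightarrow> swap i j F = insert i (F - {j})"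
  by (rule set_eqI, rename_tac x, case_tac "x = i"; case_tac "x = j") auto

lemma swap_downward: "i \<in> F \<Longrightarrow> j \<notin> F \<Longrightarrow> swap i j F = insert j (F - {i})"
  by (rule set_eqI, rename_tac x, case_tac "x = i"; case_tac "x = j") auto

lemma swap_Int: "swap i j (F \<inter> G) = swap i j F \<inter> swap i j G"
  by (auto simp: mem_swap)

lemma card_swap [simp]: "card (swap i j F) = card F"
  unfolding swap_def by (rule card_image) (rule inj_on_subset[OF inj_transpose], simp)

lemma swap_subset [simp]: "i \<in> {1..n} \<Longrightarrow> j \<in> {1..n} \<Longrightarrow> swap i j F \<subseteq> {1..n} \<longleftrightarrow> F \<subseteq> {1..n}"
proof -
  have *: "swap i j G \<subseteq> {1..n}" if "i \<in> {1..n}" "j \<in> {1..n}" "G \<subseteq> {1..n}" for G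
    using that by (auto simp: swap_def Transposition.transpose_def)
  show "i \<in> {1..n} \<Longrightarrow> j \<in> {1..n} \<Longrightarrow> ?thesis"
    using *[of F] *[of "swap i j F"] by auto
qed

lemma shift_subset:
  assumes "i \<in> {1..n}" "j \<in> {1..n}" "\<A> \<subseteq> Pow {1..n}"
  shows "shift i j \<A> \<subseteq> Pow {1..n}"
proof
  fix G assume "G \<in> shift i j \<A>"
  then have "G \<in> \<A> \<or> swap i j G \<in> \<A>" by (auto simp: shift_def split: if_splits)
  then show "G \<in> Pow {1..n}" using assms(3) swap_subset[OF assms(1,2), of G] by blast
qed

text \<open>Compression acts on each pair \<open>G\<close>, \<open>swap i j G\<close> separately. Summing over all sets counts every
  pair twice and reduces statements about sums over a family to single pairs.\<close>

lemma sum_shift_pairs: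
  fixes f :: "nat set \<Rightarrow> 'a :: linordered_field"
  assumes "i \<in> {1..n}" "j \<in> {1..n}" "\<B> \<subseteq> Pow {1..n}"
  shows "2 * sum f \<B> = (\<Sum>G\<in>Pow {1..n}. (if G \<in> \<B> then f G else 0) + (if swap i j G \<in> \<B> then f (swap i j G) else 0))"
proof -
  have 1: "sum f \<B> = (\<Sum>G\<in>Pow {1..n}. if G \<in> \<B> then f G else 0)"
    using assms(3) by (simp add: sum.If_cases Int_absorb1)
  also have "\<dots> = (\<Sum>G\<in>Pow {1..n}. if swap i j G \<in> \<B> then f (swap i j G) else 0)"
    by (rule sum.reindex_bij_witness[of _ "swap i j" "swap i j"])
       (use swap_subset[OF assms(1,2)] in auto)
  finally show ?thesis using 1 by (simp add: sum.distrib)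
qed

lemma shift_pair_cases:
  obtains "G \<in> shift i j \<A> \<longleftrightarrow> G \<in> \<A>" "swap i j G \<in> shift i j \<A> \<longleftrightarrow> swap i j G \<in> \<A>"
  | "i \<in> G" "j \<notin> G" "G \<notin> \<A>" "swap i j G \<in> \<A>" "G \<in> shift i j \<A>" "swap i j G \<notin> shift i j \<A>"
  | "i \<notin> G" "j \<in> G" "G \<in> \<A>" "swap i j G \<notin> \<A>" "G \<notin> shift i j \<A>" "swap i j G \<in> shift i j \<A>"
proof (cases "i \<in> G \<longleftrightarrow> j \<in> G")
  case True
  then show thesis using that(1) swap_eq_self[OF True] by (simp add: shift_def)
next
  case False
  then show thesis using that
    by (cases "G \<in> \<A>"; cases "swap i j G \<in> \<A>") (auto simp: shift_def)
qed

lemma mu_shift: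
  assumes "i \<in> {1..n}" "j \<in> {1..n}" "\<A> \<subseteq> Pow {1..n}"
  shows "mu n p (shift i j \<A>) = mu n p \<A>"
proof -
  have "2 * mu n p (shift i j \<A>) = 2 * mu n p \<A>"
    unfolding mu_set_weight sum_shift_pairs[OF assms] sum_shift_pairs[OF assms(1,2) shift_subset[OF assms]]
  proof (rule sum.cong[OF refl])
    fix G assume "G \<in> Pow {1..n}"
    have "set_weight n p (swap i j G) = set_weight n p G" by (simp add: set_weight_def)
    then show "(if G \<in> shift i j \<A> then set_weight n p G else 0) +
        (if swap i j G \<in> shift i j \<A> then set_weight n p (swap i j G) else 0) =
        (if G \<in> \<A> then set_weight n p G else 0) +
        (if swap i j G \<in> \<A> then set_weight n p (swap i j G) else 0)"
      by (cases rule: shift_pair_cases[of G i j \<A>]) auto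
  qed
  then show ?thesis by simp
qed

definition element_sum :: "nat set set \<Rightarrow> nat" where
  "element_sum \<A> = (\<Sum>A\<in>\<A>. \<Sum>A)"

lemma element_sum_swap:
  assumes "finite G" "i \<in> G" "j \<notin> G" "i < j"
  shows "\<Sum>G < \<Sum>(swap i j G)"
proof -
  have "\<Sum>G = i + \<Sum>(G - {i})" using assms by (simp add: sum.remove)
  moreover have "\<Sum>(swap i j G) = j + \<Sum>(G - {i})" using assms by (simp add: swap_downward)
  ultimately show ?thesis using assms(4) by simp
qed

lemma element_sum_shift:
  assumes ij: "i \<in> {1..n}" "j \<in> {1..n}" "i < j" and A: "\<A> \<subseteq> Pow {1..n}"
  shows "element_sum (shift i j \<A>) \<le> element_sum \<A>"
    and "shift i j \<A> \<noteq> \<A> \<Longrightarrow> element_sum (shift i j \<A>) < element_sum \<A>"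
proof -
  define f :: "nat set \<Rightarrow> real" where "f G = real (\<Sum>G)" for G
  define g where "g \<B> G = (if G \<in> \<B> then f G else 0) + (if swap i j G \<in> \<B> then f (swap i j G) else 0)" for \<B> G
  have es: "2 * real (element_sum \<B>) = (\<Sum>G\<in>Pow {1..n}. g \<B> G)" if "\<B> \<subseteq> Pow {1..n}" for \<B>
    using sum_shift_pairs[OF ij(1,2) that, of f] by (simp add: element_sum_def f_def g_def)
  have less: "f G < f (swap i j G)" if "G \<subseteq> {1..n}" "i \<in> G" "j \<notin> G" for G
    using element_sum_swap[OF _ that(2,3) ij(3)] that(1) finite_subset by (fastforce simp: f_def simp del: of_nat_sum)
  have less': "f (swap i j G) < f G" if "G \<subseteq> {1..n}" "i \<notin> G" "j \<in> G" for G
    using less[of "swap i j G"] that swap_subset[OF ij(1,2), of G] by simp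
  have le: "g (shift i j \<A>) G \<le> g \<A> G" if "G \<in> Pow {1..n}" for G
  proof (cases rule: shift_pair_cases[of G i j \<A>])
    case 1 then show ?thesis by (simp add: g_def)
  next
    case 2 then show ?thesis using less[of G] that by (simp add: g_def)
  next
    case 3 then show ?thesis using less'[of G] that by (simp add: g_def)
  qed
  note e1 = es[OF shift_subset[OF ij(1,2) A]] and e2 = es[OF A]
  have "(\<Sum>G\<in>Pow {1..n}. g (shift i j \<A>) G) \<le> (\<Sum>G\<in>Pow {1..n}. g \<A> G)"
    by (rule sum_mono[OF le])
  then show "element_sum (shift i j \<A>) \<le> element_sum \<A>" using e1 e2 by linarith
  assume "shift i j \<A> \<noteq> \<A>"
  then obtain G where G: "G \<in> shift i j \<A> \<longleftrightarrow> G \<notin> \<A>" by blast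
  then have "G \<in> Pow {1..n}" using A shift_subset[OF ij(1,2) A] by blast
  moreover have "g (shift i j \<A>) G < g \<A> G"
  proof (cases rule: shift_pair_cases[of G i j \<A>])
    case 1 then show ?thesis using G by simp
  next
    case 2 then show ?thesis using less[of G] \<open>G \<in> Pow {1..n}\<close> by (simp add: g_def)
  next
    case 3 then show ?thesis using less'[of G] \<open>G \<in> Pow {1..n}\<close> by (simp add: g_def)
  qed
  ultimately have "(\<Sum>G\<in>Pow {1..n}. g (shift i j \<A>) G) < (\<Sum>G\<in>Pow {1..n}. g \<A> G)"
    by (intro sum_strict_mono_ex1) (use le in auto)
  then show "element_sum (shift i j \<A>) < element_sum \<A>" using e1 e2 by linarith
qed

lemma cross_intersecting_commute: "cross_intersecting t \<A> \<B> \<longleftrightarrow> cross_intersecting t \<B> \<A>"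
  unfolding cross_intersecting_def by (metis Int_commute)

text \<open>If \<open>G\<close> is new, then \<open>swap i j G\<close> was in \<open>\<A>\<close>. Either the swapped partner of \<open>H\<close> was in
  \<open>\<B>\<close>, and both can be swapped back, or \<open>H\<close> itself contains \<open>i\<close> but not \<open>j\<close> and loses an
  element of the intersection when \<open>G\<close> is swapped back.\<close>

lemma shift_mixed_case:
  assumes cross: "cross_intersecting t \<A> \<B>" and fin: "finite G"
    and G: "i \<in> G" "j \<notin> G" "swap i j G \<in> \<A>" and H: "H \<in> shift i j \<B>"
  shows "t \<le> card (G \<inter> H)"
proof (cases "swap i j H \<in> \<B>")
  case True
  then have "t \<le> card (swap i j G \<inter> swap i j H)" using cross G by (auto simp: cross_intersecting_def)
  then show ?thesis by (simp add: swap_Int[symmetric])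
next
  case False
  then have HB: "H \<in> \<B>" and HD: "\<not> (j \<in> H \<and> i \<notin> H)" using H by (auto simp: shift_def split: if_splits)
  have "swap i j H \<noteq> H" using False HB by auto
  then have "i \<in> H" "j \<notin> H" using HD swap_eq_self by blast+
  then have "swap i j G \<inter> H \<subseteq> G \<inter> H" using G by (auto simp: swap_downward)
  then have "card (swap i j G \<inter> H) \<le> card (G \<inter> H)" using fin by (intro card_mono) auto
  then show ?thesis using cross G HB by (force simp: cross_intersecting_def)
qed

lemma cross_intersecting_shift:
  assumes cross: "cross_intersecting t \<A> \<B>" and ij: "i \<in> {1..n}" "j \<in> {1..n}"
    and A: "\<A> \<subseteq> Pow {1..n}" and B: "\<B> \<subseteq> Pow {1..n}"
  shows "cross_intersecting t (shift i j \<A>) (shift i j \<B>)"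
  unfolding cross_intersecting_def
proof (intro ballI)
  fix G H assume G: "G \<in> shift i j \<A>" and H: "H \<in> shift i j \<B>"
  have "G \<subseteq> {1..n}" "H \<subseteq> {1..n}" using G H shift_subset[OF ij A] shift_subset[OF ij B] by auto
  then have fin: "finite G" "finite H" using finite_subset[OF _ finite_atLeastAtMost] by auto
  have new: "F \<in> \<C> \<or> (i \<in> F \<and> j \<notin> F \<and> swap i j F \<in> \<C>)" if "F \<in> shift i j \<C>" for F \<C>
  proof (cases "i \<in> F \<longleftrightarrow> j \<in> F")
    case True
    then have "F \<in> shift i j \<C> \<longleftrightarrow> F \<in> \<C>" unfolding shift_def mem_Collect_eq swap_eq_self[OF True] by auto
    then show ?thesis using that by blast
  next
    case False
    then show ?thesis using that by (auto simp: shift_def)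
  qed
  show "t \<le> card (G \<inter> H)"
    using new[OF G] new[OF H]
  proof (elim disjE)
    assume "G \<in> \<A>" "H \<in> \<B>" then show ?thesis using cross by (simp add: cross_intersecting_def)
  next
    assume "i \<in> G \<and> j \<notin> G \<and> swap i j G \<in> \<A>"
    then show ?thesis using shift_mixed_case[OF cross fin(1) _ _ _ H] by blast
  next
    assume "i \<in> H \<and> j \<notin> H \<and> swap i j H \<in> \<B>"
    then show ?thesis using shift_mixed_case[OF _ fin(2) _ _ _ G, of t \<B>] cross
      by (simp add: cross_intersecting_commute Int_commute)
  next
    assume "i \<in> G \<and> j \<notin> G \<and> swap i j G \<in> \<A>" 
    then show ?thesis using shift_mixed_case[OF cross fin(1) _ _ _ H] by blast
  qed
qed

definition left_compressed :: "nat set set \<Rightarrow> bool" where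
  "left_compressed \<A> \<longleftrightarrow> (\<forall>A\<in>\<A>. \<forall>i j. 1 \<le> i \<longrightarrow> i < j \<longrightarrow> i \<notin> A \<longrightarrow> j \<in> A \<longrightarrow> insert i (A - {j}) \<in> \<A>)"

lemma left_compressedI:
  assumes "\<A> \<subseteq> Pow {1..n}" and "\<And>i j. i \<in> {1..n} \<Longrightarrow> j \<in> {1..n} \<Longrightarrow> i < j \<Longrightarrow> shift i j \<A> = \<A>"
  shows "left_compressed \<A>"
  unfolding left_compressed_def
proof (intro ballI allI impI)
  fix A i j assume A: "A \<in> \<A>" and ij: "1 \<le> i" "i < j" "i \<notin> A" "j \<in> A"
  then have "j \<in> {1..n}" using assms(1) by blast
  then have "shift i j \<A> = \<A>" using assms(2) ij by auto
  then have "A \<in> shift i j \<A>" using A by simp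
  then have "swap i j A \<in> \<A>" using ij by (simp add: shift_def)
  then show "insert i (A - {j}) \<in> \<A>" using ij by (simp add: swap_upward)
qed

section \<open>Common peaks\<close>

text \<open>Let \<open>x\<close> be the largest common element of \<open>A\<close> and \<open>B\<close>. If \<open>[x]\<close> is covered by
  \<open>A \<union> B\<close>, then \<open>x\<close> itself is the required step. Otherwise \<open>x \<in> A\<close> may be replaced by the largest
  uncovered \<open>y < x\<close>, which decreases the sum of \<open>A\<close>. A step found for the new set also works for \<open>A\<close>,
  unless it lies between \<open>y\<close> and \<open>x\<close>; in this case \<open>x\<close> works, because everything between \<open>y\<close> and
  \<open>x\<close> is covered and \<open>x\<close> is covered twice.\<close>

lemma compressed_common_peak:
  assumes "left_compressed \<A>" and "0 < t"
    and "A \<in> \<A>" "A \<subseteq> {1..n}" "B \<subseteq> {1..n}"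
    and cross: "\<And>A'. A' \<in> \<A> \<Longrightarrow> t \<le> card (A' \<inter> B)"
  shows "\<exists>s\<le>n. 2 * int t \<le> height A s + height B s"
  using assms(3,4)
proof (induction "\<Sum>A" arbitrary: A rule: less_induct)
  case less
  have finA: "finite A" using less.prems finite_subset by blast
  have "A \<inter> B \<noteq> {}" using cross[OF less.prems(1)] assms(2) by auto
  define x where "x = Max (A \<inter> B)"
  have x: "x \<in> A" "x \<in> B" and xmax: "\<And>z. z \<in> A \<Longrightarrow> z \<in> B \<Longrightarrow> z \<le> x"
    using Max_in[of "A \<inter> B"] \<open>A \<inter> B \<noteq> {}\<close> finA by (auto simp: x_def)
  have xn: "1 \<le> x" "x \<le> n" using x less.prems by auto
  define Y where "Y = {y. 1 \<le> y \<and> y < x \<and> y \<notin> A \<union> B}"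
  have finY: "finite Y" by (rule finite_subset[of _ "{..<x}"]) (auto simp: Y_def)
  have cards: "card (A \<inter> {1..s}) + card (B \<inter> {1..s}) = card ((A \<union> B) \<inter> {1..s}) + card (A \<inter> B \<inter> {1..s})" for s
    using card_Un_Int[of "A \<inter> {1..s}" "B \<inter> {1..s}"] by (simp add: Int_Un_distrib2 Int_ac)
  show ?case
  proof (cases "Y = {}")
    case True
    have "(A \<union> B) \<inter> {1..x} = {1..x}"
    proof
      show "{1..x} \<subseteq> (A \<union> B) \<inter> {1..x}"
      proof
        fix z assume z: "z \<in> {1..x}"
        show "z \<in> (A \<union> B) \<inter> {1..x}"
        proof (rule ccontr)
          assume "z \<notin> (A \<union> B) \<inter> {1..x}"
          then have "z \<in> Y" using z x by (cases "z = x") (auto simp: Y_def)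
          then show False using True by simp
        qed
      qed
    qed auto
    moreover have "A \<inter> B \<inter> {1..x} = A \<inter> B" using xmax less.prems by auto
    ultimately have "x + t \<le> card (A \<inter> {1..x}) + card (B \<inter> {1..x})"
      using cards[of x] cross[OF less.prems(1)] by simp
    then show ?thesis using xn by (intro exI[of _ x]) (simp add: height_def)
  next
    case False
    define y where "y = Max Y"
    have "y \<in> Y" using False finY by (simp add: y_def)
    then have y: "1 \<le> y" "y < x" "y \<notin> A" "y \<notin> B" by (auto simp: Y_def)
    have gap: "z \<in> A \<union> B" if "y < z" "z \<le> x" for z
    proof (rule ccontr)
      assume "z \<notin> A \<union> B"
      then have "z \<in> Y" using that x y by (cases "z = x") (auto simp: Y_def)
      then have "z \<le> y" unfolding y_def using finY by (intro Max_ge)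
      then show False using that by simp
    qed
    define A' where "A' = insert y (A - {x})"
    have A': "A' \<in> \<A>" using assms(1) less.prems(1) y x by (auto simp: left_compressed_def A'_def)
    have A'n: "A' \<subseteq> {1..n}" using less.prems(2) y xn by (auto simp: A'_def)
    have "\<Sum>A' = y + \<Sum>(A - {x})" using y finA by (simp add: A'_def)
    moreover have "\<Sum>A = x + \<Sum>(A - {x})" using x finA by (simp add: sum.remove)
    ultimately have "\<Sum>A' < \<Sum>A" using y by simp
    from less.hyps[OF this A' A'n] obtain s where s: "s \<le> n" "2 * int t \<le> height A' s + height B s" by blast
    have card': "card (A' \<inter> {1..s}) = card (A \<inter> {1..s}) + (if y \<le> s then 1 else 0) - (if x \<le> s then 1 else 0)"
    proof -
      have *: "A' \<inter> {1..s} = (if y \<le> s then insert y (A \<inter> {1..s} - {x}) else A \<inter> {1..s} - {x})"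
        using y by (auto simp: A'_def)
      have "card (A \<inter> {1..s} - {x}) = card (A \<inter> {1..s}) - (if x \<le> s then 1 else 0)"
        using x xn by (auto simp: card_Diff_singleton_if)
      moreover have "card (A \<inter> {1..s}) > 0" if "x \<le> s"
        using x xn that by (auto simp: card_gt_0_iff)
      ultimately show ?thesis unfolding * using y by auto
    qed
    show ?thesis
    proof (cases "y \<le> s \<and> s < x")
      case False
      then have "card (A' \<inter> {1..s}) = card (A \<inter> {1..s})" using card' y by auto
      then show ?thesis using s by (auto simp: height_def)
    next
      case True
      have split: "F \<inter> {1..x} = (F \<inter> {1..s}) \<union> (F \<inter> {s<..x})" for F :: "nat set"
        using True y by auto
      have cs: "card (F \<inter> {1..x}) = card (F \<inter> {1..s}) + card (F \<inter> {s<..x})" for F :: "nat set"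
        unfolding split by (rule card_Un_disjoint) auto
      have "z \<in> A \<union> B" if "z \<in> {s<..x}" for z using gap[of z] True that by simp
      then have "(A \<inter> {s<..x}) \<union> (B \<inter> {s<..x}) = {s<..x}" by blast
      moreover have "card (A \<inter> B \<inter> {s<..x}) \<ge> 1"
        using x True by (auto simp: Suc_le_eq card_gt_0_iff)
      ultimately have "x - s + 1 \<le> card (A \<inter> {s<..x}) + card (B \<inter> {s<..x})"
        using card_Un_Int[of "A \<inter> {s<..x}" "B \<inter> {s<..x}"] by (simp add: Int_ac)
      moreover have "card (A' \<inter> {1..s}) = card (A \<inter> {1..s}) + 1" using card' True by simp
      ultimately have "2 * int t \<le> height A x + height B x"
        using s(2) cs[of A] cs[of B] True unfolding height_def by linarith
      then show ?thesis using xn by blast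
    qed
  qed
qed

text \<open>The only consequence of compression and cross intersection used for the main estimate; unlike
  compression of one family, it is symmetric in \<open>\<A>\<close> and \<open>\<B>\<close>.\<close>

definition common_peak :: "nat \<Rightarrow> nat \<Rightarrow> nat set set \<Rightarrow> nat set set \<Rightarrow> bool" where
  "common_peak n t \<A> \<B> \<longleftrightarrow> (\<forall>A\<in>\<A>. \<forall>B\<in>\<B>. \<exists>s\<le>n. 2 * int t \<le> height A s + height B s)"

lemma common_peak_commute: "common_peak n t \<A> \<B> \<Longrightarrow> common_peak n t \<B> \<A>"
  unfolding common_peak_def by (metis add.commute)

lemma exists_lowest_peak:
  assumes "\<A> \<subseteq> Pow {1..n}" "\<A> \<noteq> {}"
  obtains u A0 where "\<And>A. A \<in> \<A> \<Longrightarrow> \<exists>s\<le>n. int u \<le> height A s"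
    and "A0 \<in> \<A>" "\<And>s. s \<le> n \<Longrightarrow> height A0 s \<le> int u"
proof -
  define pk where "pk A = Max (height A ` {..n})" for A
  have fin: "finite \<A>" using assms(1) by (rule finite_family)
  define U where "U = Min (pk ` \<A>)"
  have "U \<in> pk ` \<A>" unfolding U_def using assms(2) fin by (intro Min_in) auto
  then obtain A0 where A0: "A0 \<in> \<A>" "U = pk A0" by blast
  have le: "height A s \<le> pk A" if "s \<le> n" for A s
    unfolding pk_def using that by (intro Max_ge) auto
  have ex: "\<exists>s\<le>n. height A s = pk A" for A
    using Max_in[of "height A ` {..n}"] unfolding pk_def by fastforce
  have U0: "0 \<le> U" using le[of 0 A0] A0 by simp
  show thesis
  proof (rule that[of "nat U" A0])
    fix A assume "A \<in> \<A>"
    then have "U \<le> pk A" unfolding U_def using fin by (intro Min_le) auto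
    then show "\<exists>s\<le>n. int (nat U) \<le> height A s" using ex[of A] U0 by auto
  qed (use A0 le U0 in auto)
qed

lemma visit_above_twice:
  assumes "int u < height F s" "s \<le> n"
  shows "visits_twice n (int u) F"
proof -
  have "s \<noteq> 0" using assms(1) by (cases "s = 0") auto
  then obtain s' where s': "s = Suc s'" using not0_implies_Suc by blast
  then have "int u \<le> height F s'" using assms(1) by (auto simp: height_Suc split: if_splits)
  then show ?thesis unfolding visits_twice_def using assms s' by (intro exI[of _ s'] exI[of _ s]) auto
qed

lemma mu_le_hit:
  assumes p: "0 < p" "p < 1" and "\<A> \<subseteq> Pow {1..n}" and "\<And>A. A \<in> \<A> \<Longrightarrow> \<exists>s\<le>n. int u \<le> height A s"
  shows "mu n p \<A> \<le> (p / (1 - p)) ^ u"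
proof -
  have "mu n p \<A> \<le> mu n p {F. F \<subseteq> {1..n} \<and> (\<exists>s\<le>n. int u \<le> height F s)}"
    using assms by (intro mu_mono) auto
  also have "\<dots> \<le> (p / (1 - p)) ^ u" using mu_hit[OF p, of "int u" n] by simp
  finally show ?thesis .
qed

definition single_visits :: "nat \<Rightarrow> nat \<Rightarrow> nat set set \<Rightarrow> nat set set" where
  "single_visits n u \<A> = {A \<in> \<A>. \<not> visits_twice n (int u) A}"

lemma single_visits_subset: "single_visits n u \<A> \<subseteq> \<A>"
  by (auto simp: single_visits_def)

lemma mu_le_single_visits:
  assumes p: "0 < p" "p < 1 / 2" and A: "\<A> \<subseteq> Pow {1..n}"
  shows "mu n p \<A> \<le> mu n p (single_visits n u \<A>) + 2 * p * (p / (1 - p)) ^ u"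
proof -
  let ?E = "{F. F \<subseteq> {1..n} \<and> visits_twice n (int u) F}"
  have "mu n p \<A> \<le> mu n p (single_visits n u \<A> \<union> ?E)"
    using A p by (intro mu_mono) (auto simp: single_visits_def)
  also have "\<dots> \<le> mu n p (single_visits n u \<A>) + mu n p ?E"
    using A p by (intro mu_Un_le) (auto simp: single_visits_def)
  also have "mu n p ?E \<le> 2 * p * (p / (1 - p)) ^ u"
    using mu_visits_twice[OF p, of "int u" n] by simp
  finally show ?thesis by simp
qed

lemma product_bound:
  fixes x y :: real
  assumes "a \<le> \<alpha> ^ u * x" "b \<le> \<alpha> ^ v * y" "0 \<le> a" "0 \<le> b" "0 \<le> \<alpha>" "u + v = w"
  shows "a * b \<le> \<alpha> ^ w * (x * y)"
proof -
  have "a * b \<le> (\<alpha> ^ u * x) * (\<alpha> ^ v * y)"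
    by (intro mult_mono) (use assms in \<open>auto intro: order_trans\<close>)
  also have "\<dots> = \<alpha> ^ w * (x * y)" by (simp add: assms(6)[symmetric] power_add mult_ac)
  finally show ?thesis .
qed

section \<open>Large parameters and the common level\<close>

text \<open>What "\<open>t\<close> is large" means. Relative to \<open>\<alpha>^(2t)\<close>, the optimum is at least \<open>\<gamma>\<close>; the number \<open>K\<close>
  bounds how many elements of the ground set \<open>[N]\<close> are missed; the quantity \<open>R\<close> stands for \<open>r + 1\<close>
  and bounds \<open>p t\<close>. For fixed \<open>R\<close>, \<open>\<gamma>\<close>, \<open>K\<close> the remaining conditions hold as soon as \<open>p\<close> is
  of order \<open>1 / t\<close> and \<open>t\<close> is large, see \<open>eventually_large_parameters\<close>.\<close>

locale large_parameters =
  fixes p R \<gamma> :: real and t K :: nat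
  assumes p_pos: "0 < p" and R_ge_1: "1 \<le> R" and \<gamma>_pos: "0 < \<gamma>" and \<gamma>_le_1: "\<gamma> \<le> 1"
    and density: "p * (real t + 2 * real K) \<le> 2 * R"
    and K_large: "24 * R \<le> real K" "(1 / 2) ^ K \<le> \<gamma> / 2"
    and p_small: "100 * (2 * R) ^ K * (real K + 1) * p \<le> \<gamma>"
    and t_large: "5 * K + 1 \<le> t"
    and \<gamma>_le_tail: "\<gamma> \<le> (1 - p) ^ (2 * t)"
begin

abbreviation \<alpha> :: real where "\<alpha> \<equiv> p / (1 - p)"

lemma two_R_pow: "1 \<le> (2 * R) ^ K"
  using R_ge_1 by (intro one_le_power) simp

lemma K_p_small: "100 * (real K + 1) * p \<le> \<gamma>"
proof -
  have "1 * (100 * (real K + 1) * p) \<le> (2 * R) ^ K * (100 * (real K + 1) * p)"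
    by (rule mult_right_mono[OF two_R_pow]) (use p_pos in auto)
  also have "\<dots> = 100 * (2 * R) ^ K * (real K + 1) * p" by (simp only: mult_ac)
  finally show ?thesis using p_small by linarith
qed

lemma p_le: "100 * p \<le> \<gamma>"
proof -
  have "100 * p \<le> 100 * (real K + 1) * p" using p_pos by (simp add: algebra_simps)
  then show ?thesis using K_p_small by linarith
qed

lemma p_bounds: "p \<le> 1 / 100" "p < 1 / 2" "p < 1"
  using p_le \<gamma>_le_1 by auto

lemma alpha_bounds: "0 < \<alpha>" "\<alpha> \<le> 2 * p" "\<alpha> < \<gamma>" "\<alpha> \<le> 1 / 2" "\<alpha> \<le> 1"
proof -
  show "0 < \<alpha>" using p_pos p_bounds by simp
  show *: "\<alpha> \<le> 2 * p" using p_pos p_bounds by (simp add: field_simps)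
  show "\<alpha> < \<gamma>" using * p_le p_pos by linarith
  show "\<alpha> \<le> 1 / 2" "\<alpha> \<le> 1" using * p_bounds by linarith+
qed

text \<open>Each of the alternatives \<open>u + v > 2t\<close>, no single visitor in \<open>\<A>\<close>, no single visitor in
  \<open>\<B>\<close> costs a factor of order \<open>p\<close>. So there are single visitors \<open>A\<close> and \<open>B\<close>, and
  their common peak can only be at height \<open>u\<close> for \<open>A\<close> and \<open>v\<close> for \<open>B\<close>. Since each of them is there only
  once, fixing one of them determines the step for all the others.\<close>

lemma pairs_meet_on_level:
  assumes cp: "common_peak n t \<A> \<B>" and A: "\<A> \<subseteq> Pow {1..n}" and B: "\<B> \<subseteq> Pow {1..n}"
    and big: "\<gamma> * \<alpha> ^ (2 * t) \<le> mu n p \<A> * mu n p \<B>"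
  obtains u v k l where "u + v = 2 * t" "u + 2 * k \<le> n" "u + 2 * k = v + 2 * l"
    and "\<And>A. A \<in> \<A> \<Longrightarrow> \<exists>s\<le>n. int u \<le> height A s"
    and "\<And>B. B \<in> \<B> \<Longrightarrow> \<exists>s\<le>n. int v \<le> height B s"
    and "single_visits n u \<A> \<subseteq> exact_level n (u + 2 * k) k"
    and "single_visits n v \<B> \<subseteq> exact_level n (u + 2 * k) l"
proof -
  note p = p_pos p_bounds(3)
  have "0 < mu n p \<A> * mu n p \<B>"
    using big \<gamma>_pos alpha_bounds(1) by (meson less_le_trans mult_pos_pos zero_less_power)
  then have ne: "\<A> \<noteq> {}" "\<B> \<noteq> {}" by (auto simp: mu_def)
  obtain u A0 where u: "\<And>A. A \<in> \<A> \<Longrightarrow> \<exists>s\<le>n. int u \<le> height A s"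
    and A0: "A0 \<in> \<A>" "\<And>s. s \<le> n \<Longrightarrow> height A0 s \<le> int u"
    using exists_lowest_peak[OF A ne(1)] by blast
  obtain v B0 where v: "\<And>B. B \<in> \<B> \<Longrightarrow> \<exists>s\<le>n. int v \<le> height B s"
    and B0: "B0 \<in> \<B>" "\<And>s. s \<le> n \<Longrightarrow> height B0 s \<le> int v"
    using exists_lowest_peak[OF B ne(2)] by blast
  have muA: "mu n p \<A> \<le> \<alpha> ^ u * 1" using mu_le_hit[OF p A u] by simp
  have muB: "mu n p \<B> \<le> \<alpha> ^ v * 1" using mu_le_hit[OF p B v] by simp
  note nonneg = mu_nonneg[OF p]
  have apos: "0 < \<alpha> ^ (2 * t)" using alpha_bounds(1) by simp
  obtain s0 where "s0 \<le> n" "2 * int t \<le> height A0 s0 + height B0 s0"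
    using cp A0 B0 unfolding common_peak_def by blast
  then have ge: "2 * t \<le> u + v" using A0(2)[of s0] B0(2)[of s0] by linarith
  have eq: "u + v = 2 * t"
  proof (rule ccontr)
    assume "u + v \<noteq> 2 * t"
    then have "2 * t + 1 \<le> u + v" using ge by simp
    have "mu n p \<A> * mu n p \<B> \<le> \<alpha> ^ (u + v) * (1 * 1)"
      by (rule product_bound[OF muA muB nonneg nonneg]) (use alpha_bounds in auto)
    also have "\<dots> \<le> \<alpha> ^ (2 * t + 1)"
      unfolding mult_1_right using alpha_bounds(1,5) by (intro power_decreasing \<open>2 * t + 1 \<le> u + v\<close>) auto
    also have "\<dots> = \<alpha> * \<alpha> ^ (2 * t)" by simp
    also have "\<dots> < \<gamma> * \<alpha> ^ (2 * t)" using apos alpha_bounds(3) by (rule mult_strict_right_mono[rotated])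
    finally show False using big by simp
  qed
  have small: False if "mu n p \<A> * mu n p \<B> \<le> \<alpha> ^ (2 * t) * (2 * p)"
  proof -
    have "\<alpha> ^ (2 * t) * (2 * p) < \<alpha> ^ (2 * t) * \<gamma>"
      using apos p_le p_pos by (intro mult_strict_left_mono) auto
    then show False using that big by (simp add: mult.commute)
  qed
  have "single_visits n u \<A> \<noteq> {}"
  proof
    assume "single_visits n u \<A> = {}"
    then have "mu n p \<A> \<le> \<alpha> ^ u * (2 * p)"
      using mu_le_single_visits[OF p_pos p_bounds(2) A, of u] by (simp add: mu_def mult_ac)
    from product_bound[OF this muB nonneg nonneg _ eq] alpha_bounds(1) show False
      using small by simp
  qed
  then obtain A1 where A1: "A1 \<in> \<A>" "\<not> visits_twice n (int u) A1" by (auto simp: single_visits_def)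
  have "single_visits n v \<B> \<noteq> {}"
  proof
    assume "single_visits n v \<B> = {}"
    then have "mu n p \<B> \<le> \<alpha> ^ v * (2 * p)"
      using mu_le_single_visits[OF p_pos p_bounds(2) B, of v] by (simp add: mu_def mult_ac)
    from product_bound[OF muA this nonneg nonneg _ eq] alpha_bounds(1) show False
      using small by simp
  qed
  then obtain B1 where B1: "B1 \<in> \<B>" "\<not> visits_twice n (int v) B1" by (auto simp: single_visits_def)
  have meet: "\<exists>s\<le>n. height A s = int u \<and> height B s = int v"
    if AB: "A \<in> \<A>" "\<not> visits_twice n (int u) A" "B \<in> \<B>" "\<not> visits_twice n (int v) B" for A B
  proof -
    obtain s where s: "s \<le> n" "2 * int t \<le> height A s + height B s"
      using cp AB(1,3) unfolding common_peak_def by blast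
    have "height A s \<le> int u" using visit_above_twice[of u A s n] AB(2) s(1) by (meson not_le)
    moreover have "height B s \<le> int v" using visit_above_twice[of v B s n] AB(4) s(1) by (meson not_le)
    ultimately have "height A s = int u" "height B s = int v" using s eq by linarith+
    then show ?thesis using s by blast
  qed
  obtain N where N: "N \<le> n" "height A1 N = int u" "height B1 N = int v"
    using meet[OF A1 B1] by blast
  \<comment> \<open>Single visitors are at their peak only at step \<open>N\<close>, so the pairs with \<open>A1\<close> or \<open>B1\<close> fix \<open>N\<close> for all.\<close>
  have uniq: "s = N" if "\<not> visits_twice n w F" "s \<le> n" "height F s = w" "height F N = w" for s w F
    using that N(1) unfolding visits_twice_def by (metis linorder_neqE_nat order_refl)
  define k where "k = N - card (A1 \<inter> {1..N})"
  define l where "l = N - card (B1 \<inter> {1..N})"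
  have c: "card (F \<inter> {1..N}) \<le> N" for F using card_mono[of "{1..N}" "F \<inter> {1..N}"] by simp
  have k: "u + 2 * k = N" using N(2) c[of A1] unfolding k_def height_def by linarith
  have l: "v + 2 * l = N" using N(3) c[of B1] unfolding l_def height_def by linarith
  show thesis
  proof (rule that[OF eq, of k l])
    show "single_visits n u \<A> \<subseteq> exact_level n (u + 2 * k) k"
    proof
      fix A assume "A \<in> single_visits n u \<A>"
      then have A': "A \<in> \<A>" "\<not> visits_twice n (int u) A" by (auto simp: single_visits_def)
      obtain s where s: "s \<le> n" "height A s = int u" "height B1 s = int v" using meet[OF A' B1] by blast
      then have "s = N" using uniq[OF B1(2)] N by simp
      then show "A \<in> exact_level n (u + 2 * k) k"
        using s k A A'(1) by (subst height_eq_iff_exact_level) auto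
    qed
    show "single_visits n v \<B> \<subseteq> exact_level n (u + 2 * k) l"
    proof
      fix B assume "B \<in> single_visits n v \<B>"
      then have B': "B \<in> \<B>" "\<not> visits_twice n (int v) B" by (auto simp: single_visits_def)
      obtain s where s: "s \<le> n" "height A1 s = int u" "height B s = int v" using meet[OF A1 B'] by blast
      then have "s = N" using uniq[OF A1(2)] N by simp
      then show "B \<in> exact_level n (u + 2 * k) l"
        using s k l B B'(1) by (subst height_eq_iff_exact_level) auto
    qed
  qed (use k l N u v in auto)
qed

end

text \<open>A single term of the exponential series at \<open>k\<close>, together with \<open>e \<le> 3\<close>.\<close>

lemma power_self_le_fact: "real k ^ k \<le> 3 ^ k * fact k"
proof -
  have sm: "summable (\<lambda>n. inverse (fact n) * real k ^ n)" by (rule summable_exp)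
  have "inverse (fact k) * real k ^ k \<le> (\<Sum>n. inverse (fact n) * real k ^ n)"
    using sum_le_suminf[OF sm, of "{k}"] by simp
  also have "\<dots> = exp (real k)" by (simp add: exp_def)
  also have "\<dots> = exp 1 ^ k" by (simp add: exp_of_nat_mult[symmetric])
  also have "\<dots> \<le> 3 ^ k" by (intro power_mono exp_le) auto
  finally show ?thesis by (simp add: field_simps)
qed

lemma binomial_power_le:
  fixes p :: real
  assumes "0 \<le> p"
  shows "real (N choose k) * p ^ k \<le> (real N * p) ^ k"
proof -
  have "(N choose k) * 1 \<le> (N choose k) * fact k" by (intro mult_le_mono2) (simp add: fact_ge_1)
  also have "\<dots> \<le> N ^ k" by (rule binomial_fact_pow)
  finally have "real (N choose k) \<le> real N ^ k" by (metis mult.right_neutral of_nat_le_iff of_nat_power)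
  then show ?thesis using assms by (simp add: power_mult_distrib mult_right_mono)
qed

lemma binomial_power_le_fact:
  fixes p :: real
  assumes "0 \<le> p" "0 < k"
  shows "real (N choose k) * p ^ k \<le> (3 * real N * p / real k) ^ k"
proof -
  have "real (N choose k) * fact k \<le> real N ^ k"
    using binomial_fact_pow[of N k] by (metis of_nat_fact of_nat_le_iff of_nat_mult of_nat_power)
  then have "3 ^ k * (real (N choose k) * fact k) \<le> 3 ^ k * real N ^ k" by simp
  moreover have "real (N choose k) * real k ^ k \<le> real (N choose k) * (3 ^ k * fact k)"
    by (intro mult_left_mono power_self_le_fact) auto
  moreover have "real (N choose k) * (3 ^ k * fact k) = 3 ^ k * (real (N choose k) * fact k)"
    by (simp only: mult_ac)
  ultimately have "real (N choose k) * real k ^ k \<le> (3 * real N) ^ k"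
    by (simp only: power_mult_distrib)
  then have "real (N choose k) \<le> (3 * real N / real k) ^ k"
    using assms(2) by (simp add: power_divide field_simps)
  then have "real (N choose k) * p ^ k \<le> (3 * real N / real k) ^ k * p ^ k"
    using assms(1) by (intro mult_right_mono) auto
  then show ?thesis by (simp add: power_mult_distrib[symmetric])
qed

lemma binom_weight_alpha:
  fixes p :: real
  assumes "0 < p" "p < 1"
  shows "binom_weight p (u + 2 * k) k \<le> (p / (1 - p)) ^ u * (real ((u + 2 * k) choose k) * p ^ k)"
proof -
  have e: "u + 2 * k - k = u + k" by simp
  have "binom_weight p (u + 2 * k) k = (p / (1 - p)) ^ u * (real ((u + 2 * k) choose k) * p ^ k) * ((1 - p) ^ u * (1 - p) ^ k)"
    unfolding binom_weight_def e using assms by (simp add: power_add power_divide field_simps)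
  also have "\<dots> \<le> (p / (1 - p)) ^ u * (real ((u + 2 * k) choose k) * p ^ k) * (1 * 1)"
    using assms by (intro mult_left_mono mult_mono power_le_one) auto
  finally show ?thesis by simp
qed

context large_parameters
begin

text \<open>The number of missing elements is nearly Poisson distributed with mean \<open>p t \<le> 2R\<close>, so missing
  \<open>k \<ge> 24 R\<close> elements is exponentially unlikely.\<close>

lemma binom_weight_deep_level:
  assumes "u \<le> t" "K \<le> k"
  shows "binom_weight p (u + 2 * k) k \<le> \<alpha> ^ u * (1 / 2) ^ k"
proof -
  have k0: "0 < k" using K_large(1) R_ge_1 assms(2) by (cases "k = 0") auto
  have tp: "p * real t \<le> 2 * R" 
  proof -
    have "p * real t \<le> p * (real t + 2 * real K)" using p_pos by (intro mult_left_mono) auto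
    then show ?thesis using density by linarith
  qed
  have "3 * real (u + 2 * k) * p = 3 * (p * real u) + 6 * p * real k" by (simp add: algebra_simps)
  also have "p * real u \<le> p * real t" using assms(1) p_pos by (intro mult_left_mono) auto
  also have "3 * (p * real t) + 6 * p * real k \<le> 6 * R + (1 / 4) * real k"
  proof -
    have "6 * p * real k \<le> (1 / 4) * real k" using p_bounds by (intro mult_right_mono) auto
    then show ?thesis using tp by linarith
  qed
  also have "6 * R \<le> (1 / 4) * real k" using K_large(1) assms(2) by linarith
  finally have "3 * real (u + 2 * k) * p / real k \<le> 1 / 2" using k0 by (simp add: field_simps)
  then have "(3 * real (u + 2 * k) * p / real k) ^ k \<le> (1 / 2) ^ k"
    using p_pos by (intro power_mono) auto
  then have "real ((u + 2 * k) choose k) * p ^ k \<le> (1 / 2) ^ k"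
    using binomial_power_le_fact[of p k "u + 2 * k"] p_pos k0 by linarith
  then have "\<alpha> ^ u * (real ((u + 2 * k) choose k) * p ^ k) \<le> \<alpha> ^ u * (1 / 2) ^ k"
    using alpha_bounds(1) by (intro mult_left_mono) auto
  then show ?thesis using binom_weight_alpha[OF p_pos p_bounds(3), of u k] by linarith
qed

lemma product_too_small:
  assumes "mu n p \<A> \<le> \<alpha> ^ u" "mu n p \<B> \<le> \<alpha> ^ v * x" "u + v = 2 * t" "x < \<gamma>"
  shows "mu n p \<A> * mu n p \<B> < \<gamma> * \<alpha> ^ (2 * t)"
proof -
  note nonneg = mu_nonneg[OF p_pos p_bounds(3)]
  have "mu n p \<A> * mu n p \<B> \<le> \<alpha> ^ (2 * t) * (1 * x)"
    by (rule product_bound[OF _ assms(2) nonneg nonneg _ assms(3)]) (use assms(1) alpha_bounds in auto)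
  also have "\<dots> < \<alpha> ^ (2 * t) * \<gamma>" using assms(4) alpha_bounds(1) by simp
  finally show ?thesis by (simp add: mult.commute)
qed

lemma shallow_level:
  assumes A: "\<A> \<subseteq> Pow {1..n}" and B: "\<B> \<subseteq> Pow {1..n}"
    and big: "\<gamma> * \<alpha> ^ (2 * t) \<le> mu n p \<A> * mu n p \<B>"
    and uv: "u + v = 2 * t" "u + 2 * k \<le> n" "u + 2 * k = v + 2 * l"
    and v: "\<And>B. B \<in> \<B> \<Longrightarrow> \<exists>s\<le>n. int v \<le> height B s"
    and sv: "single_visits n u \<A> \<subseteq> exact_level n (u + 2 * k) k"
    and "l \<le> k"
  shows "k < K"
proof (rule ccontr)
  assume "\<not> k < K"
  note p = p_pos p_bounds(3)
  have "u \<le> t" using uv \<open>l \<le> k\<close> by linarith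
  have "mu n p (single_visits n u \<A>) \<le> binom_weight p (u + 2 * k) k"
    using mu_mono[OF p sv exact_level_subset] mu_exact_level[OF p uv(2)] by simp
  also have "\<dots> \<le> \<alpha> ^ u * (1 / 2) ^ k"
    by (rule binom_weight_deep_level) (use \<open>u \<le> t\<close> \<open>\<not> k < K\<close> in auto)
  also have "\<dots> \<le> \<alpha> ^ u * (1 / 2) ^ K"
    using \<open>\<not> k < K\<close> alpha_bounds(1) by (intro mult_left_mono power_decreasing) auto
  finally have "mu n p \<A> \<le> \<alpha> ^ u * ((1 / 2) ^ K + 2 * p)"
    using mu_le_single_visits[OF p_pos p_bounds(2) A, of u] by (simp add: algebra_simps)
  moreover have "mu n p \<B> \<le> \<alpha> ^ v" by (rule mu_le_hit[OF p B v])
  moreover have "(1 / 2) ^ K + 2 * p < \<gamma>" using K_large(2) p_le \<gamma>_pos by linarith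
  ultimately have "mu n p \<B> * mu n p \<A> < \<gamma> * \<alpha> ^ (2 * t)"
    using uv(1) product_too_small[of n \<B> v \<A> u "(1 / 2) ^ K + 2 * p"] by simp
  then show False using big by (simp add: mult.commute)
qed

end

section \<open>Sets below the common level\<close>

text \<open>Near step \<open>N\<close> the walk of \<open>F\<close> is low because it is two below \<open>u\<close> at \<open>N\<close> and moves by one per step;
  elsewhere it is at most \<open>u + i\<close>. So it suffices that \<open>B\<close> leaves \<open>v\<close> in both directions with full speed
  until it is \<open>i + 1\<close> below. The last alternative for early steps uses that the height of \<open>F\<close> at step \<open>s\<close> is
  at most \<open>s\<close>.\<close>

lemma heights_stay_below:
  fixes u v :: int and i N n :: nat
  assumes FN: "height F N \<le> u - 2" and Fi: "\<And>s. s \<le> n \<Longrightarrow> height F s \<le> u + int i"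
    and late: "\<And>s. N \<le> s \<Longrightarrow> s \<le> n \<Longrightarrow> height B s \<le> v - int (s - N) \<or> height B s \<le> v - int i - 1"
    and early: "\<And>s. s < N \<Longrightarrow> height B s \<le> v - int (N - s) \<or> height B s \<le> v - int i - 1 \<or> height B s \<le> - int s"
    and uv: "0 < u + v" and s: "s \<le> n"
  shows "height F s + height B s < u + v"
proof (cases "N \<le> s")
  case True
  have "height F s \<le> u - 2 + int (s - N)" using height_lipschitz[OF True, of F] FN by linarith
  then show ?thesis using late[OF True s] Fi[OF s] by linarith
next
  case False
  then have "s < N" by simp
  have "height F s \<le> u - 2 + int (N - s)" using height_lipschitz[of s N F] FN False by linarith
  then show ?thesis using early[OF \<open>s < N\<close>] Fi[OF s] height_le[of F s] uv by linarith
qed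

definition sinking_time :: "nat \<Rightarrow> nat \<Rightarrow> nat \<Rightarrow> nat" where
  "sinking_time n N i = min n (N + i + 1)"

text \<open>Sets that coincide with \<open>X\<close> on \<open>[N]\<close> (for \<open>X \<subseteq> [N]\<close>), contain none of the next \<open>i + 1\<close>
  elements, and whose walk never rises above that level again. The minimum in \<open>sinking_time\<close> covers ground sets
  that end before step \<open>N + i + 1\<close>.\<close>

definition sinking :: "nat \<Rightarrow> nat \<Rightarrow> nat \<Rightarrow> nat set \<Rightarrow> nat set set" where
  "sinking n N i X = {F \<in> cylinder n (sinking_time n N i) X. \<forall>s\<in>{sinking_time n N i..n}. height F s \<le> height X (sinking_time n N i)}"

lemma height_cylinder: "F \<in> cylinder n m X \<Longrightarrow> s \<le> m \<Longrightarrow> height F s = height X s"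
proof -
  assume "F \<in> cylinder n m X" "s \<le> m"
  then have "F \<inter> {1..s} = X \<inter> {1..s}" by (auto simp: cylinder_def)
  then show ?thesis by (simp add: height_def)
qed

lemma height_beyond:
  assumes "X \<subseteq> {1..N}" "N \<le> s"
  shows "height X s = height X N - int (s - N)"
proof -
  have "X \<inter> {1..s} = X \<inter> {1..N}" using assms by auto
  then show ?thesis using assms(2) by (simp add: height_def)
qed

lemma sinking_late:
  assumes X: "X \<subseteq> {1..N}" and N: "N \<le> n" and F: "F \<in> sinking n N i X" and s: "N \<le> s" "s \<le> n"
  shows "height F s \<le> height X N - int (s - N) \<or> height F s \<le> height X N - int i - 1"
proof -
  let ?m = "sinking_time n N i"
  have Fc: "F \<in> cylinder n ?m X" using F by (simp add: sinking_def)
  show ?thesis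
  proof (cases "s \<le> ?m")
    case True
    then show ?thesis using height_cylinder[OF Fc True] height_beyond[OF X s(1)] by simp
  next
    case False
    then have m: "?m = N + i + 1" using s by (auto simp: sinking_time_def)
    have "height F s \<le> height X ?m" using F False s by (auto simp: sinking_def)
    then show ?thesis using height_beyond[OF X, of ?m] m by simp
  qed
qed

text \<open>The factor \<open>1 - \<alpha>\<close> bounds the probability of never rising above the level reached after the
  descent.\<close>

lemma mu_sinking:
  assumes p: "0 < p" "p < 1 / 2" and X: "X \<subseteq> {1..N}" "card X + l = N" and N: "N \<le> n"
  shows "p ^ (N - l) * (1 - p) ^ (l + i + 1) * (1 - p / (1 - p)) \<le> mu n p (sinking n N i X)"
proof -
  define m where "m = sinking_time n N i"
  have p1: "p < 1" using p by simp
  have m: "N \<le> m" "m \<le> n" "m \<le> N + i + 1" using N by (auto simp: m_def sinking_time_def)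
  have Xm: "X \<subseteq> {1..m}" using X m by auto
  let ?bad = "{F \<in> cylinder n m X. \<exists>s\<in>{m..n}. height X m + 1 \<le> height F s}"
  have "sinking n N i X = cylinder n m X - ?bad"
    by (force simp: sinking_def m_def[symmetric])
  then have eq: "mu n p (sinking n N i X) = set_weight m p X - mu n p ?bad"
    using mu_diff[OF cylinder_subset, of ?bad n m X p] mu_cylinder[OF p(1) p1 m(2) Xm] by auto
  have "mu n p ?bad \<le> set_weight m p X * (p / (1 - p))"
    using mu_hit_cylinder[OF p(1) p1 m(2) Xm, of "height X m + 1"] by simp
  then have lower: "set_weight m p X * (1 - p / (1 - p)) \<le> mu n p (sinking n N i X)"
    unfolding eq right_diff_distrib by linarith
  have "p ^ (N - l) * (1 - p) ^ (l + i + 1) \<le> p ^ (N - l) * (1 - p) ^ (m - card X)"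
    by (intro mult_left_mono power_decreasing) (use p m X in auto)
  also have "\<dots> = set_weight m p X"
  proof -
    have "N - l = card X" using X(2) by simp
    then show ?thesis by (simp only: set_weight_def)
  qed
  finally have "p ^ (N - l) * (1 - p) ^ (l + i + 1) * (1 - p / (1 - p)) \<le> set_weight m p X * (1 - p / (1 - p))"
    by (rule mult_right_mono) (use p in \<open>auto simp: field_simps\<close>)
  then show ?thesis using lower by linarith
qed

definition sinking_union :: "nat \<Rightarrow> nat \<Rightarrow> nat \<Rightarrow> nat set set \<Rightarrow> nat set set" where
  "sinking_union n N i \<X> = (\<Union>X\<in>\<X>. sinking n N i X)"

lemma sinking_subset_exact_level:
  assumes "X \<subseteq> {1..N}" "card X + l = N" "N \<le> n"
  shows "sinking n N i X \<subseteq> exact_level n N l"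
proof
  fix F assume F: "F \<in> sinking n N i X"
  then have Fc: "F \<in> cylinder n (sinking_time n N i) X" by (simp add: sinking_def)
  have "N \<le> sinking_time n N i" using assms by (simp add: sinking_time_def)
  then have "F \<inter> {1..N} = X \<inter> {1..N}" using Fc by (auto simp: cylinder_def)
  also have "\<dots> = X" using assms by auto
  finally show "F \<in> exact_level n N l" using Fc assms by (auto simp: exact_level_def cylinder_def)
qed

lemma sinking_union_subset_exact_level:
  assumes "\<And>X. X \<in> \<X> \<Longrightarrow> X \<subseteq> {1..N} \<and> card X + l = N" "N \<le> n"
  shows "sinking_union n N i \<X> \<subseteq> exact_level n N l"
  using sinking_subset_exact_level assms unfolding sinking_union_def by blast

lemma mu_sinking_union:
  assumes p: "0 < p" "p < 1 / 2" and X: "\<And>X. X \<in> \<X> \<Longrightarrow> X \<subseteq> {1..N} \<and> card X + l = N" and N: "N \<le> n"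
  shows "real (card \<X>) * (p ^ (N - l) * (1 - p) ^ (l + i + 1) * (1 - p / (1 - p)))
    \<le> mu n p (sinking_union n N i \<X>)"
proof -
  have fin: "finite \<X>" by (rule finite_family[of _ 1 N]) (use X in auto)
  have sub: "sinking n N i X \<subseteq> Pow {1..n}" for X by (auto simp: sinking_def cylinder_def)
  have "mu n p (sinking_union n N i \<X>) = (\<Sum>X\<in>\<X>. mu n p (sinking n N i X))"
    unfolding mu_set_weight sinking_union_def
  proof (rule sum.UNION_disjoint[OF fin])
    show "\<forall>X\<in>\<X>. finite (sinking n N i X)" using finite_family[OF sub] by blast
    show "\<forall>X\<in>\<X>. \<forall>Y\<in>\<X>. X \<noteq> Y \<longrightarrow> sinking n N i X \<inter> sinking n N i Y = {}"
      by (auto simp: sinking_def cylinder_def)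
  qed
  moreover have "(\<Sum>X\<in>\<X>. p ^ (N - l) * (1 - p) ^ (l + i + 1) * (1 - p / (1 - p))) \<le> (\<Sum>X\<in>\<X>. mu n p (sinking n N i X))"
    by (intro sum_mono mu_sinking[OF p]) (use X N in auto)
  ultimately show ?thesis by simp
qed

text \<open>A set \<open>F \<in> \<A>\<close> that is too low at step \<open>N\<close> has no common peak with any set of the union, so \<open>\<B>\<close>
  contains none of them.\<close>

lemma sinking_union_avoids:
  assumes cp: "common_peak n t \<A> \<B>" and uv: "u + v = 2 * t" "0 < t"
    and F: "F \<in> \<A>" "height F N \<le> int u - 2" "\<And>s. s \<le> n \<Longrightarrow> height F s \<le> int u + int i"
    and Nv: "N = v + 2 * l" "N \<le> n"
    and X: "\<And>X. X \<in> \<X> \<Longrightarrow> X \<subseteq> {1..N} \<and> card X + l = N"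
    and early: "\<And>X s. X \<in> \<X> \<Longrightarrow> s < N \<Longrightarrow>
      height X s \<le> int v - int (N - s) \<or> height X s \<le> int v - int i - 1 \<or> height X s \<le> - int s"
  shows "sinking_union n N i \<X> \<inter> \<B> = {}"
proof (rule ccontr)
  assume "sinking_union n N i \<X> \<inter> \<B> \<noteq> {}"
  then obtain X B where B: "B \<in> \<B>" "X \<in> \<X>" "B \<in> sinking n N i X" by (auto simp: sinking_union_def)
  have XN: "X \<subseteq> {1..N}" "card X + l = N" using X[OF B(2)] by auto
  have "X \<inter> {1..N} = X" using XN by auto
  then have hX: "height X N = int v" using XN Nv by (simp add: height_def)
  have m: "N \<le> sinking_time n N i" using Nv by (simp add: sinking_time_def)
  have hB: "height B s = height X s" if "s \<le> N" for s
    by (rule height_cylinder[of _ n "sinking_time n N i"]) (use B m that in \<open>auto simp: sinking_def\<close>)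
  have "height F s + height B s < int u + int v" if "s \<le> n" for s
  proof (rule heights_stay_below[OF F(2) F(3) _ _ _ that])
    fix s assume "N \<le> s" "s \<le> n"
    then show "height B s \<le> int v - int (s - N) \<or> height B s \<le> int v - int i - 1"
      using sinking_late[OF XN(1) Nv(2) B(3)] hX by simp
  next
    fix s assume "s < N"
    then show "height B s \<le> int v - int (N - s) \<or> height B s \<le> int v - int i - 1 \<or> height B s \<le> - int s"
      using early[OF B(2)] hB[of s] by simp
  qed (use uv in auto)
  moreover obtain s where "s \<le> n" "2 * int t \<le> height F s + height B s"
    using cp F(1) B(1) unfolding common_peak_def by blast
  ultimately show False using uv(1) by force
qed

text \<open>The generic prefixes: all \<open>l\<close> missing elements come early, so that the walk rises straight to
  \<open>v\<close> during the last \<open>L\<close> steps; before that it is too low because only \<open>N - L\<close> steps have been made.\<close>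

lemma early_gap_prefixes:
  fixes N L l i v :: nat
  assumes N: "N = v + 2 * l" "L = i + 2 * l + 1" "L \<le> N"
  defines "\<X> \<equiv> (\<lambda>M. {1..N} - M) ` {M. M \<subseteq> {1..N - L} \<and> card M = l}"
  shows "card \<X> = (N - L) choose l"
    and "X \<in> \<X> \<Longrightarrow> X \<subseteq> {1..N} \<and> card X + l = N"
    and "X \<in> \<X> \<Longrightarrow> s < N \<Longrightarrow>
      height X s \<le> int v - int (N - s) \<or> height X s \<le> int v - int i - 1 \<or> height X s \<le> - int s"
proof -
  have inj: "inj_on (\<lambda>M. {1..N} - M) {M. M \<subseteq> {1..N - L} \<and> card M = l}"
  proof (rule inj_onI)
    fix M M' assume "M \<in> {M. M \<subseteq> {1..N - L} \<and> card M = l}" "M' \<in> {M. M \<subseteq> {1..N - L} \<and> card M = l}"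
      and eq: "{1..N} - M = {1..N} - M'"
    moreover have "{1..N - L} \<subseteq> {1..N}" by auto
    ultimately have "M \<subseteq> {1..N}" "M' \<subseteq> {1..N}" by blast+
    then show "M = M'" using eq by blast
  qed
  show "card \<X> = (N - L) choose l"
    unfolding \<X>_def by (subst card_image[OF inj]) (simp add: n_subsets)
  assume "X \<in> \<X>"
  then obtain M where M: "M \<subseteq> {1..N - L}" "card M = l" "X = {1..N} - M" by (auto simp: \<X>_def)
  have "{1..N - L} \<subseteq> {1..N}" by auto
  then have MN: "M \<subseteq> {1..N}" "finite M" using M(1) finite_subset[OF M(1)] by blast+
  then have "card X = N - l" using M card_mono[OF _ MN(1)] by (simp add: card_Diff_subset)
  then show "X \<subseteq> {1..N} \<and> card X + l = N" using M(3) N by auto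
  assume s: "s < N"
  show "height X s \<le> int v - int (N - s) \<or> height X s \<le> int v - int i - 1 \<or> height X s \<le> - int s"
  proof (cases "N - L \<le> s")
    case True
    have "M \<subseteq> {1..s}" using M(1) True by (meson atLeastAtMost_iff order.trans subset_iff)
    moreover have "X \<inter> {1..s} = {1..s} - M" using M(3) s by auto
    ultimately have "card (X \<inter> {1..s}) = s - l" "l \<le> s"
      using MN(2) M(2) card_mono[of "{1..s}" M] by (auto simp: card_Diff_subset)
    then show ?thesis using s N(1) by (simp add: height_def)
  next
    case False
    then have "height X s \<le> int v - int i - 1" using height_le[of X s] N by linarith
    then show ?thesis by simp
  qed
qed

text \<open>A single admissible prefix for every \<open>i\<close>: the missing elements are the first \<open>l\<close> ones.\<close>

lemma initial_gap_prefix: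
  fixes N l i v :: nat
  assumes N: "N = v + 2 * l"
  shows "{l + 1..N} \<subseteq> {1..N} \<and> card {l + 1..N} + l = N"
    and "s < N \<Longrightarrow> height {l + 1..N} s \<le> int v - int (N - s) \<or> height {l + 1..N} s \<le> int v - int i - 1
       \<or> height {l + 1..N} s \<le> - int s"
proof -
  show "{l + 1..N} \<subseteq> {1..N} \<and> card {l + 1..N} + l = N" using N by auto
  assume s: "s < N"
  have "{l + 1..N} \<inter> {1..s} = {l + 1..s}" using s by auto
  then have "card ({l + 1..N} \<inter> {1..s}) = s - l" by (simp only: card_atLeastAtMost)
  then have "height {l + 1..N} s = 2 * int (s - l) - int s" by (simp only: height_def)
  then show "height {l + 1..N} s \<le> int v - int (N - s) \<or> height {l + 1..N} s \<le> int v - int i - 1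
       \<or> height {l + 1..N} s \<le> - int s"
    using s N by (cases "l \<le> s") auto
qed

lemma binomial_shift_le: "(M + L) choose Suc l \<le> (M choose Suc l) + L * ((M + L) choose l)"
proof (induction L)
  case (Suc L)
  have "(M + L) choose l \<le> Suc (M + L) choose l" by (cases l) auto
  then have "L * ((M + L) choose l) \<le> L * (Suc (M + L) choose l)" by (rule mult_le_mono2)
  then have "Suc (M + L) choose Suc l \<le> (M choose Suc l) + (Suc (M + L) choose l) + L * (Suc (M + L) choose l)"
    using Suc \<open>(M + L) choose l \<le> _\<close> binomial_Suc_Suc[of "M + L" l] by linarith
  then show ?case by simp
qed simp

context large_parameters
begin

lemma level_size:
  assumes "k \<le> K" "l \<le> K"
  shows "real (t + k + l) * p \<le> 2 * R"
proof -
  have "real (t + k + l) * p \<le> (real t + 2 * real K) * p"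
    using assms p_pos by (intro mult_right_mono) auto
  then show ?thesis using density by (simp add: mult.commute)
qed

lemma level_count_bound:
  assumes "k \<le> K" "l \<le> K" "j \<le> K"
  shows "real ((t + k + l) choose j) * p ^ j \<le> (2 * R) ^ K"
proof -
  have "real ((t + k + l) choose j) * p ^ j \<le> (real (t + k + l) * p) ^ j"
    using binomial_power_le[of p "t + k + l" j] p_pos by simp
  also have "\<dots> \<le> (2 * R) ^ j" using level_size[OF assms(1,2)] p_pos by (intro power_mono) auto
  also have "\<dots> \<le> (2 * R) ^ K" using R_ge_1 assms(3) by (intro power_increasing) auto
  finally show ?thesis .
qed

text \<open>Few sets of \<open>l\<close> missing elements meet the last \<open>L\<close> positions: pick a position there, and
  \<open>l - 1\<close> further elements.\<close>

lemma early_gap_count: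
  assumes kl: "k \<le> K" "l \<le> K" and N: "N = t + k + l" and L: "L \<le> N"
  shows "(real (N choose l) - real ((N - L) choose l)) * p ^ l \<le> real L * p * (2 * R) ^ K"
proof (cases l)
  case 0
  then show ?thesis using p_pos R_ge_1 by simp
next
  case (Suc l')
  have "N choose l \<le> ((N - L) choose l) + L * (N choose l')"
    using binomial_shift_le[of "N - L" L l'] L Suc by simp
  then have "real (N choose l) \<le> real ((N - L) choose l) + real L * real (N choose l')"
    by (metis of_nat_add of_nat_le_iff of_nat_mult)
  then have "(real (N choose l) - real ((N - L) choose l)) * p ^ l \<le> real L * real (N choose l') * p ^ l"
    using p_pos by (intro mult_right_mono) auto
  also have "\<dots> = real L * p * (real (N choose l') * p ^ l')" by (simp add: Suc)
  also have "\<dots> \<le> real L * p * (2 * R) ^ K"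
    unfolding N by (intro mult_left_mono level_count_bound) (use p_pos kl Suc in auto)
  finally show ?thesis .
qed

text \<open>For \<open>i \<le> k + l\<close> the families avoided by \<open>\<B>\<close> make up all but a fraction \<open>O(p)\<close> of the sets that
  miss \<open>l\<close> elements of \<open>[N]\<close>. As the single visitors of \<open>\<B>\<close> are among these sets, \<open>\<B>\<close> would
  have measure \<open>O(p) \<alpha>^v\<close>.\<close>

lemma low_peak_impossible:
  assumes cp: "common_peak n t \<A> \<B>" and A: "\<A> \<subseteq> Pow {1..n}" and B: "\<B> \<subseteq> Pow {1..n}"
    and big: "\<gamma> * \<alpha> ^ (2 * t) \<le> mu n p \<A> * mu n p \<B>"
    and uv: "u + v = 2 * t" "u + 2 * k \<le> n" "u + 2 * k = v + 2 * l"
    and u: "\<And>A. A \<in> \<A> \<Longrightarrow> \<exists>s\<le>n. int u \<le> height A s"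
    and sv: "single_visits n v \<B> \<subseteq> exact_level n (u + 2 * k) l"
    and kl: "k \<le> K" "l \<le> K"
    and F: "F \<in> \<A>" "height F (u + 2 * k) \<le> int u - 2" "\<And>s. s \<le> n \<Longrightarrow> height F s \<le> int u + int i"
  shows "k + l < i"
proof (rule ccontr)
  assume "\<not> k + l < i"
  then have i: "i \<le> k + l" by simp
  note p = p_pos p_bounds(3)
  define N where "N = u + 2 * k"
  define L where "L = i + 2 * l + 1"
  have N: "N = v + 2 * l" "N = t + k + l" "N \<le> n" using uv by (auto simp: N_def)
  have t0: "0 < t" using t_large by simp
  have LN: "L \<le> N" using N(2) t_large kl i by (simp add: L_def)
  define \<X> where "\<X> = (\<lambda>M. {1..N} - M) ` {M. M \<subseteq> {1..N - L} \<and> card M = l}"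
  note \<X> = early_gap_prefixes[OF N(1) L_def LN, folded \<X>_def]
  let ?G = "sinking_union n N i \<X>"
  have avoid: "?G \<inter> \<B> = {}"
    by (rule sinking_union_avoids[OF cp uv(1) t0 F(1) _ F(3) N(1,3)]) (use F(2) \<X>(2,3) in \<open>auto simp: N_def\<close>)
  have GE: "?G \<subseteq> exact_level n N l"
    by (rule sinking_union_subset_exact_level[OF \<X>(2) N(3)])
  let ?w = "p ^ (N - l) * (1 - p) ^ l"
  \<comment> \<open>The probability of sinking after step \<open>N\<close>, which is \<open>1 - O(p)\<close>.\<close>
  let ?x = "(1 - p) ^ (i + 1) * (1 - \<alpha>)"
  have "real ((N - L) choose l) * (p ^ (N - l) * (1 - p) ^ (l + i + 1) * (1 - \<alpha>)) \<le> mu n p ?G"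
    unfolding \<X>(1)[symmetric] by (rule mu_sinking_union[OF p_pos p_bounds(2) \<X>(2) N(3)])
  then have G: "?w * (real ((N - L) choose l) * ?x) \<le> mu n p ?G"
    by (simp add: power_add mult_ac)
  have "mu n p (single_visits n v \<B>) \<le> mu n p (exact_level n N l - ?G)"
    using sv avoid single_visits_subset[of n v \<B>]
    by (intro mu_mono[OF p]) (auto simp: N_def exact_level_def)
  also have "\<dots> = binom_weight p N l - mu n p ?G"
    using mu_diff[OF exact_level_subset GE] mu_exact_level[OF p N(3)] by simp
  also have "\<dots> \<le> ?w * (real (N choose l) - real ((N - L) choose l) * ?x)"
    using G by (simp add: binom_weight_def algebra_simps)
  also have "\<dots> = ?w * ((real (N choose l) - real ((N - L) choose l)) + real ((N - L) choose l) * (1 - ?x))"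
    by (simp add: algebra_simps)
  also have "?w = (\<alpha> ^ v * p ^ l) * (1 - p) ^ (v + l)"
    using N(1) p by (simp add: power_add power_divide field_simps)
  finally have 1: "mu n p (single_visits n v \<B>) \<le> (\<alpha> ^ v * p ^ l) * (1 - p) ^ (v + l) *
     ((real (N choose l) - real ((N - L) choose l)) + real ((N - L) choose l) * (1 - ?x))" .
  have "1 - real (i + 1) * p \<le> (1 - p) ^ (i + 1)"
    using Bernoulli_inequality[of "- p" "i + 1"] p by simp
  then have "(1 - real (i + 1) * p) * (1 - \<alpha>) \<le> ?x"
    using alpha_bounds by (intro mult_right_mono) auto
  moreover have "1 - real (i + 1) * p - \<alpha> \<le> (1 - real (i + 1) * p) * (1 - \<alpha>)"
    using p alpha_bounds(1) by (simp add: algebra_simps)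
  ultimately have x: "1 - ?x \<le> real (i + 3) * p" using alpha_bounds(2) by (simp add: algebra_simps)
  have x0: "?x \<le> 1 * 1"
    by (intro mult_mono power_le_one) (use p alpha_bounds in auto)
  have mono: "(N - L) choose l \<le> N choose l" by (rule binomial_right_mono) simp
  have "p ^ l * ((real (N choose l) - real ((N - L) choose l)) + real ((N - L) choose l) * (1 - ?x))
     = (real (N choose l) - real ((N - L) choose l)) * p ^ l + (real ((N - L) choose l) * p ^ l) * (1 - ?x)"
    by (simp add: algebra_simps)
  also have "\<dots> \<le> real L * p * (2 * R) ^ K + (2 * R) ^ K * (real (i + 3) * p)"
  proof (rule add_mono)
    show "(real (N choose l) - real ((N - L) choose l)) * p ^ l \<le> real L * p * (2 * R) ^ K"
      by (rule early_gap_count[OF kl N(2) LN])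
    have "real ((N - L) choose l) * p ^ l \<le> real (N choose l) * p ^ l"
      using mono p by (intro mult_right_mono) auto
    also have "\<dots> \<le> (2 * R) ^ K" unfolding N(2) by (rule level_count_bound) (use kl in auto)
    finally have "real ((N - L) choose l) * p ^ l \<le> (2 * R) ^ K" .
    then show "(real ((N - L) choose l) * p ^ l) * (1 - ?x) \<le> (2 * R) ^ K * (real (i + 3) * p)"
      by (rule mult_mono[OF _ x]) (use x0 R_ge_1 in auto)
  qed
  also have "\<dots> = (2 * R) ^ K * p * real (L + i + 3)" by (simp add: algebra_simps)
  also have "\<dots> \<le> (2 * R) ^ K * p * (6 * (real K + 1))"
    using R_ge_1 p kl i by (intro mult_left_mono) (auto simp: L_def)
  finally have 2: "p ^ l * ((real (N choose l) - real ((N - L) choose l)) + real ((N - L) choose l) * (1 - ?x))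
     \<le> (2 * R) ^ K * p * (6 * (real K + 1))" (is "?y \<le> _") .
  have y0: "0 \<le> ?y"
    using p x0 mono by (intro mult_nonneg_nonneg add_nonneg_nonneg) auto
  have "mu n p (single_visits n v \<B>) \<le> \<alpha> ^ v * ((1 - p) ^ (v + l) * ?y)" using 1 by (simp add: mult_ac)
  also have "\<dots> \<le> \<alpha> ^ v * (1 * ?y)"
    using y0 p alpha_bounds(1) by (intro mult_left_mono mult_right_mono power_le_one) auto
  also have "\<dots> \<le> \<alpha> ^ v * ((2 * R) ^ K * p * (6 * (real K + 1)))"
    using 2 alpha_bounds(1) by (intro mult_left_mono) auto
  finally have "mu n p \<B> \<le> \<alpha> ^ v * ((2 * R) ^ K * p * (6 * (real K + 1)) + 2 * p)"
    using mu_le_single_visits[OF p_pos p_bounds(2) B, of v] by (simp add: algebra_simps)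
  moreover have "(2 * R) ^ K * p * (6 * (real K + 1)) + 2 * p < \<gamma>"
  proof -
    have "(2 * R) ^ K * p * (6 * (real K + 1)) = 6 / 100 * (100 * (2 * R) ^ K * (real K + 1) * p)" by simp
    also have "\<dots> \<le> 6 / 100 * \<gamma>" using p_small by (intro mult_left_mono) auto
    finally show ?thesis using p_le \<gamma>_pos by linarith
  qed
  moreover have "mu n p \<A> \<le> \<alpha> ^ u" by (rule mu_le_hit[OF p A u])
  ultimately have "mu n p \<A> * mu n p \<B> < \<gamma> * \<alpha> ^ (2 * t)"
    using product_too_small[of n \<A> u \<B> v] uv(1) by blast
  then show False using big by simp
qed

text \<open>Both sides are of order \<open>\<alpha>^(2t)\<close> times a power of \<open>p\<close>: the exponent is \<open>i\<close> on the left and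
  only \<open>k + l\<close> on the right.\<close>

lemma high_peak_cheap:
  assumes kl: "k \<le> K" "l \<le> K" and "uv": "u + v = 2 * t" and i: "k + l < i"
  shows "4 * \<alpha> ^ (u + i) * \<alpha> ^ v
    \<le> (p ^ (v + l) * (1 - p) ^ (l + i + 1) * (1 - \<alpha>)) * (p ^ (u + k) * (1 - p) ^ k)"
proof -
  \<comment> \<open>The surplus of factors \<open>p\<close> on the left, at least one.\<close>
  define m where "m = i - (k + l)"
  have m: "i = k + l + m" "0 < m" using i by (auto simp: m_def)
  define q where "q = 1 - p"
  have q: "0 < q" "q \<le> 1" using p_bounds p_pos by (auto simp: q_def)
  have qbig: "1 / 2 \<le> q ^ (3 * (k + l) + 1)"
  proof -
    have "real (3 * (k + l) + 1) * p \<le> (6 * (real K + 1)) * p"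
      using kl p_pos by (intro mult_right_mono) auto
    also have "\<dots> = 6 / 100 * (100 * (real K + 1) * p)" by simp
    also have "\<dots> \<le> 6 / 100 * 1" using K_p_small \<gamma>_le_1 by (intro mult_left_mono) auto
    finally have "1 / 2 \<le> 1 + real (3 * (k + l) + 1) * (- p)" by simp
    also have "\<dots> \<le> (1 + (- p)) ^ (3 * (k + l) + 1)"
      by (rule Bernoulli_inequality) (use p_bounds in auto)
    finally show ?thesis by (simp add: q_def)
  qed
  have q2: "p / q ^ 2 \<le> 2 * p"
  proof -
    have "99 / 100 \<le> q" using p_bounds by (simp add: q_def)
    then have "(99 / 100)\<^sup>2 \<le> q\<^sup>2" by (intro power_mono) auto
    then have "1 / 2 \<le> q\<^sup>2" by (simp add: power2_eq_square)
    then show ?thesis using q p_pos by (simp add: field_simps)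
  qed
  have "(p / q\<^sup>2) ^ m \<le> (2 * p) ^ m" using q2 p_pos q by (intro power_mono) auto
  also have "\<dots> \<le> (2 * p) ^ 1" using m p_pos p_bounds by (intro power_decreasing) auto
  finally have "p ^ m / q ^ (2 * m) \<le> 2 * p" by (simp add: power_divide power_mult)
  then have "4 * p ^ m \<le> 8 * p * q ^ (2 * m)" using q by (simp add: field_simps)
  also have "8 * p \<le> \<gamma> * (1 / 2) * (1 / 2)" using p_le p_pos by simp
  also have "\<gamma> * (1 / 2) * (1 / 2) \<le> q ^ (2 * t) * q ^ (3 * (k + l) + 1) * (1 - \<alpha>)"
    using \<gamma>_le_tail \<gamma>_pos qbig alpha_bounds(4) q unfolding q_def[symmetric] by (intro mult_mono) auto
  finally have "4 * p ^ m \<le> q ^ (2 * t) * q ^ (3 * (k + l) + 1) * (1 - \<alpha>) * q ^ (2 * m)"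
    using q by (simp add: mult_right_mono)
  also have "\<dots> = (1 - \<alpha>) * q ^ (2 * t + i + (k + l + i + 1))"
    by (simp add: m power_add mult_ac flip: power_mult_distrib)
  finally have main: "4 * p ^ m \<le> (1 - \<alpha>) * q ^ (2 * t + i + (k + l + i + 1))" .
  have "4 * \<alpha> ^ (u + i) * \<alpha> ^ v = 4 * \<alpha> ^ (2 * t + i)"
    by (simp add: power_add[symmetric] uv[symmetric] add_ac)
  also have "\<dots> = p ^ (2 * t + k + l) * (4 * p ^ m) / q ^ (2 * t + i)"
    by (simp add: power_divide q_def[symmetric] m(1) power_add)
  also have "\<dots> \<le> p ^ (2 * t + k + l) * ((1 - \<alpha>) * q ^ (2 * t + i + (k + l + i + 1))) / q ^ (2 * t + i)"
    using main p_pos q by (intro divide_right_mono mult_left_mono) auto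
  also have "\<dots> = p ^ (2 * t + k + l) * (1 - \<alpha>) * q ^ (k + l + i + 1)"
    unfolding power_add[of q "2 * t + i" "k + l + i + 1"] using q by simp
  also have "\<dots> = (p ^ (v + l) * q ^ (l + i + 1) * (1 - \<alpha>)) * (p ^ (u + k) * q ^ k)"
    unfolding uv[symmetric] by (simp add: power_add mult_ac)
  finally show ?thesis by (simp add: q_def)
qed

end

text \<open>Two families lose \<open>S - a\<close> and \<open>T - b\<close> and win \<open>x\<close> and \<open>y\<close>. If every relative gain is at most a
  quarter of the relative loss of the other family, the product drops, by the inequality of arithmetic and
  geometric means.\<close>

lemma trade_inequality:
  fixes a b x y S T :: real
  assumes "0 < S" "0 < T" "0 \<le> a" "a \<le> S" "0 \<le> b" "b \<le> T" "0 \<le> x" "0 \<le> y"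
    and "x * T \<le> 1 / 4 * (T - b) * S" "y * S \<le> 1 / 4 * (S - a) * T"
    and "a < S \<or> b < T"
  shows "(a + x) * (b + y) < S * T"
proof -
  have x: "x / S \<le> 1 / 4 * (1 - b / T)" and y: "y / T \<le> 1 / 4 * (1 - a / S)"
    using assms by (simp_all add: field_simps)
  define X Y where "X = (a + x) / S" and "Y = (b + y) / T"
  have X0: "0 \<le> X" "0 \<le> Y" using assms by (auto simp: X_def Y_def)
  have ab: "a / S \<le> 1" "b / T \<le> 1" "a / S < 1 \<or> b / T < 1" using assms by auto
  have "a' + x' + (b' + y') < 2"
    if "x' \<le> 1 / 4 * (1 - b')" "y' \<le> 1 / 4 * (1 - a')" "a' \<le> 1" "b' \<le> 1" "a' < 1 \<or> b' < 1"
    for a' b' x' y' :: real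
    using that(5)
  proof
    assume "a' < 1" then show ?thesis using that(1-4) by argo
  next
    assume "b' < 1" then show ?thesis using that(1-4) by argo
  qed
  from this[OF x y ab] have "X + Y < 2" unfolding X_def Y_def add_divide_distrib .
  have "4 * (X * Y) \<le> (X + Y)\<^sup>2" using sum_squares_ge_zero[of "X - Y" 0] by (simp add: power2_eq_square algebra_simps)
  also have "(X + Y)\<^sup>2 < 2\<^sup>2" using \<open>X + Y < 2\<close> X0 by (intro power_strict_mono) auto
  finally have "X * Y < 1" by simp
  then have "X * Y * (S * T) < 1 * (S * T)" using assms by (intro mult_strict_right_mono) auto
  moreover have "X * Y * (S * T) = (a + x) * (b + y)" using assms by (simp add: X_def Y_def)
  ultimately show ?thesis by simp
qed

context large_parameters
begin

text \<open>Let \<open>u + i\<close> be the lowest peak among the sets \<open>D\<close> of \<open>\<A>\<close> below the threshold. Then \<open>i > k + l\<close> by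
  \<open>low_peak_impossible\<close>, all of \<open>D\<close> has measure at most \<open>\<alpha>^(u + i)\<close>, and the set with the lowest peak
  already excludes from \<open>\<B>\<close> the sinking sets with initial gap.\<close>

lemma deep_sets_cost:
  assumes cp: "common_peak n t \<A> \<B>" and A: "\<A> \<subseteq> Pow {1..n}" and B: "\<B> \<subseteq> Pow {1..n}"
    and big: "\<gamma> * \<alpha> ^ (2 * t) \<le> mu n p \<A> * mu n p \<B>"
    and uv: "u + v = 2 * t" "u + 2 * k \<le> n" "u + 2 * k = v + 2 * l"
    and u: "\<And>A. A \<in> \<A> \<Longrightarrow> \<exists>s\<le>n. int u \<le> height A s"
    and sv: "single_visits n v \<B> \<subseteq> exact_level n (u + 2 * k) l"
    and kl: "k \<le> K" "l \<le> K"
  defines "N \<equiv> u + 2 * k"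
  defines "D \<equiv> \<A> - threshold n {1..N} k"
  assumes ne: "D \<noteq> {}"
  shows "mu n p D * binom_tail p N l
      \<le> 1 / 4 * (binom_tail p N l - mu n p (\<B> \<inter> threshold n {1..N} l)) * binom_tail p N k"
    and "mu n p (\<B> \<inter> threshold n {1..N} l) < binom_tail p N l"
proof -
  note p = p_pos p_bounds(3)
  note nonneg = mu_nonneg[OF p]
  have N: "N = v + 2 * l" "N = t + k + l" "N \<le> n" using uv by (auto simp: N_def)
  have t0: "0 < t" using t_large by simp
  have D: "D \<subseteq> Pow {1..n}" using A by (auto simp: D_def)
  obtain w F where w: "\<And>A. A \<in> D \<Longrightarrow> \<exists>s\<le>n. int w \<le> height A s"
    and F: "F \<in> D" "\<And>s. s \<le> n \<Longrightarrow> height F s \<le> int w"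
    using exists_lowest_peak[OF D ne] by blast
  have FA: "F \<in> \<A>" using F by (simp add: D_def)
  obtain s where "s \<le> n" "int u \<le> height F s" using u[OF FA] by blast
  then have "u \<le> w" using F(2)[of s] by linarith
  define i where "i = w - u"
  have i: "w = u + i" using \<open>u \<le> w\<close> by (simp add: i_def)
  have Fi: "height F s \<le> int u + int i" if "s \<le> n" for s using F(2)[OF that] i by simp
  have FN: "height F N \<le> int u - 2"
  proof -
    have "card (F \<inter> {1..N}) + k < N" using F(1) A by (auto simp: D_def threshold_def)
    then show ?thesis by (simp add: height_def N_def)
  qed
  have ikl: "k + l < i"
    by (rule low_peak_impossible[OF cp A B big uv u sv kl FA FN[unfolded N_def] Fi])
  have muD: "mu n p D \<le> \<alpha> ^ (u + i)"
    unfolding i[symmetric] by (rule mu_le_hit[OF p D w])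
  have Tl: "binom_tail p N l \<le> \<alpha> ^ v"
  proof -
    have "mu n p (threshold n {1..N} l) \<le> \<alpha> ^ v"
    proof (rule mu_le_hit[OF p threshold_subset])
      fix H assume H: "H \<in> threshold n {1..N} l"
      then have "int N - 2 * int l \<le> height H N"
        by (subst height_ge_iff_threshold[symmetric]) (auto simp: threshold_def)
      then show "\<exists>s\<le>n. int v \<le> height H s" using N(1,3) by (intro exI[of _ N]) auto
    qed
    then show ?thesis using mu_threshold[OF p N(3)] by simp
  qed
  have Tk: "p ^ (u + k) * (1 - p) ^ k \<le> binom_tail p N k"
  proof -
    have "1 \<le> real (N choose k)" using N(2) by (simp add: Suc_le_eq)
    then have "1 * (p ^ (u + k) * (1 - p) ^ k) \<le> real (N choose k) * (p ^ (u + k) * (1 - p) ^ k)"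
      using p by (intro mult_right_mono) auto
    also have "\<dots> = binom_weight p N k"
    proof -
      have "N - k = u + k" by (simp add: N_def)
      then show ?thesis by (simp only: binom_weight_def mult.assoc)
    qed
    finally show ?thesis using binom_weight_le_tail[of p N k] p by simp
  qed
  let ?\<X> = "{{l + 1..N}}"
  let ?G = "sinking_union n N i ?\<X>"
  have X: "X \<subseteq> {1..N} \<and> card X + l = N" if "X \<in> ?\<X>" for X
    using that initial_gap_prefix(1)[OF N(1)] by simp
  have "?G \<inter> \<B> = {}"
    by (rule sinking_union_avoids[OF cp uv(1) t0 FA FN Fi N(1,3) X])
       (use initial_gap_prefix(2)[OF N(1)] in auto)
  have "?G \<subseteq> exact_level n N l" by (rule sinking_union_subset_exact_level[OF X N(3)])
  then have GT: "?G \<subseteq> threshold n {1..N} l" by (auto simp: exact_level_def threshold_def)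
  with \<open>?G \<inter> \<B> = {}\<close> have "mu n p (\<B> \<inter> threshold n {1..N} l) \<le> mu n p (threshold n {1..N} l - ?G)"
    using threshold_subset by (intro mu_mono[OF p]) blast+
  also have "\<dots> = binom_tail p N l - mu n p ?G"
    using mu_diff[OF threshold_subset GT] mu_threshold[OF p N(3)] by simp
  finally have G: "mu n p ?G \<le> binom_tail p N l - mu n p (\<B> \<inter> threshold n {1..N} l)" by simp
  have "N - l = v + l" using N(1) by simp
  moreover have "real (card ?\<X>) * (p ^ (N - l) * (1 - p) ^ (l + i + 1) * (1 - \<alpha>)) \<le> mu n p ?G"
    by (rule mu_sinking_union[OF p_pos p_bounds(2) X N(3)])
  ultimately have g: "p ^ (v + l) * (1 - p) ^ (l + i + 1) * (1 - \<alpha>) \<le> mu n p ?G" (is "?g \<le> _")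
    by simp
  have "0 < ?g" using p alpha_bounds by auto
  then show "mu n p (\<B> \<inter> threshold n {1..N} l) < binom_tail p N l" using G g by linarith
  have "mu n p D * binom_tail p N l \<le> \<alpha> ^ (u + i) * \<alpha> ^ v"
    by (intro mult_mono muD Tl) (use alpha_bounds(1) binom_tail_pos[OF p, of N l] in auto)
  also have "\<dots> \<le> 1 / 4 * (?g * (p ^ (u + k) * (1 - p) ^ k))"
    using high_peak_cheap[OF kl uv(1) ikl] by simp
  also have "\<dots> \<le> 1 / 4 * ((binom_tail p N l - mu n p (\<B> \<inter> threshold n {1..N} l)) * binom_tail p N k)"
    by (intro mult_left_mono mult_mono Tk) (use G g \<open>0 < ?g\<close> p in auto)
  finally show "mu n p D * binom_tail p N l
      \<le> 1 / 4 * (binom_tail p N l - mu n p (\<B> \<inter> threshold n {1..N} l)) * binom_tail p N k"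
    by simp
qed

lemma common_peak_bound:
  assumes cp: "common_peak n t \<A> \<B>" and A: "\<A> \<subseteq> Pow {1..n}" and B: "\<B> \<subseteq> Pow {1..n}"
    and big: "\<gamma> * \<alpha> ^ (2 * t) \<le> mu n p \<A> * mu n p \<B>"
  obtains k l where "t + k + l \<le> n"
    and "mu n p \<A> * mu n p \<B> \<le> binom_tail p (t + k + l) k * binom_tail p (t + k + l) l"
    and "mu n p \<A> * mu n p \<B> = binom_tail p (t + k + l) k * binom_tail p (t + k + l) l \<Longrightarrow>
      \<A> = threshold n {1..t + k + l} k \<and> \<B> = threshold n {1..t + k + l} l"
proof -
  note p = p_pos p_bounds(3)
  note nonneg = mu_nonneg[OF p]
  obtain u v k l where uv: "u + v = 2 * t" "u + 2 * k \<le> n" "u + 2 * k = v + 2 * l"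
    and u: "\<And>A. A \<in> \<A> \<Longrightarrow> \<exists>s\<le>n. int u \<le> height A s"
    and v: "\<And>B. B \<in> \<B> \<Longrightarrow> \<exists>s\<le>n. int v \<le> height B s"
    and su: "single_visits n u \<A> \<subseteq> exact_level n (u + 2 * k) k"
    and sv: "single_visits n v \<B> \<subseteq> exact_level n (u + 2 * k) l"
    using pairs_meet_on_level[OF cp A B big] by metis
  have cp': "common_peak n t \<B> \<A>" by (rule common_peak_commute[OF cp])
  have big': "\<gamma> * \<alpha> ^ (2 * t) \<le> mu n p \<B> * mu n p \<A>" using big by (simp add: mult.commute)
  have uv': "v + u = 2 * t" "v + 2 * l \<le> n" "v + 2 * l = u + 2 * k" using uv by auto
  have su': "single_visits n u \<A> \<subseteq> exact_level n (v + 2 * l) k"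
    and sv': "single_visits n v \<B> \<subseteq> exact_level n (v + 2 * l) l" using su sv uv(3) by auto
  have kl: "k \<le> K" "l \<le> K"
  proof -
    have "k < K" if "l \<le> k" by (rule shallow_level[OF A B big uv v su that])
    moreover have "l < K" if "k \<le> l" by (rule shallow_level[OF B A big' uv' u sv' that])
    ultimately show "k \<le> K" "l \<le> K" by (cases "k \<le> l"; linarith)+
  qed
  define N where "N = t + k + l"
  have N: "u + 2 * k = N" "v + 2 * l = N" "N \<le> n" using uv by (auto simp: N_def)
  define X where "X = threshold n {1..N} k"
  define Y where "Y = threshold n {1..N} l"
  have XY: "mu n p X = binom_tail p N k" "mu n p Y = binom_tail p N l"
    unfolding X_def Y_def by (rule mu_threshold[OF p N(3)])+
  have XYn: "X \<subseteq> Pow {1..n}" "Y \<subseteq> Pow {1..n}" by (auto simp: X_def Y_def threshold_def)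
  note costA = deep_sets_cost[OF cp A B big uv u sv kl, unfolded N(1), folded X_def Y_def]
  note costB = deep_sets_cost[OF cp' B A big' uv' v su' kl(2,1), unfolded N(2), folded X_def Y_def]
  have split: "mu n p \<C> \<le> mu n p (\<C> \<inter> Z) + mu n p (\<C> - Z)" if "\<C> \<subseteq> Pow {1..n}" for \<C> Z
    using mu_Un_le[OF p, of "\<C> \<inter> Z" n "\<C> - Z"] that by (simp add: Int_Diff_Un le_infI1 subset_trans[OF Diff_subset])
  have leX: "mu n p (\<A> \<inter> X) \<le> binom_tail p N k" and leY: "mu n p (\<B> \<inter> Y) \<le> binom_tail p N l"
    unfolding XY[symmetric] by (intro mu_mono[OF p] Int_lower2 XYn)+
  have main: "mu n p \<A> * mu n p \<B> \<le> binom_tail p N k * binom_tail p N l \<and>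
    (mu n p \<A> * mu n p \<B> = binom_tail p N k * binom_tail p N l \<longrightarrow> \<A> = X \<and> \<B> = Y)"
  proof (cases "\<A> - X = {} \<and> \<B> - Y = {}")
    case True
    then have sub: "\<A> \<subseteq> X" "\<B> \<subseteq> Y" by auto
    have le: "mu n p \<A> \<le> mu n p X" "mu n p \<B> \<le> mu n p Y"
      by (rule mu_mono[OF p sub(1) XYn(1)], rule mu_mono[OF p sub(2) XYn(2)])
    have pos: "0 < mu n p X" "0 < mu n p Y" unfolding XY by (auto intro: binom_tail_pos[OF p])
    have "\<A> = X \<and> \<B> = Y" if eq: "mu n p \<A> * mu n p \<B> = mu n p X * mu n p Y"
    proof -
      have "mu n p X * mu n p Y \<le> mu n p \<A> * mu n p Y"
        using eq mult_left_mono[OF le(2) nonneg[of n \<A>]] by linarith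
      then have 1: "mu n p X \<le> mu n p \<A>" using pos by simp
      have "mu n p X * mu n p Y \<le> mu n p X * mu n p \<B>"
        using eq mult_right_mono[OF le(1) nonneg[of n \<B>]] by linarith
      then have 2: "mu n p Y \<le> mu n p \<B>" using pos by simp
      show ?thesis using mu_eq_imp_eq[OF p sub(1) XYn(1) 1] mu_eq_imp_eq[OF p sub(2) XYn(2) 2] by simp
    qed
    moreover have "mu n p \<A> * mu n p \<B> \<le> mu n p X * mu n p Y"
      by (intro mult_mono le nonneg)
    ultimately show ?thesis unfolding XY by blast
  next
    case False
    have "mu n p (\<A> - X) * binom_tail p N l \<le> 1 / 4 * (binom_tail p N l - mu n p (\<B> \<inter> Y)) * binom_tail p N k"
    proof (cases "\<A> - X = {}")
      case True
      then have "mu n p (\<A> - X) = 0" by (simp only: mu_def sum.empty)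
      then show ?thesis using leY binom_tail_pos[OF p, of N k] by simp
    qed (rule costA(1))
    moreover have "mu n p (\<B> - Y) * binom_tail p N k \<le> 1 / 4 * (binom_tail p N k - mu n p (\<A> \<inter> X)) * binom_tail p N l"
    proof (cases "\<B> - Y = {}")
      case True
      then have "mu n p (\<B> - Y) = 0" by (simp only: mu_def sum.empty)
      then show ?thesis using leX binom_tail_pos[OF p, of N l] by simp
    qed (rule costB(1))
    moreover have "mu n p (\<A> \<inter> X) < binom_tail p N k \<or> mu n p (\<B> \<inter> Y) < binom_tail p N l"
      using False costA(2) costB(2) by blast
    ultimately have "(mu n p (\<A> \<inter> X) + mu n p (\<A> - X)) * (mu n p (\<B> \<inter> Y) + mu n p (\<B> - Y))
        < binom_tail p N k * binom_tail p N l"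
      by (intro trade_inequality binom_tail_pos[OF p] nonneg leX leY)
    moreover have "mu n p \<A> * mu n p \<B> \<le> (mu n p (\<A> \<inter> X) + mu n p (\<A> - X)) * (mu n p (\<B> \<inter> Y) + mu n p (\<B> - Y))"
      by (intro mult_mono split A B nonneg add_nonneg_nonneg)
    ultimately show ?thesis by linarith
  qed
  show thesis
    by (rule that[of k l], unfold N_def[symmetric])
       (use N(3) main in \<open>auto simp: X_def Y_def\<close>)
qed

end

section \<open>Undoing a compression\<close>

lemma shift_mem_iff:
  assumes "G \<in> shift i j \<A> \<longleftrightarrow> swap i j G \<in> shift i j \<A>"
  shows "G \<in> \<A> \<longleftrightarrow> G \<in> shift i j \<A>"
  by (cases rule: shift_pair_cases[of G i j \<A>]) (use assms in auto)

text \<open>When compression separates a pair, the family contained exactly one of its two members.\<close>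

lemma shift_separated:
  assumes "G \<in> shift i j \<A>" "swap i j G \<notin> shift i j \<A>"
  shows "i \<in> G" "j \<notin> G" "swap i j G \<in> \<A> \<longleftrightarrow> G \<notin> \<A>"
proof -
  have "swap i j G \<noteq> G" using assms by metis
  then have "\<not> (i \<in> G \<longleftrightarrow> j \<in> G)" using swap_eq_self by blast
  moreover have "\<not> (j \<in> G \<and> i \<notin> G)" using assms by (auto simp: shift_def split: if_splits)
  ultimately show ij: "i \<in> G" "j \<notin> G" by auto
  then show "swap i j G \<in> \<A> \<longleftrightarrow> G \<notin> \<A>" using assms by (auto simp: shift_def split: if_splits)
qed

lemma card_Int_complements:
  assumes "finite T" "M \<subseteq> T" "M' \<subseteq> T" "M \<inter> M' = {}"
  shows "card ((T - M) \<inter> (T - M')) = card T - card M - card M'"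
proof -
  have "(T - M) \<inter> (T - M') = T - (M \<union> M')" by auto
  moreover have "finite M" "finite M'"
    using finite_subset[OF assms(2,1)] finite_subset[OF assms(3,1)] by auto
  ultimately show ?thesis using assms by (simp add: card_Diff_subset card_Un_disjoint)
qed

text \<open>Only the critical sets matter, those which leave the threshold family when \<open>i\<close> is replaced by
  \<open>j\<close>; they miss exactly \<open>k\<close> elements of \<open>T\<close> and contain \<open>i \<in> T\<close>. For each critical \<open>F\<close>, the family
  \<open>\<A>\<close> contains either \<open>F\<close> or its swapped version, and so does \<open>\<B>\<close>. If two critical sets miss disjoint
  parts of \<open>T\<close> and have no common element outside \<open>T\<close>, they meet in exactly \<open>t\<close> elements, one of
  which is \<open>i\<close>; so swapping one of them alone is forbidden and \<open>\<A>\<close>, \<open>\<B>\<close> make the same choice.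
  Since \<open>k < t\<close>, any two critical sets have a common partner of this kind, hence the choice is the same
  everywhere: the families are the threshold family of \<open>T\<close> or of \<open>T\<close> with \<open>j\<close> in place of \<open>i\<close>.\<close>

lemma unshift_threshold:
  assumes cross: "cross_intersecting t \<A> \<B>" and ij: "i \<in> {1..n}" "j \<in> {1..n}" "i < j"
    and T: "T \<subseteq> {1..n}" "card T = t + 2 * k" and kt: "k < t"
    and SA: "shift i j \<A> = threshold n T k" and SB: "shift i j \<B> = threshold n T k"
  obtains T' where "T' \<subseteq> {1..n}" "card T' = t + 2 * k" "\<A> = threshold n T' k" "\<B> = threshold n T' k"
proof -
  define S where "S = threshold n T k"
  define crit where "crit G \<longleftrightarrow> G \<in> S \<and> swap i j G \<notin> S" for G
  have finT: "finite T" using T(1) finite_subset by blast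
  have sub: "swap i j G \<subseteq> {1..n} \<longleftrightarrow> G \<subseteq> {1..n}" for G by (rule swap_subset[OF ij(1,2)])
  have memA: "G \<in> \<A> \<longleftrightarrow> G \<in> S" if "\<not> crit G" "\<not> crit (swap i j G)" for G
    using shift_mem_iff[of G i j \<A>] that by (auto simp: SA crit_def S_def)
  have memB: "G \<in> \<B> \<longleftrightarrow> G \<in> S" if "\<not> crit G" "\<not> crit (swap i j G)" for G
    using shift_mem_iff[of G i j \<B>] that by (auto simp: SB crit_def S_def)
  have sepA: "i \<in> G" "j \<notin> G" "swap i j G \<in> \<A> \<longleftrightarrow> G \<notin> \<A>" if "crit G" for G
    using shift_separated[of G i j \<A>] that by (auto simp: SA crit_def S_def)
  have sepB: "swap i j G \<in> \<B> \<longleftrightarrow> G \<notin> \<B>" if "crit G" for G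
    using shift_separated(3)[of G i j \<B>] that by (auto simp: SB crit_def S_def)
  show thesis
  proof (cases "\<exists>G. crit G")
    case False
    then have "\<A> = S" "\<B> = S" using memA memB by blast+
    then show thesis using that[OF T] by (simp add: S_def)
  next
    case True
    then obtain G0 where G0: "crit G0" by blast
    have critD: "i \<in> T" "j \<notin> T" "card (T - G) = k" "G \<subseteq> {1..n}" if "crit G" for G
    proof -
      have G: "G \<subseteq> {1..n}" "card T \<le> card (G \<inter> T) + k" "card (swap i j G \<inter> T) + k < card T"
        using that sub[of G] by (auto simp: crit_def S_def threshold_def)
      then show "G \<subseteq> {1..n}" by simp
      have less: "card (swap i j G \<inter> T) < card (G \<inter> T)" using G by linarith
      show iT: "i \<in> T"
      proof (rule ccontr)
        assume i: "i \<notin> T"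
        have "G \<inter> T \<subseteq> swap i j G \<inter> T" using i sepA(2)[OF that] by (auto simp: mem_swap Transposition.transpose_def)
        then have "card (G \<inter> T) \<le> card (swap i j G \<inter> T)" using finT by (intro card_mono) auto
        then show False using less by simp
      qed
      show jT: "j \<notin> T"
      proof
        assume j: "j \<in> T"
        then have "swap i j T = T" using iT by (intro swap_eq_self) simp
        then have "swap i j G \<inter> T = swap i j (G \<inter> T)" by (simp add: swap_Int)
        then show False using less by simp
      qed
      have "G \<inter> T \<subseteq> insert i (swap i j G \<inter> T)"
        using jT by (auto simp: mem_swap Transposition.transpose_def)
      then have "card (G \<inter> T) \<le> card (insert i (swap i j G \<inter> T))" using finT by (intro card_mono) auto
      also have "\<dots> \<le> Suc (card (swap i j G \<inter> T))" by (rule card_insert_le_m1) (auto simp: )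
      finally have c: "card (G \<inter> T) = t + k" using G T by linarith
      have "card (T - G) = card T - card (G \<inter> T)" using card_Diff_subset_Int[of T G] finT by (simp add: Int_commute)
      then show "card (T - G) = k" using c T(2) by simp
    qed
    note iT = critD(1)[OF G0] and jT = critD(2)[OF G0]
    have full: "crit (T - M)" if M: "M \<subseteq> T - {i}" "card M = k" for M
    proof -
      have finM: "finite M" and MT: "M \<subseteq> T" using M finT finite_subset by auto
      have "(T - M) \<inter> T = T - M" by auto
      then have 1: "card ((T - M) \<inter> T) = t + k" using card_Diff_subset[OF finM MT] T(2) M by simp
      have "swap i j (T - M) = insert j (T - M - {i})" using M iT jT by (intro swap_downward) auto
      then have "swap i j (T - M) \<inter> T = T - M - {i}" using jT by auto
      moreover have "i \<in> T - M" using M iT by auto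
      ultimately have 2: "card (swap i j (T - M) \<inter> T) = t + k - 1"
        using 1 \<open>(T - M) \<inter> T = T - M\<close> finT by simp
      have "T - M \<subseteq> {1..n}" using T by auto
      then show ?thesis using 1 2 T(2) kt by (auto simp: crit_def S_def threshold_def)
    qed
    have link: "F \<in> \<C> \<longleftrightarrow> T - M \<in> \<D>"
      if F: "crit F" and M: "M \<subseteq> T - {i}" "card M = k" "M \<inter> (T - F) = {}"
        and cr: "cross_intersecting t \<C> \<D>"
        and sC: "\<And>G. crit G \<Longrightarrow> swap i j G \<in> \<C> \<longleftrightarrow> G \<notin> \<C>"
        and sD: "\<And>G. crit G \<Longrightarrow> swap i j G \<in> \<D> \<longleftrightarrow> G \<notin> \<D>" for F M \<C> \<D>
    proof -
      let ?H = "T - M"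
      have H: "crit ?H" by (rule full[OF M(1,2)])
      have MT: "M \<subseteq> T" using M by auto
      have "(T - (T - F)) \<inter> (T - M) = F \<inter> ?H" by auto
      then have FH: "card (F \<inter> ?H) = t"
        using card_Int_complements[OF finT _ MT, of "T - F"] M critD(3)[OF F] T(2) by (auto simp: Int_commute)
      have iFH: "i \<in> F \<inter> ?H" using sepA(1)[OF F] sepA(1)[OF H] by simp
      have fin: "finite (F \<inter> ?H)" using finT by simp
      have d: "card (F \<inter> ?H - {i}) < t" using FH iFH fin kt by (simp add: card_Diff_singleton)
      have "F \<inter> swap i j ?H = F \<inter> ?H - {i}"
        using sepA(1,2)[OF F] sepA(1,2)[OF H] by (auto simp: swap_downward)
      then have 1: "\<not> (F \<in> \<C> \<and> swap i j ?H \<in> \<D>)" using cr d unfolding cross_intersecting_def by (metis not_le)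
      have "swap i j F \<inter> ?H = F \<inter> ?H - {i}"
        using sepA(1,2)[OF F] sepA(1,2)[OF H] by (auto simp: swap_downward)
      then have 2: "\<not> (swap i j F \<in> \<C> \<and> ?H \<in> \<D>)" using cr d unfolding cross_intersecting_def by (metis not_le)
      show ?thesis using 1 2 sC[OF F] sD[OF H] by blast
    qed
    \<comment> \<open>At most \<open>2k + 1\<close> of the \<open>t + 2k\<close> elements of \<open>T\<close> are blocked, which leaves \<open>k\<close> free ones.\<close>
    have common: "\<exists>M. M \<subseteq> T - {i} \<and> card M = k \<and> M \<inter> (T - F) = {} \<and> M \<inter> (T - G) = {}"
      if F: "crit F" and G: "crit G" for F G
    proof -
      have "card ((T - F) \<union> (T - G)) \<le> 2 * k"
        using card_Un_le[of "T - F" "T - G"] critD(3)[OF F] critD(3)[OF G] by simp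
      moreover have "card (T - {i}) = t + 2 * k - 1" using iT finT T(2) by simp
      ultimately have "k \<le> card (T - {i} - ((T - F) \<union> (T - G)))"
        using diff_card_le_card_Diff[of "(T - F) \<union> (T - G)" "T - {i}"] finT kt by simp
      then obtain M where "M \<subseteq> T - {i} - ((T - F) \<union> (T - G))" "card M = k"
        using obtain_subset_with_card_n by metis
      then show ?thesis by blast
    qed
    have cross': "cross_intersecting t \<B> \<A>" using cross by (simp add: cross_intersecting_commute)
    have same: "(F \<in> \<A> \<longleftrightarrow> G \<in> \<A>) \<and> (F \<in> \<B> \<longleftrightarrow> G \<in> \<B>) \<and> (F \<in> \<A> \<longleftrightarrow> F \<in> \<B>)" if F: "crit F" and G: "crit G" for F G
    proof -
      have AB: "\<exists>H. crit H \<and> (F' \<in> \<A> \<longleftrightarrow> H \<in> \<B>) \<and> (G' \<in> \<A> \<longleftrightarrow> H \<in> \<B>) \<and> (F' \<in> \<B> \<longleftrightarrow> H \<in> \<A>) \<and> (G' \<in> \<B> \<longleftrightarrow> H \<in> \<A>)"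
        if F': "crit F'" and G': "crit G'" for F' G'
      proof -
        obtain M where M: "M \<subseteq> T - {i}" "card M = k" "M \<inter> (T - F') = {}" "M \<inter> (T - G') = {}"
          using common[OF F' G'] by blast
        show ?thesis
          using full[OF M(1,2)]
            link[OF F' M(1,2,3) cross sepA(3) sepB] link[OF G' M(1,2,4) cross sepA(3) sepB]
            link[OF F' M(1,2,3) cross' sepB sepA(3)] link[OF G' M(1,2,4) cross' sepB sepA(3)] by blast
      qed
      obtain H where H: "crit H" "F \<in> \<A> \<longleftrightarrow> H \<in> \<B>" "G \<in> \<A> \<longleftrightarrow> H \<in> \<B>" "F \<in> \<B> \<longleftrightarrow> H \<in> \<A>" "G \<in> \<B> \<longleftrightarrow> H \<in> \<A>"
        using AB[OF F G] by blast
      have "F \<in> \<B> \<longleftrightarrow> H \<in> \<B>" using AB[OF F H(1)] by blast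
      then show ?thesis using H by blast
    qed
    show thesis
    proof (cases "G0 \<in> \<A>")
      case True
      have c: "G \<in> \<A> \<and> G \<in> \<B>" if "crit G" for G using same[OF G0 that] same[OF G0 G0] True by blast
      have "G \<in> \<A> \<longleftrightarrow> G \<in> S" "G \<in> \<B> \<longleftrightarrow> G \<in> S" for G
      proof -
        consider "crit G" | "crit (swap i j G)" | "\<not> crit G" "\<not> crit (swap i j G)" by blast
        then show "G \<in> \<A> \<longleftrightarrow> G \<in> S" "G \<in> \<B> \<longleftrightarrow> G \<in> S"
          using c[of G] c[of "swap i j G"] sepA(3)[of "swap i j G"] sepB[of "swap i j G"] memA[of G] memB[of G]
          by (cases; auto simp: crit_def)+
      qed
      then have "\<A> = S" "\<B> = S" by blast+
      then show thesis using that[OF T] by (simp add: S_def)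
    next
      case False
      have c: "G \<notin> \<A> \<and> G \<notin> \<B>" if "crit G" for G using same[OF G0 that] same[OF G0 G0] False by blast
      have m: "G \<in> \<A> \<longleftrightarrow> swap i j G \<in> S" "G \<in> \<B> \<longleftrightarrow> swap i j G \<in> S" for G
      proof -
        consider "crit G" | "crit (swap i j G)" | "\<not> crit G" "\<not> crit (swap i j G)" by blast
        then show "G \<in> \<A> \<longleftrightarrow> swap i j G \<in> S" "G \<in> \<B> \<longleftrightarrow> swap i j G \<in> S"
          using c[of G] c[of "swap i j G"] sepA(3)[of "swap i j G"] sepB[of "swap i j G"] memA[of G] memB[of G]
          by (cases; auto simp: crit_def)+
      qed
      have "swap i j G \<in> S \<longleftrightarrow> G \<in> threshold n (swap i j T) k" for G
      proof -
        have "swap i j (swap i j G \<inter> T) = G \<inter> swap i j T" by (simp add: swap_Int)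
        then have "card (swap i j G \<inter> T) = card (G \<inter> swap i j T)" by (metis card_swap)
        then show ?thesis using sub[of G] by (auto simp: S_def threshold_def)
      qed
      then have "\<A> = threshold n (swap i j T) k" "\<B> = threshold n (swap i j T) k" using m by blast+
      then show thesis using that[of "swap i j T"] T sub[of T] by simp
    qed
  qed
qed

section \<open>Isomorphic families\<close>

lemma exists_permutation_onto_prefix:
  assumes T: "T \<subseteq> {1..n}" "card T = N"
  obtains \<pi> where "\<pi> permutes {1..n}" "\<pi> ` T = {1..N}"
proof -
  have finT: "finite T" using T(1) finite_subset by blast
  have Nn: "N \<le> n" using card_mono[OF _ T(1)] T(2) by simp
  obtain f where f: "bij_betw f T {1..N}"
    using finite_same_card_bij[OF finT, of "{1..N}"] T(2) by auto
  have "card ({1..n} - T) = card ({1..n} - {1..N})"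
    using T Nn finT by (simp add: card_Diff_subset)
  then obtain g where g: "bij_betw g ({1..n} - T) ({1..n} - {1..N})"
    using finite_same_card_bij[of "{1..n} - T" "{1..n} - {1..N}"] by auto
  define \<pi> where "\<pi> x = (if x \<in> T then f x else if x \<in> {1..n} then g x else x)" for x
  have 1: "bij_betw \<pi> T {1..N}"
    by (rule bij_betw_cong[THEN iffD1, OF _ f]) (simp add: \<pi>_def)
  have 2: "bij_betw \<pi> ({1..n} - T) ({1..n} - {1..N})"
    by (rule bij_betw_cong[THEN iffD1, OF _ g]) (simp add: \<pi>_def)
  have "bij_betw \<pi> (T \<union> ({1..n} - T)) ({1..N} \<union> ({1..n} - {1..N}))"
    by (rule bij_betw_combine[OF 1 2]) auto
  moreover have "T \<union> ({1..n} - T) = {1..n}" "{1..N} \<union> ({1..n} - {1..N}) = {1..n}"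
    using T(1) Nn by auto
  ultimately have "bij_betw \<pi> {1..n} {1..n}" by simp
  then have "\<pi> permutes {1..n}"
    by (rule bij_imp_permutes) (use T(1) in \<open>auto simp: \<pi>_def\<close>)
  moreover have "\<pi> ` T = {1..N}" using 1 by (rule bij_betw_imp_surj_on)
  ultimately show thesis by (rule that)
qed

lemma isomorphic_threshold:
  assumes T: "T \<subseteq> {1..n}" "card T = t + 2 * k"
  shows "isomorphic_families n (threshold n T k) (frankl_family n t k)"
proof -
  obtain \<pi> where \<pi>: "\<pi> permutes {1..n}" "\<pi> ` T = {1..t + 2 * k}"
    using exists_permutation_onto_prefix[OF T] by blast
  have inj: "inj \<pi>" using \<pi>(1) by (rule permutes_inj)
  have mem: "\<pi> ` A \<in> frankl_family n t k \<longleftrightarrow> A \<in> threshold n T k" for A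
  proof -
    have "\<pi> ` A \<inter> {1..t + 2 * k} = \<pi> ` (A \<inter> T)"
      unfolding \<pi>(2)[symmetric] using inj by (simp add: image_Int)
    then have "card (\<pi> ` A \<inter> {1..t + 2 * k}) = card (A \<inter> T)"
      using card_image[OF inj_on_subset[OF inj subset_UNIV], of "A \<inter> T"] by simp
    moreover have "\<pi> ` A \<subseteq> {1..n} \<longleftrightarrow> A \<subseteq> {1..n}"
      using permutes_in_image[OF \<pi>(1)] by auto
    ultimately show ?thesis by (auto simp: frankl_family_threshold threshold_def T(2))
  qed
  have "frankl_family n t k = (\<lambda>A. \<pi> ` A) ` threshold n T k"
  proof
    show "(\<lambda>A. \<pi> ` A) ` threshold n T k \<subseteq> frankl_family n t k" using mem by auto
    show "frankl_family n t k \<subseteq> (\<lambda>A. \<pi> ` A) ` threshold n T k"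
    proof
      fix F assume F: "F \<in> frankl_family n t k"
      have "\<pi> ` (inv \<pi> ` F) = F" using permutes_surj[OF \<pi>(1)] by (simp add: image_f_inv_f)
      then have "inv \<pi> ` F \<in> threshold n T k" using mem[of "inv \<pi> ` F"] F by simp
      then show "F \<in> (\<lambda>A. \<pi> ` A) ` threshold n T k" using \<open>\<pi> ` (inv \<pi> ` F) = F\<close> by (metis imageI)
    qed
  qed
  then show ?thesis using \<pi>(1) by (auto simp: isomorphic_families_def)
qed

lemma mu_isomorphic:
  assumes "isomorphic_families n \<A> \<A>'"
  shows "mu n p \<A>' = mu n p \<A>"
proof -
  obtain \<pi> where \<pi>: "\<pi> permutes {1..n}" "\<A>' = (\<lambda>A. \<pi> ` A) ` \<A>"
    using assms by (auto simp: isomorphic_families_def)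
  have inj: "inj \<pi>" using \<pi>(1) by (rule permutes_inj)
  then have "inj_on (\<lambda>A. \<pi> ` A) \<A>" by (auto simp: inj_on_def inj_image_eq_iff)
  moreover have "card (\<pi> ` A) = card A" for A
    by (rule card_image[OF inj_on_subset[OF inj subset_UNIV]])
  ultimately show ?thesis by (simp add: \<pi>(2) mu_def sum.reindex)
qed

section \<open>The bound and its equality cases\<close>

definition extremal_pair :: "nat \<Rightarrow> real \<Rightarrow> nat \<Rightarrow> nat \<Rightarrow> nat set set \<Rightarrow> nat set set \<Rightarrow> bool" where
  "extremal_pair n p t r \<A> \<B> \<longleftrightarrow> (\<exists>k T. T \<subseteq> {1..n} \<and> card T = t + 2 * k \<and> extremal_index p t r k
     \<and> \<A> = threshold n T k \<and> \<B> = threshold n T k)"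

context large_parameters
begin

text \<open>Induction on the sum of all elements of all members, which drops under every compression that changes one of the
  two families. Uncompressed pairs inherit the bound from their compression and the cases of equality by
  \<open>unshift_threshold\<close>.\<close>

lemma cross_intersecting_bound:
  assumes hi: "p \<le> critical_prob t r" and lo: "\<And>j. Suc j = r \<Longrightarrow> critical_prob t j \<le> p"
    and rt: "r + 2 \<le> t" and V: "\<gamma> * \<alpha> ^ (2 * t) \<le> (central_tail p t r)\<^sup>2"
    and "\<A> \<subseteq> Pow {1..n}" "\<B> \<subseteq> Pow {1..n}" "cross_intersecting t \<A> \<B>"
  shows "mu n p \<A> * mu n p \<B> \<le> (central_tail p t r)\<^sup>2 \<and>
    (mu n p \<A> * mu n p \<B> = (central_tail p t r)\<^sup>2 \<longrightarrow> extremal_pair n p t r \<A> \<B>)"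
  using assms(5-7)
proof (induction "element_sum \<A> + element_sum \<B>" arbitrary: \<A> \<B> rule: less_induct)
  case less
  note A = less.prems(1) and B = less.prems(2) and cross = less.prems(3)
  have t2: "2 \<le> t" using rt by simp
  show ?case
  proof (cases "\<exists>i j. i \<in> {1..n} \<and> j \<in> {1..n} \<and> i < j \<and> (shift i j \<A> \<noteq> \<A> \<or> shift i j \<B> \<noteq> \<B>)")
    case True
    then obtain i j where ij: "i \<in> {1..n}" "j \<in> {1..n}" "i < j"
      and ne: "shift i j \<A> \<noteq> \<A> \<or> shift i j \<B> \<noteq> \<B>" by blast
    have "element_sum (shift i j \<A>) + element_sum (shift i j \<B>) < element_sum \<A> + element_sum \<B>"
      using ne
    proof
      assume "shift i j \<A> \<noteq> \<A>"
      then show ?thesis using element_sum_shift(2)[OF ij A] element_sum_shift(1)[OF ij B] by linarith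
    next
      assume "shift i j \<B> \<noteq> \<B>"
      then show ?thesis using element_sum_shift(1)[OF ij A] element_sum_shift(2)[OF ij B] by linarith
    qed
    from less.hyps[OF this shift_subset[OF ij(1,2) A] shift_subset[OF ij(1,2) B]
        cross_intersecting_shift[OF cross ij(1,2) A B]]
    have IH: "mu n p \<A> * mu n p \<B> \<le> (central_tail p t r)\<^sup>2 \<and>
      (mu n p \<A> * mu n p \<B> = (central_tail p t r)\<^sup>2 \<longrightarrow> extremal_pair n p t r (shift i j \<A>) (shift i j \<B>))"
      unfolding mu_shift[OF ij(1,2) A] mu_shift[OF ij(1,2) B] .
    have "extremal_pair n p t r \<A> \<B>" if ext: "extremal_pair n p t r (shift i j \<A>) (shift i j \<B>)"
    proof -
      obtain k T where T: "T \<subseteq> {1..n}" "card T = t + 2 * k" "extremal_index p t r k"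
        "shift i j \<A> = threshold n T k" "shift i j \<B> = threshold n T k"
        using ext unfolding extremal_pair_def by blast
      have "k < t" using T(3) rt by (auto simp: extremal_index_def)
      obtain T' where "T' \<subseteq> {1..n}" "card T' = t + 2 * k" "\<A> = threshold n T' k" "\<B> = threshold n T' k"
        by (rule unshift_threshold[OF cross ij T(1,2) \<open>k < t\<close> T(4,5)])
      then show ?thesis using T(3) unfolding extremal_pair_def by blast
    qed
    then show ?thesis using IH by blast
  next
    case False
    then have "left_compressed \<A>" using A by (intro left_compressedI) auto
    have cp: "common_peak n t \<A> \<B>"
      unfolding common_peak_def
    proof (intro ballI)
      fix F G assume F: "F \<in> \<A>" and G: "G \<in> \<B>"
      show "\<exists>s\<le>n. 2 * int t \<le> height F s + height G s"
        by (rule compressed_common_peak[OF \<open>left_compressed \<A>\<close> _ F])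
           (use F G A B cross t2 in \<open>auto simp: cross_intersecting_def\<close>)
    qed
    show ?thesis
    proof (cases "mu n p \<A> * mu n p \<B> < (central_tail p t r)\<^sup>2")
      case False
      then have big: "\<gamma> * \<alpha> ^ (2 * t) \<le> mu n p \<A> * mu n p \<B>" using V by linarith
      obtain k l where N: "t + k + l \<le> n"
        and le: "mu n p \<A> * mu n p \<B> \<le> binom_tail p (t + k + l) k * binom_tail p (t + k + l) l"
        and eq: "mu n p \<A> * mu n p \<B> = binom_tail p (t + k + l) k * binom_tail p (t + k + l) l \<Longrightarrow>
          \<A> = threshold n {1..t + k + l} k \<and> \<B> = threshold n {1..t + k + l} l"
        using common_peak_bound[OF cp A B big] by metis
      note tails = tail_product_bound[OF p_pos p_bounds(2) t2 hi lo, of k l]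
      have all_eq: "mu n p \<A> * mu n p \<B> = (central_tail p t r)\<^sup>2"
        "binom_tail p (t + k + l) k * binom_tail p (t + k + l) l = (central_tail p t r)\<^sup>2"
        using False le tails(1) by linarith+
      have kl: "k = l" "extremal_index p t r k" using tails(2)[OF _ all_eq(2)] by auto
      have "\<A> = threshold n {1..t + 2 * k} k \<and> \<B> = threshold n {1..t + 2 * k} k"
        using eq all_eq kl(1) by (simp add: mult_2 add.assoc)
      then have "extremal_pair n p t r \<A> \<B>"
        unfolding extremal_pair_def using kl N by (intro exI[of _ k] exI[of _ "{1..t + 2 * k}"]) auto
      then show ?thesis using all_eq by simp
    qed simp
  qed
qed

end

text \<open>Already the sets that miss exactly \<open>r\<close> elements of \<open>[t + 2r]\<close> suffice: the lower bound on \<open>p\<close>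
  and \<open>(n / r)^r \<le> n choose r\<close> give \<open>((t + 2r) choose r) p^r \<ge> 1\<close>.\<close>

lemma central_tail_lower_bound:
  fixes p :: real and r t :: nat
  assumes p: "0 < p" "p < 1" and lo: "real r / real (t + 2 * r) \<le> p" and \<beta>: "\<beta> \<le> (1 - p) ^ (t + r)" and t: "0 < t"
  shows "\<beta> * (p / (1 - p)) ^ t \<le> central_tail p t r"
proof -
  have "1 \<le> real ((t + 2 * r) choose r) * p ^ r"
  proof (cases "r = 0")
    case False
    have "(real (t + 2 * r) / real r) ^ r \<le> real ((t + 2 * r) choose r)"
      by (rule binomial_ge_n_over_k_pow_k) simp
    then have "(real (t + 2 * r) / real r) ^ r * (real r / real (t + 2 * r)) ^ r \<le> real ((t + 2 * r) choose r) * p ^ r"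
      by (intro mult_mono power_mono lo) auto
    moreover have "(real (t + 2 * r) / real r) ^ r * (real r / real (t + 2 * r)) ^ r = 1"
      using False t by (simp add: power_mult_distrib[symmetric])
    ultimately show ?thesis by simp
  qed simp
  then have "1 * (p ^ t * (1 - p) ^ r) \<le> (real ((t + 2 * r) choose r) * p ^ r) * (p ^ t * (1 - p) ^ r)"
    using p by (intro mult_right_mono) auto
  also have "\<dots> = binom_weight p (t + 2 * r) r"
  proof -
    have "t + 2 * r - r = r + t" by simp
    then show ?thesis by (simp only: binom_weight_def power_add mult_ac)
  qed
  also have "\<dots> \<le> central_tail p t r"
    unfolding central_tail_def by (rule binom_weight_le_tail) (use p in auto)
  finally have 1: "p ^ t * (1 - p) ^ r \<le> central_tail p t r" by simp
  have "\<beta> * (p / (1 - p)) ^ t \<le> (1 - p) ^ (t + r) * (p / (1 - p)) ^ t"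
    using \<beta> p by (intro mult_right_mono) auto
  also have "\<dots> = p ^ t * (1 - p) ^ r" using p by (simp add: power_add power_divide)
  finally show ?thesis using 1 by linarith
qed

lemma exp_le_power_one_minus:
  fixes p c :: real
  assumes p: "0 < p" "p < 1" and "real m * p \<le> c * (1 - p)"
  shows "exp (- c) \<le> (1 - p) ^ m"
proof -
  have "inverse ((1 - p) ^ m) = (1 + p / (1 - p)) ^ m" using p by (simp add: field_simps flip: power_inverse)
  also have "\<dots> \<le> exp (p / (1 - p)) ^ m" by (intro power_mono exp_ge_add_one_self) (use p in auto)
  also have "\<dots> = exp (real m * p / (1 - p))" by (simp add: exp_of_nat_mult[symmetric])
  also have "\<dots> \<le> exp c" using assms by (simp add: field_simps)
  finally have "inverse (exp c) \<le> (1 - p) ^ m" using p by (simp add: field_simps)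
  then show ?thesis by (simp add: exp_minus)
qed

text \<open>The conditions on \<open>p\<close> follow from \<open>p t \<le> r + 1\<close>, and \<open>q^(t + r) \<ge> exp (- (r + 1))\<close>
  dictates the choice \<open>\<gamma> = exp (- 2 (r + 1))\<close>.\<close>

lemma eventually_large_parameters:
  fixes r :: nat
  obtains t0 K :: nat and \<gamma> :: real where "r + 2 \<le> t0"
    and "\<And>t p. t0 \<le> t \<Longrightarrow> 0 < p \<Longrightarrow> p \<le> critical_prob t r \<Longrightarrow>
      (\<And>j. Suc j = r \<Longrightarrow> critical_prob t j \<le> p) \<Longrightarrow>
      large_parameters p (real r + 1) \<gamma> t K \<and> \<gamma> * (p / (1 - p)) ^ (2 * t) \<le> (central_tail p t r)\<^sup>2"
proof -
  define R where "R = real r + 1"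
  define \<beta> where "\<beta> = exp (- R)"
  define \<gamma> where "\<gamma> = \<beta>\<^sup>2"
  have \<beta>: "0 < \<beta>" "\<beta> \<le> 1" by (auto simp: \<beta>_def R_def)
  have \<gamma>: "0 < \<gamma>" "\<gamma> \<le> 1" using \<beta> by (auto simp: \<gamma>_def power_le_one)
  obtain K1 where K1: "(1 / 2 :: real) ^ K1 < \<gamma> / 2" using real_arch_pow_inv[of "\<gamma> / 2" "1 / 2"] \<gamma> by auto
  obtain K2 where K2: "24 * R \<le> real K2" using real_arch_simple by blast
  define K where "K = max K1 K2"
  have "(1 / 2 :: real) ^ K \<le> (1 / 2) ^ K1" by (intro power_decreasing) (auto simp: K_def)
  then have K: "(1 / 2) ^ K \<le> \<gamma> / 2" using K1 by linarith
  have "real K2 \<le> real K" by (simp add: K_def)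
  then have K': "24 * R \<le> real K" using K2 by linarith
  define C where "C = 100 * (2 * R) ^ K * (real K + 1)"
  have C0: "0 \<le> C" by (simp add: C_def R_def)
  obtain T where T: "C * R / \<gamma> \<le> real T" using real_arch_simple by blast
  define t0 where "t0 = max T (5 * K + r + 2)"
  show thesis
  proof (rule that[of t0])
    fix t and p :: real
    assume t: "t0 \<le> t" and p0: "0 < p" and hi: "p \<le> critical_prob t r"
      and lo: "\<And>j. Suc j = r \<Longrightarrow> critical_prob t j \<le> p"
    have tl: "5 * K + 2 \<le> t" "T \<le> t" "0 < t" using t by (auto simp: t0_def)
    have hi': "p * (real t + 2 * real r + 1) \<le> R"
      using hi by (simp add: critical_prob_def R_def pos_le_divide_eq)
    have expand: "p * (real t + 2 * real r + 1) = p * real t + 2 * (p * real r) + p" by (simp add: algebra_simps)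
    have "0 \<le> p * real r" using p0 by simp
    then have tp: "p * real t \<le> R" using hi' expand p0 by linarith
    have "critical_prob t r < 1" using tl by (simp add: critical_prob_def)
    then have p1: "p < 1" using hi by simp
    have dens: "p * (real t + 2 * real K) \<le> 2 * R"
    proof -
      have "p * (2 * real K) \<le> p * real t" using tl p0 by (intro mult_left_mono) auto
      then show ?thesis using tp by (simp add: distrib_left)
    qed
    have small: "C * p \<le> \<gamma>"
    proof -
      have "C * R \<le> \<gamma> * real T" using T \<gamma> by (simp add: field_simps)
      also have "\<dots> \<le> \<gamma> * real t" using tl \<gamma> by simp
      finally have "C * R \<le> \<gamma> * real t" .
      moreover have "C * (p * real t) \<le> C * R" using tp C0 by (rule mult_left_mono)
      ultimately have "(C * p) * real t \<le> \<gamma> * real t" by (simp add: mult.assoc)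
      then show ?thesis using tl by simp
    qed
    have \<beta>tr: "\<beta> \<le> (1 - p) ^ (t + r)"
      unfolding \<beta>_def
    proof (rule exp_le_power_one_minus[OF p0 p1])
      have "p * (real t + 2 * real r + 1) = real (t + r) * p + R * p" by (simp add: R_def algebra_simps)
      then show "real (t + r) * p \<le> R * (1 - p)" using hi' by (simp add: right_diff_distrib)
    qed
    have "(1 - p) ^ (t + r) \<le> (1 - p) ^ t" using p0 p1 by (intro power_decreasing) auto
    then have "\<beta>\<^sup>2 \<le> ((1 - p) ^ t)\<^sup>2" using \<beta>tr \<beta> by (intro power_mono) auto
    also have "\<dots> = (1 - p) ^ (2 * t)" by (simp add: power_mult[symmetric] mult.commute)
    finally have \<gamma>t: "\<gamma> \<le> (1 - p) ^ (2 * t)" by (simp add: \<gamma>_def)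
    have "large_parameters p R \<gamma> t K"
      by unfold_locales (use p0 \<gamma> dens K K' small tl \<gamma>t in \<open>auto simp: R_def C_def\<close>)
    moreover have "\<gamma> * (p / (1 - p)) ^ (2 * t) \<le> (central_tail p t r)\<^sup>2"
    proof -
      have "real r / real (t + 2 * r) \<le> p"
      proof (cases r)
        case (Suc j)
        then have "real r / (real t + 2 * real j + 1) \<le> p" using lo[of j] by (simp add: critical_prob_def add.commute)
        moreover have "real r / real (t + 2 * r) \<le> real r / (real t + 2 * real j + 1)"
          using Suc tl by (intro divide_left_mono) auto
        ultimately show ?thesis by linarith
      qed (use p0 in simp)
      from central_tail_lower_bound[OF p0 p1 this \<beta>tr tl(3)]
      have "(\<beta> * (p / (1 - p)) ^ t)\<^sup>2 \<le> (central_tail p t r)\<^sup>2"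
        using \<beta> p0 p1 by (intro power_mono) auto
      moreover have "(\<beta> * (p / (1 - p)) ^ t)\<^sup>2 = \<gamma> * (p / (1 - p)) ^ (2 * t)"
        by (simp add: \<gamma>_def power_mult_distrib power_mult[symmetric] mult.commute)
      ultimately show ?thesis by simp
    qed
    ultimately show "large_parameters p (real r + 1) \<gamma> t K \<and> \<gamma> * (p / (1 - p)) ^ (2 * t) \<le> (central_tail p t r)\<^sup>2"
      by (simp add: R_def)
  qed (simp add: t0_def)
qed

lemma mu_frankl_family:
  assumes "0 < p" "p < 1" "t + 2 * k \<le> n"
  shows "mu n p (frankl_family n t k) = central_tail p t k"
  unfolding frankl_family_threshold central_tail_def by (rule mu_threshold[OF assms])

theorem theorem2:
  "\<forall>r::nat. \<exists>t0::nat. \<forall>(n::nat) (t::nat) (p::real) (\<A>::nat set set) (\<B>::nat set set).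
     0 < t \<and> t0 \<le> t \<and> t \<le> n \<and> t + 2 * r \<le> n \<and>
     0 < p \<and> p < 1 \<and>
     real r / (real t + 2 * real r - 1) \<le> p \<and>
     p \<le> (real r + 1) / (real t + 2 * real r + 1) \<and>
     \<A> \<subseteq> Pow {1..n} \<and> \<B> \<subseteq> Pow {1..n} \<and> cross_intersecting t \<A> \<B>
     \<longrightarrow>
     mu n p \<A> * mu n p \<B> \<le> (mu n p (frankl_family n t r))\<^sup>2 \<and>
     (mu n p \<A> * mu n p \<B> = (mu n p (frankl_family n t r))\<^sup>2 \<longleftrightarrow>
        (1 \<le> r \<and> \<A> = \<B> \<and> isomorphic_families n \<A> (frankl_family n t (r - 1)) \<and>
           p = real r / (real t + 2 * real r - 1)) \<or>
        (\<A> = \<B> \<and> isomorphic_families n \<A> (frankl_family n t r) \<and>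
           real r / (real t + 2 * real r - 1) \<le> p \<and>
           p \<le> (real r + 1) / (real t + 2 * real r + 1)) \<or>
        (t + 2 * (r + 1) \<le> n \<and> \<A> = \<B> \<and>
           isomorphic_families n \<A> (frankl_family n t (r + 1)) \<and>
           p = (real r + 1) / (real t + 2 * real r + 1)))"
proof
  fix r :: nat
  obtain t0 K :: nat and \<gamma> :: real where rt0: "r + 2 \<le> t0"
    and large: "\<And>t p. t0 \<le> t \<Longrightarrow> 0 < p \<Longrightarrow> p \<le> critical_prob t r \<Longrightarrow>
      (\<And>j. Suc j = r \<Longrightarrow> critical_prob t j \<le> p) \<Longrightarrow>
      large_parameters p (real r + 1) \<gamma> t K \<and> \<gamma> * (p / (1 - p)) ^ (2 * t) \<le> (central_tail p t r)\<^sup>2"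
    by (rule eventually_large_parameters[of r]) blast
  show "\<exists>t0::nat. \<forall>(n::nat) (t::nat) (p::real) (\<A>::nat set set) (\<B>::nat set set).
     0 < t \<and> t0 \<le> t \<and> t \<le> n \<and> t + 2 * r \<le> n \<and>
     0 < p \<and> p < 1 \<and>
     real r / (real t + 2 * real r - 1) \<le> p \<and>
     p \<le> (real r + 1) / (real t + 2 * real r + 1) \<and>
     \<A> \<subseteq> Pow {1..n} \<and> \<B> \<subseteq> Pow {1..n} \<and> cross_intersecting t \<A> \<B>
     \<longrightarrow>
     mu n p \<A> * mu n p \<B> \<le> (mu n p (frankl_family n t r))\<^sup>2 \<and>
     (mu n p \<A> * mu n p \<B> = (mu n p (frankl_family n t r))\<^sup>2 \<longleftrightarrow>
        (1 \<le> r \<and> \<A> = \<B> \<and> isomorphic_families n \<A> (frankl_family n t (r - 1)) \<and>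
           p = real r / (real t + 2 * real r - 1)) \<or>
        (\<A> = \<B> \<and> isomorphic_families n \<A> (frankl_family n t r) \<and>
           real r / (real t + 2 * real r - 1) \<le> p \<and>
           p \<le> (real r + 1) / (real t + 2 * real r + 1)) \<or>
        (t + 2 * (r + 1) \<le> n \<and> \<A> = \<B> \<and>
           isomorphic_families n \<A> (frankl_family n t (r + 1)) \<and>
           p = (real r + 1) / (real t + 2 * real r + 1)))"
  proof (rule exI[of _ t0], intro allI impI, elim conjE)
    fix n t :: nat and p :: real and \<A> \<B> :: "nat set set"
    assume t: "0 < t" "t0 \<le> t" and n: "t \<le> n" "t + 2 * r \<le> n" and p: "0 < p" "p < 1"
      and lo: "real r / (real t + 2 * real r - 1) \<le> p"
      and hi: "p \<le> (real r + 1) / (real t + 2 * real r + 1)"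
      and A: "\<A> \<subseteq> Pow {1..n}" and B: "\<B> \<subseteq> Pow {1..n}" and cross: "cross_intersecting t \<A> \<B>"
    let ?P1 = "1 \<le> r \<and> \<A> = \<B> \<and> isomorphic_families n \<A> (frankl_family n t (r - 1)) \<and>
           p = real r / (real t + 2 * real r - 1)"
    let ?P2 = "\<A> = \<B> \<and> isomorphic_families n \<A> (frankl_family n t r) \<and>
           real r / (real t + 2 * real r - 1) \<le> p \<and> p \<le> (real r + 1) / (real t + 2 * real r + 1)"
    let ?P3 = "t + 2 * (r + 1) \<le> n \<and> \<A> = \<B> \<and>
           isomorphic_families n \<A> (frankl_family n t (r + 1)) \<and>
           p = (real r + 1) / (real t + 2 * real r + 1)"
    have crit_hi: "critical_prob t r = (real r + 1) / (real t + 2 * real r + 1)"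
      by (simp add: critical_prob_def)
    have crit_lo: "critical_prob t j = real r / (real t + 2 * real r - 1)" if "Suc j = r" for j
      using that by (auto simp: critical_prob_def add_ac)
    have hi': "p \<le> critical_prob t r" using hi crit_hi by simp
    have lo': "critical_prob t j \<le> p" if "Suc j = r" for j using crit_lo[OF that] lo by simp
    have t2: "2 \<le> t" and rt: "r + 2 \<le> t" using t rt0 by auto
    have par: "large_parameters p (real r + 1) \<gamma> t K" and V: "\<gamma> * (p / (1 - p)) ^ (2 * t) \<le> (central_tail p t r)\<^sup>2"
      using large[OF t(2) p(1) hi' lo'] by auto
    note bound = large_parameters.cross_intersecting_bound[OF par hi' lo' rt V A B cross]
    have F: "mu n p (frankl_family n t r) = central_tail p t r" by (rule mu_frankl_family[OF p n(2)])
    have "mu n p \<A> * mu n p \<B> = (central_tail p t r)\<^sup>2 \<longleftrightarrow> ?P1 \<or> ?P2 \<or> ?P3"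
    proof
      assume "mu n p \<A> * mu n p \<B> = (central_tail p t r)\<^sup>2"
      then obtain k T where T: "T \<subseteq> {1..n}" "card T = t + 2 * k" "extremal_index p t r k"
        and AT: "\<A> = threshold n T k" "\<B> = threshold n T k"
        using bound unfolding extremal_pair_def by blast
      have iso: "isomorphic_families n \<A> (frankl_family n t k)"
        unfolding AT(1) by (rule isomorphic_threshold[OF T(1,2)])
      have kn: "t + 2 * k \<le> n" using card_mono[OF _ T(1)] T(2) by simp
      have AB: "\<A> = \<B>" using AT by simp
      from T(3) consider "k = r" | "Suc k = r" "p = critical_prob t k" | "k = Suc r" "p = critical_prob t r"
        unfolding extremal_index_def by blast
      then show "?P1 \<or> ?P2 \<or> ?P3"
      proof cases
        case 1
        then show ?thesis using AB iso lo hi by blast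
      next
        case 2
        then have "k = r - 1" "1 \<le> r" by auto
        then have ?P1 using AB iso 2 crit_lo[OF 2(1)] by simp
        then show ?thesis by blast
      next
        case 3
        then have ?P3 using AB iso kn crit_hi by simp
        then show ?thesis by blast
      qed
    next
      have eq: "mu n p \<A> * mu n p \<B> = (central_tail p t r)\<^sup>2"
        if "\<A> = \<B>" "isomorphic_families n \<A> (frankl_family n t k)" "t + 2 * k \<le> n" "extremal_index p t r k" for k
      proof -
        have "mu n p \<A> = central_tail p t k"
          using mu_isomorphic[OF that(2)] mu_frankl_family[OF p that(3)] by simp
        also have "\<dots> = central_tail p t r"
          using central_tail_unimodal(2)[OF p t2 hi' lo'] that(4) by blast
        finally show ?thesis using that(1) by (simp add: power2_eq_square)
      qed
      assume "?P1 \<or> ?P2 \<or> ?P3"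
      then show "mu n p \<A> * mu n p \<B> = (central_tail p t r)\<^sup>2"
      proof (elim disjE)
        assume h: ?P1
        then have "Suc (r - 1) = r" by simp
        then have "extremal_index p t r (r - 1)" using h crit_lo by (auto simp: extremal_index_def)
        then show ?thesis using eq[of "r - 1"] h n by auto
      next
        assume h: ?P2
        have "extremal_index p t r r" by (simp add: extremal_index_def)
        then show ?thesis using eq[of r] h n by blast
      next
        assume h: ?P3
        have "extremal_index p t r (r + 1)" using h crit_hi by (simp add: extremal_index_def)
        then show ?thesis using eq[of "r + 1"] h by blast
      qed
    qed
    then show "mu n p \<A> * mu n p \<B> \<le> (mu n p (frankl_family n t r))\<^sup>2 \<and>
     (mu n p \<A> * mu n p \<B> = (mu n p (frankl_family n t r))\<^sup>2 \<longleftrightarrow> ?P1 \<or> ?P2 \<or> ?P3)"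
      unfolding F using bound by blast
  qed
qed

end
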